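(* Suppose that $-2<s\le d-4$, that $v$ is $\mathcal{C}^2$ in the extended sense on $[0,\infty)$, and that $v''(r)\ge0$ for all $r\in[0,\infty)$. If there exists $R_*\in(0,\infty)$ such that $$R_*^{s+2}\,v'(R_*^2)=\frac{c_{s,d}}{4},$$ then $\mu_{\mathrm{eq}}=\sigma_{R_*}$.
   Context: $d\ge2$ is an integer. $\|\cdot\|$ is the Euclidean norm on $\mathbb{R}^d$, and $\mathcal{P}(\mathbb{R}^d)$ is the set of Borel probability measures on $\mathbb{R}^d$. The Riesz kernel is $K_s(x)=\frac{1}{s\|x\|^s}$ if $s\ne0$ and $K_0(x)=-\log\|x\|$. The external field is $V(x)=v(\|x\|^2)$, where $v:[0,\infty)\to(-\infty,+\infty]$ is lower semicontinuous, bounded from below, and finite on some interval $(a,b)$. The energy of $\mu\in\mathcal{P}(\mathbb{R}^d)$ is $$I_{s,V}(\mu)=\iint\big(K_s(x-y)+V(x)+V(y)\big)\,\mathrm{d}\mu(x)\,\mathrm{d}\mu(y)\in(-\infty,+\infty],$$ and $\mu_{\mathrm{eq}}$ denotes the equilibrium measure, i.e. the unique minimizer of $I_{s,V}$ over $\mathcal{P}(\mathbb{R}^d)$. For $R>0$, $\sigma_R$ is the uniform probability measure on the sphere $\{x\in\mathbb{R}^d:\|x\|=R\}$. The constant is $$c_{s,d}={}_2\mathrm{F}_1\Big(\tfrac s2,\tfrac{2+s-d}{2};\tfrac d2;1\Big)=\frac{\Gamma(\frac d2)\Gamma(d-s-1)}{\Gamma(\frac{d-s}{2})\Gamma(d-\frac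 s2-1)}.$$ A function $f:I\to\mathbb{R}\cup\{\pm\infty\}$ on an interval $I$ is $\mathcal{C}^k$ in the extended sense on $I$ when for each $\ell\in\{0,\dots,k\}$ and $y\in I$, $f^{(\ell)}(y)$ exists as an element of $\mathbb{R}\cup\{\pm\infty\}$ and is finite except at a finite set of values in $I$, and $\lim_{x\to y}f^{(\ell)}(x)=f^{(\ell)}(y)$ (one-sided limits at endpoints of $I$). *)

theory Defs
  imports "HOL-Probability.Probability"
begin

section \<open>Calculus for extended-real-valued functions on an interval\<close>

definition lsc_on :: "real set \<Rightarrow> (real \<Rightarrow> ereal) \<Rightarrow> bool" where
  "lsc_on I f \<longleftrightarrow> (\<forall>y\<in>I. f y \<le> Liminf (at y within I) f)"

text \<open>
  The difference quotient is formed in the extended reals, so that a derivative may be infinite,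
  and so that for instance \<open>f 0 = \<infinity>\<close> with \<open>f\<close> finite on the right of \<open>0\<close> gives the derivative
  \<open>- \<infinity>\<close> at the endpoint \<open>0\<close> of \<open>{0..}\<close>. At endpoints of \<open>I\<close> the limit is one-sided.
\<close>

definition has_ext_deriv :: "real set \<Rightarrow> (real \<Rightarrow> ereal) \<Rightarrow> real \<Rightarrow> ereal \<Rightarrow> bool" where
  "has_ext_deriv I f y D \<longleftrightarrow> ((\<lambda>x. (f x - f y) / ereal (x - y)) \<longlongrightarrow> D) (at y within I)"

definition ext_deriv :: "real set \<Rightarrow> (real \<Rightarrow> ereal) \<Rightarrow> real \<Rightarrow> ereal" where
  "ext_deriv I f y = (THE D. has_ext_deriv I f y D)"

definition Ck_ext_on :: "nat \<Rightarrow> real set \<Rightarrow> (real \<Rightarrow> ereal) \<Rightarrow> bool" where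
  "Ck_ext_on k I f \<longleftrightarrow>
     (\<forall>l<k. \<forall>y\<in>I. \<exists>D. has_ext_deriv I ((ext_deriv I ^^ l) f) y D) \<and>
     (\<forall>l\<le>k. finite {y\<in>I. \<bar>(ext_deriv I ^^ l) f y\<bar> = \<infinity>} \<and>
            (\<forall>y\<in>I. ((ext_deriv I ^^ l) f \<longlongrightarrow> (ext_deriv I ^^ l) f y) (at y within I)))"


section \<open>Riesz energy with a radial external field\<close>

text \<open>
  For \<open>s < 0\<close> and \<open>x = 0\<close> the last branch is \<open>1 / (s * 0) = 0\<close>, which is the correct value of
  the kernel \<open>norm x powr (- s) / s\<close> at the origin.
\<close>

definition riesz_kernel :: "real \<Rightarrow> 'a::euclidean_space \<Rightarrow> ereal" where
  "riesz_kernel s x =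
     (if s \<ge> 0 \<and> x = 0 then \<infinity>
      else if s = 0 then ereal (- ln (norm x))
      else ereal (1 / (s * norm x powr s)))"

definition radial_field :: "(real \<Rightarrow> ereal) \<Rightarrow> 'a::euclidean_space \<Rightarrow> ereal" where
  "radial_field v x = v ((norm x)\<^sup>2)"

text \<open>
  Integral of an extended-real-valued function as positive part minus negative part
  (\<open>e2ennreal\<close> truncates negative values to \<open>0\<close>). If both parts are infinite the value is
  \<open>\<infinity>\<close>; this does not happen for integrands that are bounded below.
\<close>

definition ereal_integral :: "'b measure \<Rightarrow> ('b \<Rightarrow> ereal) \<Rightarrow> ereal" where
  "ereal_integral M f =
     enn2ereal (\<integral>\<^sup>+ z. e2ennreal (f z) \<partial>M) - enn2ereal (\<integral>\<^sup>+ z. e2ennreal (- f z) \<partial>M)"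

definition borel_probability_measures :: "'a::euclidean_space measure set" where
  "borel_probability_measures = {\<mu>. sets \<mu> = sets borel \<and> prob_space \<mu>}"

definition riesz_energy ::
    "real \<Rightarrow> ('a::euclidean_space \<Rightarrow> ereal) \<Rightarrow> 'a measure \<Rightarrow> ereal" where
  "riesz_energy s V \<mu> =
     ereal_integral (\<mu> \<Otimes>\<^sub>M \<mu>) (\<lambda>(x, y). riesz_kernel s (x - y) + V x + V y)"

definition is_energy_minimizer ::
    "real \<Rightarrow> ('a::euclidean_space \<Rightarrow> ereal) \<Rightarrow> 'a measure \<Rightarrow> bool" where
  "is_energy_minimizer s V \<mu> \<longleftrightarrow>
     \<mu> \<in> borel_probability_measures \<and>
     (\<forall>\<nu>\<in>borel_probability_measures. riesz_energy s V \<mu> \<le> riesz_energy s V \<nu>)"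

definition is_equilibrium_measure ::
    "real \<Rightarrow> ('a::euclidean_space \<Rightarrow> ereal) \<Rightarrow> 'a measure \<Rightarrow> bool" where
  "is_equilibrium_measure s V \<mu> \<longleftrightarrow>
     is_energy_minimizer s V \<mu> \<and> (\<forall>\<nu>. is_energy_minimizer s V \<nu> \<longrightarrow> \<nu> = \<mu>)"


section \<open>The uniform measure on a sphere\<close>

text \<open>
  Normalized surface measure, as the image of the uniform distribution on the unit ball under the
  radial projection \<open>x \<mapsto> R x / \<parallel>x\<parallel>\<close>: the mass of a set \<open>A\<close> of directions is the proportion of
  the volume of the ball lying in the cone over \<open>A\<close>. The origin, where the projection is not
  defined, is a null set.
\<close>

definition sphere_uniform :: "real \<Rightarrow> 'a::euclidean_space measure" where
  "sphere_uniform R =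
     distr (uniform_measure lborel (ball 0 1)) borel (\<lambda>x. (R / norm x) *\<^sub>R x)"

lemma sphere_uniform_in_borel_probability_measures:
  "sphere_uniform R \<in> (borel_probability_measures :: 'a::euclidean_space measure set)"
proof -
  have m: "(\<lambda>x::'a. (R / norm x) *\<^sub>R x) \<in> borel_measurable borel"
    by measurable
  have "prob_space (uniform_measure lborel (ball (0::'a) 1))"
    using emeasure_lborel_ball_finite[of "0::'a" 1] content_ball_pos[of 1 "0::'a"]
    by (intro prob_space_uniform_measure) (auto simp: emeasure_eq_ennreal_measure top.not_eq_extremum)
  then interpret P: prob_space "uniform_measure lborel (ball (0::'a) 1)" .
  have "prob_space (sphere_uniform R :: 'a measure)"
    unfolding sphere_uniform_def using m by (intro P.prob_space_distr) auto
  then show ?thesis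
    by (simp add: borel_probability_measures_def sphere_uniform_def)
qed

lemma AE_sphere_uniform:
  assumes "R > 0"
  shows "AE x in (sphere_uniform R :: 'a::euclidean_space measure). x \<in> sphere 0 R"
proof -
  have m: "(\<lambda>x::'a. (R / norm x) *\<^sub>R x) \<in> borel_measurable borel"
    by measurable
  have "AE x::'a in lborel. x \<noteq> 0"
    by (rule AE_lborel_singleton)
  then have "AE x in uniform_measure lborel (ball (0::'a) 1). (R / norm x) *\<^sub>R x \<in> sphere 0 R"
    by (subst AE_uniform_measure)
       (use emeasure_lborel_ball_finite[of "0::'a" 1] content_ball_pos[of 1 "0::'a"] assms in
         \<open>auto simp: emeasure_eq_ennreal_measure top.not_eq_extremum\<close>)
  then show ?thesis
    unfolding sphere_uniform_def using m by (subst AE_distr_iff) auto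
qed


section \<open>The constant\<close>

text \<open>The Gauss hypergeometric function, evaluated as the real sum of its power series.\<close>

definition hyp2F1 :: "real \<Rightarrow> real \<Rightarrow> real \<Rightarrow> real \<Rightarrow> real" where
  "hyp2F1 a b c z = eval_fps (fps_hypergeo [a, b] [c] 1) z"

lemma hyp2F1_series:
  "hyp2F1 a b c z =
     (\<Sum>n. pochhammer a n * pochhammer b n / (pochhammer c n * fact n) * z ^ n)"
  by (simp add: hyp2F1_def eval_fps_def)

definition c_const :: "real \<Rightarrow> nat \<Rightarrow> real" where
  "c_const s d = hyp2F1 (s / 2) ((2 + s - real d) / 2) (real d / 2) 1"

end

theory Submission
  imports Defs
begin

text \<open>
  By convexity of \<open>v\<close>, the field lies above the quadratic field \<open>\<gamma> \<parallel>x\<parallel>\<^sup>2 + const\<close> with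
  \<open>\<gamma> = v'(R\<^sup>2) = c / (4 R powr (s + 2))\<close>, with equality on the sphere of radius \<open>R\<close>; so it is enough
  to treat the quadratic field. There the energy of \<open>\<nu>\<close> exceeds that of \<open>\<sigma>\<close>, the uniform measure on
  the sphere, by the Riesz energy of the signed measure \<open>\<nu> - \<sigma>\<close> plus twice the integral of
  \<open>U + \<gamma> \<parallel>x\<parallel>\<^sup>2\<close> against it, where \<open>U\<close> is the potential of \<open>\<sigma>\<close>. The first term is positive unless
  \<open>\<nu> = \<sigma>\<close>, because the kernel is, up to a constant, a mixture of Gaussians, and a Gaussian is the
  convolution of two Gaussians. The second is nonnegative because \<open>U + \<gamma> \<parallel>x\<parallel>\<^sup>2\<close> is smallest on the
  sphere: the Laplacian of the kernel is a negative multiple of \<open>\<parallel>x\<parallel> powr (- s - 2)\<close>, which is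
  superharmonic exactly when \<open>s \<le> d - 4\<close>; hence \<open>U'(r) / r\<close>, a multiple of the mean of the Laplacian of
  \<open>U\<close> over the ball of radius \<open>r\<close>, is nondecreasing, that is, \<open>U\<close> is convex in \<open>r\<^sup>2\<close>. Since \<open>U\<close>
  need not be twice differentiable at \<open>r = R\<close>, this is done with \<open>\<parallel>x\<parallel>\<^sup>2 + \<epsilon>\<close> in place of \<open>\<parallel>x\<parallel>\<^sup>2\<close>.
  The slope of \<open>U\<close> in \<open>r\<^sup>2\<close> at \<open>r = R\<close> is \<open>- \<gamma>\<close>: it is a multiple of the mean of \<open>(1 - \<tau>) powr (- s / 2)\<close>
  over the unit sphere, \<open>\<tau>\<close> being a coordinate, and its moment expansion is again a hypergeometric
  series at \<open>1\<close>, identified with \<open>c\<close> by Gauss's theorem and the duplication formula.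
\<close>

section \<open>Gauss's summation theorem\<close>

text \<open>Positivity of \<open>c_const s d\<close> shapes the comparison. It makes the quadratic
  field confining, so a measure of finite energy has a finite second moment. Only then are its
  self-energy, its cross energy with the sphere and its integral of the field separately finite, as
  the splitting of the energy requires: for \<open>s \<le> 0\<close> the kernel is unbounded below.
  In that same range the mixture of Gaussians diverges at small \<open>t\<close>, and only
  differences of kernel values are mixtures. The correcting term \<open>exp (- t)\<close> drops out
  of the energy of \<open>\<nu> - \<sigma>\<close> because this signed measure has total mass 0, the
  three energies being weighted 1, -2 and 1. The expansion of the slope has the parameters
  \<open>s / 4\<close>, \<open>s / 4 + 1 / 2\<close>, \<open>d / 2\<close>, not those in the
  definition of \<open>c_const\<close>; both sums become Gamma quotients before they are compared.
  The moments behind it come from invariance under plane rotations, whose infinitesimal form is an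
  integration by parts. The same identity yields the polar form of the Laplacian, so no density of a
  coordinate on the sphere appears.\<close>

definition hyp_term :: "real \<Rightarrow> real \<Rightarrow> real \<Rightarrow> nat \<Rightarrow> real" where
  "hyp_term a b c n = pochhammer a n * pochhammer b n / (pochhammer c n * fact n)"

lemma hyp_term_0 [simp]: "hyp_term a b c 0 = 1"
  by (simp add: hyp_term_def)

lemma hyp_term_Suc:
  assumes "c > 0"
  shows "real (Suc n) * (c + real n) * hyp_term a b c (Suc n)
           = (a + real n) * (b + real n) * hyp_term a b c n"
proof -
  have "pochhammer c n > 0" using assms by (rule pochhammer_pos)
  moreover have "c + real n > 0" using assms by simp
  ultimately show ?thesis
    by (simp add: hyp_term_def pochhammer_Suc divide_simps del: of_nat_Suc)
qed

lemma hyp_term_shift: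
  assumes "c > 0"
  shows "(c + real n) * hyp_term a b (c + 1) n = c * hyp_term a b c n"
proof -
  have "pochhammer c n * (c + real n) = c * pochhammer (c + 1) n"
    using pochhammer_rec[of c n] by (simp add: pochhammer_Suc)
  moreover have "pochhammer c n > 0" "pochhammer (c+1) n > 0" using assms by (auto intro!: pochhammer_pos)
  ultimately show ?thesis
    by (simp add: hyp_term_def divide_simps) (simp add: algebra_simps)
qed

text \<open>Makes the growth of the terms visible: by Euler's limit formula the
  \<open>rGamma_series\<close> quotient converges, so the terms are of order at most
  \<open>n powr (a + b - c - 1)\<close>. The index is \<open>Suc n\<close> because
  \<open>rGamma_series z n\<close> is built on \<open>pochhammer z (n + 1)\<close>.\<close>

lemma hyp_term_rGamma_series:
  assumes "c > 0" "n > 0"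
  shows "hyp_term a b c (Suc n) =
    rGamma_series a n * rGamma_series b n / rGamma_series c n * (real n powr (a + b - c) / real (Suc n))"
proof -
  have *: "pochhammer z (Suc n) = rGamma_series z n * fact n * real n powr z" for z
    using assms(2) by (simp add: rGamma_series_def powr_def)
  have "pochhammer c (Suc n) > 0" using assms(1) by (rule pochhammer_pos)
  then have "rGamma_series c n \<noteq> 0" using * [of c] by auto
  then show ?thesis using assms
    unfolding hyp_term_def * by (simp add: powr_diff powr_add divide_simps)
qed

lemma hyp_term_bound:
  assumes "c > 0"
  obtains M where "M > 0" "\<And>n. n > 0 \<Longrightarrow> \<bar>hyp_term a b c (Suc n)\<bar> \<le> M * (real n powr (a + b - c) / real (Suc n))"
proof -
  have "rGamma c \<noteq> 0" using assms by (auto simp: rGamma_eq_zero_iff nonpos_Ints_def)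
  then have "(\<lambda>n. rGamma_series a n * rGamma_series b n / rGamma_series c n)
      \<longlonglongrightarrow> rGamma a * rGamma b / rGamma c"
    by (intro tendsto_intros rGamma_series_LIMSEQ)
  then have "convergent (\<lambda>n. rGamma_series a n * rGamma_series b n / rGamma_series c n)"
    by (rule convergentI)
  then have "Bseq (\<lambda>n. rGamma_series a n * rGamma_series b n / rGamma_series c n)"
    by (rule convergent_imp_Bseq)
  then obtain M where M: "M > 0" "\<And>n. \<bar>rGamma_series a n * rGamma_series b n / rGamma_series c n\<bar> \<le> M"
    unfolding Bseq_def by auto
  have "\<bar>hyp_term a b c (Suc n)\<bar> \<le> M * (real n powr (a + b - c) / real (Suc n))" if "n > 0" for n
    unfolding hyp_term_rGamma_series[OF assms that] abs_mult[of _ "_ / real (Suc n)"]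
    using M(2)[of n] M(1) by (intro mult_mono) auto
  with M(1) show ?thesis using that by blast
qed

lemma summable_hyp_term:
  assumes "c > 0" "a + b < c"
  shows "summable (\<lambda>n. \<bar>hyp_term a b c n\<bar>)"
proof -
  obtain M where M: "M > 0" "\<And>n. n > 0 \<Longrightarrow> \<bar>hyp_term a b c (Suc n)\<bar> \<le> M * (real n powr (a + b - c) / real (Suc n))"
    using hyp_term_bound[OF assms(1)] by blast
  have "summable (\<lambda>n. M * real n powr (a + b - c - 1))"
    using assms(2) by (intro summable_mult) (simp add: summable_real_powr_iff)
  moreover have "\<bar>hyp_term a b c (Suc n)\<bar> \<le> M * real n powr (a + b - c - 1)" if "n \<ge> 1" for n
  proof -
    have "real n powr (a + b - c) / real (Suc n) \<le> real n powr (a + b - c) / real n"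
      using that by (intro divide_left_mono) auto
    also have "\<dots> = real n powr (a + b - c - 1)" using that by (simp add: powr_diff)
    finally show ?thesis using M(2)[of n] M(1) that
      by (smt (verit, best) mult_left_mono zero_less_one less_le_trans gr0I not_one_le_zero)
  qed
  ultimately have "summable (\<lambda>n. \<bar>hyp_term a b c (Suc n)\<bar>)"
    by - (rule summable_comparison_test[where g = "\<lambda>n. M * real n powr (a + b - c - 1)", rotated],
        auto intro!: exI[of _ 1])
  then show ?thesis by (subst (asm) summable_Suc_iff)
qed

text \<open>Kills the boundary term at infinity in the telescoping sum behind the contiguity
  relation that follows.\<close>

lemma hyp_term_tendsto:
  assumes "c > 0" "a + b < c"
  shows "(\<lambda>n. real n * hyp_term a b c n) \<longlonglongrightarrow> 0"
proof -
  obtain M where M: "M > 0" "\<And>n. n > 0 \<Longrightarrow> \<bar>hyp_term a b c (Suc n)\<bar> \<le> M * (real n powr (a + b - c) / real (Suc n))"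
    using hyp_term_bound[OF assms(1)] by blast
  have "(\<lambda>n. M * real n powr (a + b - c)) \<longlonglongrightarrow> M * 0"
    using assms(2)
    by (intro tendsto_mult tendsto_const tendsto_neg_powr filterlim_real_sequentially) auto
  moreover have "\<bar>real (Suc n) * hyp_term a b c (Suc n)\<bar> \<le> M * real n powr (a + b - c)" if "n \<ge> 1" for n
  proof -
    have "\<bar>real (Suc n) * hyp_term a b c (Suc n)\<bar> \<le> real (Suc n) * (M * (real n powr (a + b - c) / real (Suc n)))"
      unfolding abs_mult using M(2)[of n] that by (intro mult_mono) auto
    then show ?thesis by (simp del: of_nat_Suc)
  qed
  ultimately have "(\<lambda>n. real (Suc n) * hyp_term a b c (Suc n)) \<longlonglongrightarrow> 0"
    unfolding mult_zero_right
    by - (rule Lim_null_comparison[where g = "\<lambda>n. M * real n powr (a + b - c)", rotated],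
        auto intro!: eventually_sequentiallyI[of 1])
  then show ?thesis by (rule LIMSEQ_imp_Suc)
qed

text \<open>Gauss's contiguity relation in the third parameter. Termwise, the difference of the two
  sides is \<open>- c\<close> times an increment of \<open>n * hyp_term a b c n\<close>, and this
  quantity vanishes both at 0 and at infinity.\<close>

lemma suminf_hyp_term_shift:
  assumes "c > 0" "a + b < c"
  shows "c * (c - a - b) * suminf (hyp_term a b c) = (c - a) * (c - b) * suminf (hyp_term a b (c + 1))"
proof -
  have tel: "c * (c - a - b) * hyp_term a b c n - (c - a) * (c - b) * hyp_term a b (c + 1) n
      = - c * (real (Suc n) * hyp_term a b c (Suc n) - real n * hyp_term a b c n)" for n
  proof -
    define t where "t = hyp_term a b c n"
    have pos: "c + real n > 0" using assms(1) by simp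
    have 1: "hyp_term a b (c + 1) n = c * t / (c + real n)"
      using hyp_term_shift[OF assms(1), of n a b] pos by (simp add: t_def field_simps)
    have 2: "real (Suc n) * hyp_term a b c (Suc n) = (a + real n) * (b + real n) * t / (c + real n)"
      using hyp_term_Suc[OF assms(1), of n a b] pos by (simp add: t_def field_simps)
    show ?thesis unfolding 1 2 t_def[symmetric] using pos by (simp add: divide_simps) algebra
  qed
  have s1: "summable (hyp_term a b c)" 
    using summable_hyp_term[OF assms] by (rule summable_rabs_cancel)
  have s2: "summable (hyp_term a b (c+1))" 
    using summable_hyp_term[of "c+1" a b] assms by (simp add: summable_rabs_cancel)
  have "(\<lambda>n. c * (c - a - b) * hyp_term a b c n - (c - a) * (c - b) * hyp_term a b (c + 1) n) sums
     (c * (c - a - b) * suminf (hyp_term a b c) - (c - a) * (c - b) * suminf (hyp_term a b (c + 1)))"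
    by (intro sums_diff sums_mult summable_sums s1 s2)
  moreover have "(\<lambda>n. - c * (real (Suc n) * hyp_term a b c (Suc n) - real n * hyp_term a b c n)) sums (- c * (0 - real 0 * hyp_term a b c 0))"
    by (intro sums_mult telescope_sums hyp_term_tendsto assms)
  ultimately show ?thesis unfolding tel using sums_unique2 by fastforce
qed

lemma suminf_hyp_term_shift_nat:
  assumes "c > 0" "a + b < c"
  shows "pochhammer c n * pochhammer (c - a - b) n * suminf (hyp_term a b c)
      = pochhammer (c - a) n * pochhammer (c - b) n * suminf (hyp_term a b (c + real n))"
proof (induction n)
  case (Suc n)
  have *: "(c + real n) * (c - a - b + real n) * suminf (hyp_term a b (c + real n)) =
     (c - a + real n) * (c - b + real n) * suminf (hyp_term a b (c + real (Suc n)))"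
    using suminf_hyp_term_shift[of "c + real n" a b] assms by (simp add: algebra_simps)
  have "pochhammer c (Suc n) * pochhammer (c - a - b) (Suc n) * suminf (hyp_term a b c)
      = (c + real n) * (c - a - b + real n) * (pochhammer (c - a) n * pochhammer (c - b) n * suminf (hyp_term a b (c + real n)))"
    unfolding Suc.IH[symmetric] pochhammer_Suc by (simp only: ac_simps)
  also have "\<dots> = pochhammer (c - a) n * pochhammer (c - b) n * ((c + real n) * (c - a - b + real n) * suminf (hyp_term a b (c + real n)))"
    by (simp only: ac_simps)
  finally show ?case unfolding * pochhammer_Suc by (simp only: ac_simps)
qed simp

text \<open>Only the zeroth term survives a large third parameter: every later term is at most
  \<open>c / (c + n)\<close> times the corresponding term for \<open>c\<close>, and those are
  absolutely summable.\<close>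

lemma suminf_hyp_term_tendsto_1:
  assumes "c > 0" "a + b < c"
  shows "(\<lambda>n. suminf (hyp_term a b (c + real n))) \<longlonglongrightarrow> 1"
proof -
  define S where "S = (\<Sum>k. \<bar>hyp_term a b c k\<bar>)"
  have bd: "\<bar>hyp_term a b (c + real n) (Suc k)\<bar> \<le> c / (c + real n) * \<bar>hyp_term a b c (Suc k)\<bar>" for n k
  proof -
    have "pochhammer (c + 1) k \<le> pochhammer (c + real n + 1) k"
      unfolding pochhammer_prod using assms(1) by (intro prod_mono) auto
    then have "pochhammer c (Suc k) / c * (c + real n) \<le> pochhammer (c + real n) (Suc k)"
      unfolding pochhammer_rec using assms(1) by simp
    moreover have "pochhammer c (Suc k) > 0" "pochhammer (c + real n) (Suc k) > 0"
      using assms(1) by (auto intro!: pochhammer_pos)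
    ultimately have "1 / pochhammer (c + real n) (Suc k) \<le> c / (c + real n) * (1 / pochhammer c (Suc k))"
      using assms(1) by (simp add: divide_simps mult.commute)
    then have "\<bar>pochhammer a (Suc k) * pochhammer b (Suc k) / fact (Suc k)\<bar> * (1 / pochhammer (c + real n) (Suc k))
       \<le> \<bar>pochhammer a (Suc k) * pochhammer b (Suc k) / fact (Suc k)\<bar> * (c / (c + real n) * (1 / pochhammer c (Suc k)))"
      by (rule mult_left_mono) simp
    then show ?thesis using \<open>pochhammer c (Suc k) > 0\<close> \<open>pochhammer (c + real n) (Suc k) > 0\<close>
      unfolding hyp_term_def by (simp add: abs_mult ac_simps del: fact_Suc pochhammer_Suc)
  qed
  have "\<bar>suminf (hyp_term a b (c + real n)) - 1\<bar> \<le> c * S * (1 / (c + real n))" for n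
  proof -
    have sa: "summable (\<lambda>k. \<bar>hyp_term a b (c + real n) k\<bar>)"
      using assms by (intro summable_hyp_term) auto
    have sc: "summable (\<lambda>k. \<bar>hyp_term a b c k\<bar>)"
      using assms by (intro summable_hyp_term) auto
    have sa': "summable (\<lambda>k. \<bar>hyp_term a b (c + real n) (Suc k)\<bar>)" using sa by (subst summable_Suc_iff)
    have sc': "summable (\<lambda>k. \<bar>hyp_term a b c (Suc k)\<bar>)" using sc by (subst summable_Suc_iff)
    have "suminf (hyp_term a b (c + real n)) - 1 = (\<Sum>k. hyp_term a b (c + real n) (Suc k))"
      using suminf_split_head[OF summable_rabs_cancel[OF sa]] by simp
    also have "\<bar>\<dots>\<bar> \<le> (\<Sum>k. \<bar>hyp_term a b (c + real n) (Suc k)\<bar>)"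
      by (rule summable_rabs[OF sa'])
    also have "\<dots> \<le> (\<Sum>k. c / (c + real n) * \<bar>hyp_term a b c (Suc k)\<bar>)"
      by (intro suminf_le bd sa' summable_mult sc')
    also have "\<dots> = c / (c + real n) * (\<Sum>k. \<bar>hyp_term a b c (Suc k)\<bar>)"
      by (rule suminf_mult[OF sc'])
    also have "(\<Sum>k. \<bar>hyp_term a b c (Suc k)\<bar>) = S - 1"
      using suminf_split_head[OF sc] by (simp add: S_def)
    also have "c / (c + real n) * (S - 1) \<le> c / (c + real n) * S"
      using assms by (intro mult_left_mono) auto
    finally show ?thesis by simp
  qed
  moreover have "(\<lambda>n. c * S * (1 / (c + real n))) \<longlonglongrightarrow> c * S * 0"
    by (intro tendsto_mult tendsto_const tendsto_divide_0[OF tendsto_const] filterlim_at_top_imp_at_infinity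
        filterlim_tendsto_add_at_top[OF tendsto_const] filterlim_real_sequentially)
  ultimately have "(\<lambda>n. suminf (hyp_term a b (c + real n)) - 1) \<longlonglongrightarrow> 0"
    unfolding mult_zero_right
    by - (rule Lim_null_comparison[where g = "\<lambda>n. c * S * (1 / (c + real n))", rotated], auto)
  then show ?thesis by (simp add: LIM_zero_iff)
qed

text \<open>The contiguity relation moves the third parameter to \<open>c + n\<close>, where the sum
  tends to 1. What is left is a quotient of Pochhammer symbols, that is, of Euler's products for
  \<open>rGamma\<close>; the powers of \<open>n\<close> cancel because
  \<open>(c - a) + (c - b) = c + (c - a - b)\<close>.\<close>

lemma Gauss_summation:
  fixes a b c :: real
  assumes "c > 0" "a + b < c" "a < c" "b < c"
  shows "suminf (hyp_term a b c) = Gamma c * Gamma (c - a - b) / (Gamma (c - a) * Gamma (c - b))"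
proof -
  have nz: "rGamma x \<noteq> 0" if "x > 0" for x :: real
    using that by (simp add: rGamma_eq_zero_iff nonpos_Ints_def)
  let ?r = "\<lambda>n. rGamma_series (c - a) n * rGamma_series (c - b) n / (rGamma_series c n * rGamma_series (c - a - b) n)"
  have "?r \<longlonglongrightarrow> rGamma (c - a) * rGamma (c - b) / (rGamma c * rGamma (c - a - b))"
    using nz[of c] nz[of "c - a - b"] assms by (intro tendsto_intros rGamma_series_LIMSEQ) auto
  then have "(\<lambda>n. ?r n * suminf (hyp_term a b (c + real (Suc n)))) \<longlonglongrightarrow>
      rGamma (c - a) * rGamma (c - b) / (rGamma c * rGamma (c - a - b)) * 1"
    by (intro tendsto_mult LIMSEQ_Suc suminf_hyp_term_tendsto_1 assms)
  moreover have "?r n * suminf (hyp_term a b (c + real (Suc n))) = suminf (hyp_term a b c)" if "n > 0" for n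
  proof -
    have *: "pochhammer z (Suc n) = rGamma_series z n * fact n * real n powr z" for z
      using that by (simp add: rGamma_series_def powr_def)
    have "pochhammer c (Suc n) > 0" "pochhammer (c - a - b) (Suc n) > 0" 
      using assms by (auto intro!: pochhammer_pos)
    then have nz': "rGamma_series c n \<noteq> 0" "rGamma_series (c - a - b) n \<noteq> 0" unfolding * by auto
    have pw: "real n powr (c - a) * real n powr (c - b) = real n powr c * real n powr (c - a - b)"
      using that by (simp flip: powr_add add: algebra_simps)
    have "(rGamma_series c n * rGamma_series (c - a - b) n * suminf (hyp_term a b c))
          * (fact n ^ 2 * (real n powr c * real n powr (c - a - b)))
       = (rGamma_series (c - a) n * rGamma_series (c - b) n * suminf (hyp_term a b (c + real (Suc n))))
          * (fact n ^ 2 * (real n powr (c - a) * real n powr (c - b)))"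
      using suminf_hyp_term_shift_nat[OF assms(1,2), of "Suc n"] unfolding *
      by (simp only: ac_simps power2_eq_square)
    then have "rGamma_series c n * rGamma_series (c - a - b) n * suminf (hyp_term a b c)
       = rGamma_series (c - a) n * rGamma_series (c - b) n * suminf (hyp_term a b (c + real (Suc n)))"
      unfolding pw using that by simp
    then show ?thesis using nz' by (simp add: divide_simps ac_simps)
  qed
  then have "(\<lambda>n. ?r n * suminf (hyp_term a b (c + real (Suc n)))) \<longlonglongrightarrow> suminf (hyp_term a b c)"
    by (intro tendsto_eventually) (auto simp: eventually_sequentially intro!: exI[of _ 1])
  ultimately have "suminf (hyp_term a b c) = rGamma (c - a) * rGamma (c - b) / (rGamma c * rGamma (c - a - b))"
    using LIMSEQ_unique by fastforce
  then show ?thesis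
    by (simp add: Gamma_def field_simps)
qed

section \<open>The duplication formula and the value of the constant\<close>

lemma Gamma_legendre_duplication_real:
  fixes z :: real
  assumes "z > 0"
  shows "Gamma (2 * z) = Gamma z * Gamma (z + 1/2) * 2 powr (2 * z - 1) / sqrt pi"
proof -
  have "complex_of_real z \<notin> \<int>\<^sub>\<le>\<^sub>0" "complex_of_real (z + 1/2) \<notin> \<int>\<^sub>\<le>\<^sub>0"
    using assms by (auto simp: nonpos_Ints_def complex_eq_iff)
  then have "Gamma (complex_of_real z) * Gamma (complex_of_real z + 1/2)
      = exp ((1 - 2 * complex_of_real z) * of_real (ln 2)) * of_real (sqrt pi) * Gamma (2 * complex_of_real z)"
    by (intro Gamma_legendre_duplication) auto
  then have "complex_of_real (Gamma z * Gamma (z + 1/2)) =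
      complex_of_real (exp ((1 - 2 * z) * ln 2) * sqrt pi * Gamma (2 * z))"
    by (simp flip: Gamma_complex_of_real exp_of_real)
  then have "Gamma z * Gamma (z + 1/2) = exp ((1 - 2 * z) * ln 2) * sqrt pi * Gamma (2 * z)"
    by (rule of_real_eq_iff[THEN iffD1])
  also have "exp ((1 - 2 * z) * ln 2) = inverse (2 powr (2 * z - 1))"
    by (simp add: powr_def algebra_simps flip: exp_minus)
  finally show ?thesis by (simp add: divide_simps)
qed

text \<open>The series on the right is the one produced by the moments of a coordinate on the
  sphere. Gauss's theorem evaluates both series; duplication at \<open>c - a - 1/2\<close> and at
  \<open>c - a / 2 - 1/2\<close> turns one Gamma quotient into the other and leaves the power of
  2.\<close>

lemma c_const_eq_Gauss:
  assumes "-2 < s" "s \<le> real d - 4"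
  shows "c_const s d = 2 powr (- s / 2) * suminf (hyp_term (s / 4) (s / 4 + 1 / 2) (real d / 2))"
proof -
  define a c where "a = s / 2" and "c = real d / 2"
  have ac: "a > -1" "a + 2 \<le> c" "c > 1" using assms by (auto simp: a_def c_def)
  have "c_const s d = suminf (hyp_term a (a + 1 - c) c)"
  proof -
    have "(2 + s - real d) / 2 = a + 1 - c" by (simp add: a_def c_def field_simps)
    then show ?thesis
      unfolding c_const_def hyp2F1_series by (simp only: hyp_term_def[abs_def] a_def c_def power_one mult_1_right)
  qed
  also have "\<dots> = Gamma c * Gamma (2 * (c - a - 1/2)) / (Gamma (c - a) * Gamma (2 * (c - a / 2 - 1/2)))"
    using ac by (subst Gauss_summation) (auto simp: algebra_simps)
  also have "Gamma (2 * (c - a - 1/2)) = Gamma (c - a - 1/2) * Gamma (c - a) * 2 powr (2 * c - 2 * a - 2) / sqrt pi"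
    using Gamma_legendre_duplication_real[of "c - a - 1/2"] ac by simp
  also have "Gamma (2 * (c - a / 2 - 1/2)) = Gamma (c - a / 2 - 1/2) * Gamma (c - a / 2) * 2 powr (2 * c - a - 2) / sqrt pi"
    using Gamma_legendre_duplication_real[of "c - a / 2 - 1/2"] ac by simp
  also have "Gamma c * (Gamma (c - a - 1/2) * Gamma (c - a) * 2 powr (2 * c - 2 * a - 2) / sqrt pi) /
       (Gamma (c - a) * (Gamma (c - a / 2 - 1/2) * Gamma (c - a / 2) * 2 powr (2 * c - a - 2) / sqrt pi))
     = 2 powr (- a) * (Gamma c * Gamma (c - a - 1/2) / (Gamma (c - a / 2) * Gamma (c - a / 2 - 1/2)))"
  proof -
    have "Gamma (c - a) > 0" using ac by (intro Gamma_real_pos) auto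
    moreover have "(2::real) powr (2 * c - 2 * a - 2) = 2 powr (- a) * 2 powr (2 * c - a - 2)"
      by (simp flip: powr_add add: algebra_simps)
    ultimately show ?thesis by (simp add: mult_ac)
  qed
  also have "Gamma c * Gamma (c - a - 1/2) / (Gamma (c - a / 2) * Gamma (c - a / 2 - 1/2)) = suminf (hyp_term (a / 2) (a / 2 + 1 / 2) c)"
    using ac by (subst Gauss_summation) (auto simp: algebra_simps)
  finally show ?thesis by (simp add: a_def c_def)
qed

text \<open>All Gamma arguments in Gauss's evaluation are positive. The sign is that of the slope of
  the comparison field, so it decides whether this field confines.\<close>

lemma c_const_pos:
  assumes "-2 < s" "s \<le> real d - 4"
  shows "c_const s d > 0"
  unfolding c_const_eq_Gauss[OF assms] using assms
  by (subst Gauss_summation) (auto intro!: mult_pos_pos divide_pos_pos Gamma_real_pos)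

section \<open>Extended-sense convexity\<close>

lemma at_within_Ici_pos: "at y within {0..} = at y" if "y > 0" for y :: real
  using that by (intro at_within_open_subset[of _ "{0<..}"]) auto

lemma ext_deriv_eqI:
  assumes "has_ext_deriv {0..} f y D" "y > 0"
  shows "ext_deriv {0..} f y = D"
  using assms(1) unfolding ext_deriv_def has_ext_deriv_def at_within_Ici_pos[OF assms(2)]
  by (rule the_equality) (erule tendsto_unique[OF trivial_limit_at _ assms(1)[unfolded has_ext_deriv_def at_within_Ici_pos[OF assms(2)]]])

lemma eventually_not_in_finite:
  fixes S :: "'a::t1_space set"
  assumes "finite S"
  shows "eventually (\<lambda>x. x \<notin> S) (at y)"
proof -
  have "open (- (S - {y}))" using assms by (intro open_Compl finite_imp_closed) auto
  then show ?thesis unfolding eventually_at_topological by (intro exI[of _ "- (S - {y})"]) auto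
qed

text \<open>Next to an isolated infinite value at an interior point the difference quotients are
  infinite, with opposite signs on the two sides, so they have no common limit. At the endpoint 0
  there is only one side, and an infinite value remains possible.\<close>

lemma finite_if_has_ext_deriv:
  assumes fin: "finite {x \<in> {0..}. \<bar>f x\<bar> = \<infinity>}" and "y > 0" and D: "has_ext_deriv {0..} f y D"
  shows "\<bar>f y\<bar> \<noteq> \<infinity>"
proof
  assume inf: "\<bar>f y\<bar> = \<infinity>"
  define q where "q x = (f x - f y) / ereal (x - y)" for x
  have D: "(q \<longlongrightarrow> D) (at y)"
    using D by (simp add: has_ext_deriv_def at_within_Ici_pos[OF \<open>y > 0\<close>] q_def[abs_def])
  then have Dr: "(q \<longlongrightarrow> D) (at_right y)" and Dl: "(q \<longlongrightarrow> D) (at_left y)"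
    by (auto intro!: tendsto_mono[OF at_le D])
  have pos: "eventually (\<lambda>x. x > 0) (at y)"
    using \<open>y > 0\<close> by (intro order_tendstoD(1)[OF tendsto_ident_at])
  have ev: "eventually (\<lambda>x. \<bar>f x\<bar> \<noteq> \<infinity>) (at y)"
    using eventually_not_in_finite[OF fin] pos by eventually_elim auto
  have evr: "eventually (\<lambda>x. \<bar>f x\<bar> \<noteq> \<infinity> \<and> x > y) (at_right y)"
    by (intro eventually_conj filter_leD[OF at_le ev]) (auto simp: eventually_at_filter)
  have evl: "eventually (\<lambda>x. \<bar>f x\<bar> \<noteq> \<infinity> \<and> x < y) (at_left y)"
    by (intro eventually_conj filter_leD[OF at_le ev]) (auto simp: eventually_at_filter)
  show False
  proof (cases "f y = \<infinity>")
    case True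
    have "eventually (\<lambda>x. q x = -\<infinity>) (at_right y)"
      using evr by eventually_elim (auto simp: q_def True divide_ereal_def)
    then have "D = -\<infinity>" using Dr by (metis tendsto_eventually tendsto_unique trivial_limit_at_right_real)
    moreover have "eventually (\<lambda>x. q x = \<infinity>) (at_left y)"
      using evl by eventually_elim (auto simp: q_def True divide_ereal_def)
    then have "D = \<infinity>" using Dl by (metis tendsto_eventually tendsto_unique trivial_limit_at_left_real)
    ultimately show False by simp
  next
    case False
    then have m: "f y = -\<infinity>" using inf by auto
    have "eventually (\<lambda>x. q x = \<infinity>) (at_right y)"
      using evr by eventually_elim (auto simp: q_def m divide_ereal_def)
    then have "D = \<infinity>" using Dr by (metis tendsto_eventually tendsto_unique trivial_limit_at_right_real)
    moreover have "eventually (\<lambda>x. q x = -\<infinity>) (at_left y)"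
      using evl by eventually_elim (auto simp: q_def m divide_ereal_def)
    then have "D = -\<infinity>" using Dl by (metis tendsto_eventually tendsto_unique trivial_limit_at_left_real)
    ultimately show False by simp
  qed
qed

text \<open>The largest point at which \<open>h\<close> is still at least \<open>h a\<close> cannot
  lie before \<open>b\<close>, since \<open>h\<close> does not drop immediately to the right of
  it.\<close>

lemma mono_if_right_increasing:
  fixes h :: "real \<Rightarrow> real"
  assumes "a \<le> b" and cont: "continuous_on {a..b} h"
    and inc: "\<And>x. a \<le> x \<Longrightarrow> x < b \<Longrightarrow> eventually (\<lambda>z. h x \<le> h z) (at_right x)"
  shows "h a \<le> h b"
proof (rule ccontr)
  assume less: "\<not> h a \<le> h b"
  define S where "S = {x \<in> {a..b}. h x \<ge> h a}"
  have "closed ({a..b} \<inter> h -` {h a..})" using cont by (intro continuous_closed_preimage) auto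
  also have "{a..b} \<inter> h -` {h a..} = S" by (auto simp: S_def)
  finally have "closed S" .
  moreover have bS: "bounded S" by (rule bounded_subset[of "{a..b}"]) (auto simp: S_def)
  ultimately have "compact S" by (simp add: compact_eq_bounded_closed)
  moreover have "a \<in> S" using assms(1) by (auto simp: S_def)
  ultimately obtain c where c: "c \<in> S" "\<And>x. x \<in> S \<Longrightarrow> x \<le> c"
    by (metis compact_attains_sup empty_iff)
  have "c < b" using c(1) less by (cases "c = b") (auto simp: S_def)
  then have "eventually (\<lambda>z. h c \<le> h z \<and> z \<in> {c<..<b}) (at_right c)"
    using inc[of c] c(1) eventually_at_right_less[of c] order_tendstoD(2)[OF tendsto_ident_at, of c b "{c<..}"]
    by (auto simp: S_def elim: eventually_elim2 intro!: eventually_conj)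
  then obtain z where "h c \<le> h z" "z \<in> {c<..<b}"
    using eventually_happens trivial_limit_at_right_real by blast
  then have "z \<in> S" using c(1) by (auto simp: S_def)
  then show False using c(2) \<open>z \<in> {c<..<b}\<close> by force
qed

text \<open>The derivative may be infinite, which rules out the mean value theorem. Adding a small
  slope \<open>e'\<close> turns the weak inequality for the derivative into an actual increase just
  to the right of each point.\<close>

lemma nondecreasing_if_ext_deriv_nonneg:
  fixes g :: "real \<Rightarrow> real"
  assumes "a \<le> b" and cont: "continuous_on {a..b} g"
    and D: "\<And>x. a \<le> x \<Longrightarrow> x < b \<Longrightarrow> \<exists>D::ereal. D \<ge> 0 \<and> ((\<lambda>z. ereal ((g z - g x) / (z - x))) \<longlongrightarrow> D) (at x)"
  shows "g a \<le> g b"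
proof (rule field_le_epsilon)
  fix e :: real assume "e > 0"
  \<comment> \<open>The summand 1 keeps the denominator positive when \<open>a = b\<close>; the
    total tilt over the interval is at most \<open>e\<close>.\<close>
  define e' where "e' = e / (b - a + 1)"
  have e': "e' > 0" using \<open>e > 0\<close> assms(1) by (simp add: e'_def)
  have "g a + e' * a \<le> g b + e' * b"
  proof (rule mono_if_right_increasing[OF assms(1)])
    show "continuous_on {a..b} (\<lambda>x. g x + e' * x)" by (intro continuous_intros cont)
    fix x assume "a \<le> x" "x < b"
    from D[OF this] obtain D where D: "D \<ge> 0" "((\<lambda>z. ereal ((g z - g x) / (z - x))) \<longlongrightarrow> D) (at x)" by blast
    have "ereal (- e') < D" using e' D(1) by (cases D) auto
    then have ev: "eventually (\<lambda>z. ereal (- e') < ereal ((g z - g x) / (z - x))) (at x)"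
      by (rule order_tendstoD(1)[OF D(2)])
    have "eventually (\<lambda>z. ereal (- e') < ereal ((g z - g x) / (z - x)) \<and> z > x) (at_right x)"
      by (intro eventually_conj filter_leD[OF at_le ev]) (auto simp: eventually_at_filter)
    then show "eventually (\<lambda>z. g x + e' * x \<le> g z + e' * z) (at_right x)"
      by eventually_elim (auto simp: field_simps)
  qed
  moreover have "e' * b - e' * a \<le> e"
  proof -
    have "(b - a) * e \<le> (b - a + 1) * e" using \<open>e > 0\<close> by simp
    then have "(b - a) * e / (b - a + 1) \<le> e" using assms(1) by (simp add: pos_divide_le_eq mult.commute)
    also have "(b - a) * e / (b - a + 1) = e' * b - e' * a" by (simp add: e'_def algebra_simps diff_divide_distrib)
    finally show ?thesis .
  qed
  ultimately show "g a \<le> g b + e" by linarith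
qed

text \<open>Away from 0 the extended calculus becomes classical: \<open>v\<close> and its first
  derivative both have an extended derivative at every interior point, hence are finite there. The
  second derivative may still be infinite, so the monotonicity of \<open>g\<close> rests on
  \<open>nondecreasing_if_ext_deriv_nonneg\<close>.\<close>

lemma Ck_ext_on_2_real:
  assumes C2: "Ck_ext_on 2 {0..} v" and conv: "\<forall>r\<in>{0..}. (ext_deriv {0..} ^^ 2) v r \<ge> 0"
  obtains f g where "\<And>r. r > 0 \<Longrightarrow> v r = ereal (f r)" "\<And>r. r > 0 \<Longrightarrow> ext_deriv {0..} v r = ereal (g r)"
    "\<And>r. r > 0 \<Longrightarrow> (f has_real_derivative g r) (at r)" "\<And>a b. 0 < a \<Longrightarrow> a \<le> b \<Longrightarrow> g a \<le> g b"
proof -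
  define w where "w = ext_deriv {0..} v"
  define f g where "f r = real_of_ereal (v r)" and "g r = real_of_ereal (w r)" for r
  have C2': "\<And>l y. l < 2 \<Longrightarrow> y \<ge> 0 \<Longrightarrow> \<exists>D. has_ext_deriv {0..} ((ext_deriv {0..} ^^ l) v) y D"
    "\<And>l. l \<le> 2 \<Longrightarrow> finite {y\<in>{0..}. \<bar>(ext_deriv {0..} ^^ l) v y\<bar> = \<infinity>}"
    "\<And>l y. l \<le> 2 \<Longrightarrow> y \<ge> 0 \<Longrightarrow> (((ext_deriv {0..} ^^ l) v \<longlongrightarrow> (ext_deriv {0..} ^^ l) v y) (at y within {0..}))"
    using C2 unfolding Ck_ext_on_def by (meson atLeast_iff)+
  have dv: "has_ext_deriv {0..} v y (w y)" if "y > 0" for y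
    using C2'(1)[of 0 y] ext_deriv_eqI[OF _ that] that unfolding w_def by fastforce
  have fv: "finite {y\<in>{0..}. \<bar>v y\<bar> = \<infinity>}" and fw: "finite {y\<in>{0..}. \<bar>w y\<bar> = \<infinity>}"
    using C2'(2)[of 0] C2'(2)[of 1] by (simp_all add: w_def)
  have dw: "\<exists>D\<ge>0. has_ext_deriv {0..} w y D" if y: "y > 0" for y
  proof -
    obtain D where D: "has_ext_deriv {0..} w y D"
      using C2'(1)[of 1 y] y unfolding w_def by force
    then have "D = (ext_deriv {0..} ^^ 2) v y"
      using ext_deriv_eqI[OF D y] by (simp add: w_def numeral_2_eq_2)
    then show ?thesis using conv y D by auto
  qed
  have v: "v y = ereal (f y)" and w: "w y = ereal (g y)" if "y > 0" for y
    using finite_if_has_ext_deriv[OF fv that dv[OF that]] finite_if_has_ext_deriv[OF fw that] dw[OF that]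
    by (auto simp: f_def g_def ereal_real')
  have pos: "eventually (\<lambda>x. x > 0 \<and> x \<noteq> y) (at y)" if "y > 0" for y :: real
    using that by (intro eventually_conj order_tendstoD(1)[OF tendsto_ident_at] eventually_neq_at_within)
  have fg: "(f has_real_derivative g y) (at y)" if y: "y > 0" for y
  proof -
    have "((\<lambda>x. (v x - v y) / ereal (x - y)) \<longlongrightarrow> ereal (g y)) (at y)"
      using dv[OF y] w[OF y] by (simp add: has_ext_deriv_def at_within_Ici_pos[OF y])
    moreover have "eventually (\<lambda>x. (v x - v y) / ereal (x - y) = ereal ((f x - f y) / (x - y))) (at y)"
      using pos[OF y] by eventually_elim (simp add: v y)
    ultimately have "((\<lambda>x. ereal ((f x - f y) / (x - y))) \<longlongrightarrow> ereal (g y)) (at y)"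
      by (rule Lim_transform_eventually)
    then show ?thesis by (simp add: has_field_derivative_iff)
  qed
  have contg: "isCont g y" if y: "y > 0" for y
  proof -
    have "(w \<longlongrightarrow> ereal (g y)) (at y)"
      using C2'(3)[of 1 y] y w[OF y] by (simp add: w_def at_within_Ici_pos[OF y])
    moreover have "eventually (\<lambda>x. w x = ereal (g x)) (at y)"
      using pos[OF y] by eventually_elim (simp add: w)
    ultimately have "((\<lambda>x. ereal (g x)) \<longlongrightarrow> ereal (g y)) (at y)"
      by (rule Lim_transform_eventually)
    then show ?thesis by (simp add: isCont_def)
  qed
  have mono: "g a \<le> g b" if "0 < a" "a \<le> b" for a b
  proof (rule nondecreasing_if_ext_deriv_nonneg[OF that(2)])
    show "continuous_on {a..b} g"
      using that contg by (intro continuous_at_imp_continuous_on) auto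
    fix x assume x: "a \<le> x" "x < b"
    then have x0: "x > 0" using that by simp
    from dw[OF x0] obtain D where D: "D \<ge> 0" "((\<lambda>z. (w z - w x) / ereal (z - x)) \<longlongrightarrow> D) (at x)"
      by (auto simp: has_ext_deriv_def at_within_Ici_pos[OF x0])
    have "eventually (\<lambda>z. (w z - w x) / ereal (z - x) = ereal ((g z - g x) / (z - x))) (at x)"
      using pos[OF x0] by eventually_elim (simp add: w x0)
    with D(2) have "((\<lambda>z. ereal ((g z - g x) / (z - x))) \<longlongrightarrow> D) (at x)"
      by (rule Lim_transform_eventually)
    with D(1) show "\<exists>D\<ge>0. ((\<lambda>z. ereal ((g z - g x) / (z - x))) \<longlongrightarrow> D) (at x)" by blast
  qed
  show ?thesis using that[of f g] v w fg mono by (auto simp: w_def)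
qed

text \<open>The tangent inequality of a convex function on the open half-line; it passes to the
  endpoint 0 by continuity of \<open>v\<close> in the extended reals, whether or not
  \<open>v 0\<close> is finite.\<close>

lemma Ck_ext_on_2_affine_minorant:
  assumes C2: "Ck_ext_on 2 {0..} v" and conv: "\<forall>r\<in>{0..}. (ext_deriv {0..} ^^ 2) v r \<ge> 0"
    and y: "y > 0" and m: "ext_deriv {0..} v y = ereal m"
  obtains w where "v y = ereal w" "\<And>r. r \<ge> 0 \<Longrightarrow> v r \<ge> ereal (w + m * (r - y))"
proof -
  from Ck_ext_on_2_real[OF C2 conv] obtain f g where
    v: "\<And>r. r > 0 \<Longrightarrow> v r = ereal (f r)" and w: "\<And>r. r > 0 \<Longrightarrow> ext_deriv {0..} v r = ereal (g r)" and
    fg: "\<And>r. r > 0 \<Longrightarrow> (f has_real_derivative g r) (at r)" and mono: "\<And>a b. 0 < a \<Longrightarrow> a \<le> b \<Longrightarrow> g a \<le> g b"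
    by metis
  have m: "m = g y" using m w[OF y] by simp
  have pos: "v r \<ge> ereal (f y + m * (r - y))" if "r > 0" for r
  proof -
    have "convex_on {0<..} f"
      by (rule convex_on_realI[of _ _ g]) (use fg mono in auto)
    then have "f r - f y \<ge> g y * (r - y)"
      by (rule convex_on_imp_above_tangent) 
         (use fg y that in \<open>auto intro: has_field_derivative_at_within simp: interior_open\<close>)
    then show ?thesis using v[OF that] m by simp
  qed
  have "v 0 \<ge> ereal (f y + m * (0 - y))"
  proof (rule tendsto_le)
    show "at (0::real) within {0..} \<noteq> bot" by (simp add: at_within_Ici_at_right)
    show "(v \<longlongrightarrow> v 0) (at 0 within {0..})"
      using C2 unfolding Ck_ext_on_def by (auto dest!: spec[of _ "0::nat"])
    show "((\<lambda>r. ereal (f y + m * (r - y))) \<longlongrightarrow> ereal (f y + m * (0 - y))) (at 0 within {0..})"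
      by (intro tendsto_intros)
    show "eventually (\<lambda>r. ereal (f y + m * (r - y)) \<le> v r) (at 0 within {0..})"
      using pos by (auto simp: eventually_at_filter)
  qed
  with pos have "v r \<ge> ereal (f y + m * (r - y))" if "r \<ge> 0" for r
    using that by (cases "r = 0") auto
  then show ?thesis using that[of "f y"] v[OF y] by auto
qed

lemma borel_measurable_radial_field:
  assumes C2: "Ck_ext_on 2 {0..} v" and conv: "\<forall>r\<in>{0..}. (ext_deriv {0..} ^^ 2) v r \<ge> 0"
  shows "(radial_field v :: 'a::euclidean_space \<Rightarrow> ereal) \<in> borel_measurable borel"
proof -
  from Ck_ext_on_2_real[OF C2 conv] obtain f g where
    v: "\<And>r. r > 0 \<Longrightarrow> v r = ereal (f r)" and 
    fg: "\<And>r. r > 0 \<Longrightarrow> (f has_real_derivative g r) (at r)" 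
    by metis
  have c: "continuous_on {0<..} f" 
    using fg by (intro continuous_at_imp_continuous_on) (auto intro: DERIV_isCont)
  have "continuous_on (- {0}) (\<lambda>x::'a. f ((norm x)\<^sup>2))"
    by (rule continuous_on_compose2[OF c]) (auto intro!: continuous_intros)
  then have m: "(\<lambda>x::'a. indicator (-{0}) x *\<^sub>R f ((norm x)\<^sup>2)) \<in> borel_measurable borel"
    by (intro borel_measurable_continuous_on_indicator) auto
  have "(\<lambda>x::'a. if x = 0 then v 0 else ereal (indicator (-{0}) x *\<^sub>R f ((norm x)\<^sup>2))) \<in> borel_measurable borel"
    using m by measurable
  moreover have "(\<lambda>x::'a. if x = 0 then v 0 else ereal (indicator (-{0}) x *\<^sub>R f ((norm x)\<^sup>2))) = radial_field v"
    by (auto simp: radial_field_def fun_eq_iff v)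
  ultimately show ?thesis by simp
qed

section \<open>Invariance and integration by parts on the sphere\<close>

lemma nn_integral_lborel_translate:
  fixes f :: "'a::euclidean_space \<Rightarrow> ennreal"
  assumes [measurable]: "f \<in> borel_measurable borel"
  shows "(\<integral>\<^sup>+x. f (c + x) \<partial>lborel) = (\<integral>\<^sup>+x. f x \<partial>lborel)"
proof -
  have "(\<integral>\<^sup>+x. f x \<partial>lborel) = (\<integral>\<^sup>+x. f x \<partial>distr lborel borel ((+) c))"
    by (simp add: lborel_distr_plus)
  then show ?thesis by (simp add: nn_integral_distr)
qed

lemma borel_measurable_orthogonal_transformation:
  fixes T :: "'a::euclidean_space \<Rightarrow> 'a"
  assumes "orthogonal_transformation T"
  shows "T \<in> borel_measurable borel"
  using orthogonal_transformation_linear[OF assms] linear_conv_bounded_linear[of T]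
  by (simp add: borel_measurable_continuous_onI linear_continuous_on)

text \<open>The usual uniqueness argument for Haar measure; the unit ball fixes the constant.\<close>

lemma nn_integral_lborel_orthogonal:
  fixes T :: "'a::euclidean_space \<Rightarrow> 'a" and f :: "'a \<Rightarrow> ennreal"
  assumes T: "orthogonal_transformation T" and [measurable]: "f \<in> borel_measurable borel"
  shows "(\<integral>\<^sup>+x. f (T x) \<partial>lborel) = (\<integral>\<^sup>+x. f x \<partial>lborel)"
proof -
  have [measurable]: "T \<in> borel_measurable borel"
    by (rule borel_measurable_orthogonal_transformation[OF T])
  have Tinv: "T (inv T y) = y" for y
    using orthogonal_transformation_surj[OF T] by (rule surj_f_inv_f)
  have Tplus: "T (x + y) = T x + T y" for x y
    using orthogonal_transformation_linear[OF T] by (rule linear_add)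
  define B :: "'a \<Rightarrow> ennreal" where "B = indicator (ball 0 1)"
  have [measurable]: "B \<in> borel_measurable borel" unfolding B_def by (intro borel_measurable_indicator) simp
  have BT: "B (- T x) = B x" for x
    by (auto simp: B_def orthogonal_transformation_norm[OF T] split: split_indicator)
  define b where "b = (\<integral>\<^sup>+y. B y \<partial>lborel)"
  have b: "b = emeasure lborel (ball (0::'a) 1)" by (simp add: b_def B_def)
  have b0: "b \<noteq> 0" "b \<noteq> top"
    using emeasure_lborel_ball_finite[of "0::'a" 1] content_ball_pos[of 1 "0::'a"] 
    by (auto simp: b emeasure_eq_ennreal_measure top.not_eq_extremum)
  have "b * (\<integral>\<^sup>+x. f (T x) \<partial>lborel) = (\<integral>\<^sup>+x. (\<integral>\<^sup>+y. f (T x) * B y \<partial>lborel) \<partial>lborel)"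
    by (simp add: nn_integral_cmult nn_integral_multc b_def mult.commute)
  also have "\<dots> = (\<integral>\<^sup>+x. (\<integral>\<^sup>+y. f (T x) * B (- T x + y) \<partial>lborel) \<partial>lborel)"
    by (subst nn_integral_lborel_translate[of "\<lambda>y. f (T _) * B y"]) simp_all
  also have "\<dots> = (\<integral>\<^sup>+y. (\<integral>\<^sup>+x. f (T x) * B (- T x + y) \<partial>lborel) \<partial>lborel)"
    by (rule lborel_pair.Fubini') measurable
  also have "\<dots> = (\<integral>\<^sup>+y. (\<integral>\<^sup>+x. f (T x + y) * B x \<partial>lborel) \<partial>lborel)"
  proof (rule nn_integral_cong)
    fix y
    \<comment> \<open>Translating by the preimage of \<open>y\<close> under \<open>T\<close> moves
      \<open>y\<close> from the ball indicator into \<open>f\<close>; what remains in the indicator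
      is \<open>- T x\<close>, and the ball is invariant under \<open>- T\<close>.\<close>
    have "(\<integral>\<^sup>+x. f (T x) * B (- T x + y) \<partial>lborel) = (\<integral>\<^sup>+x. f (T (inv T y + x)) * B (- T (inv T y + x) + y) \<partial>lborel)"
      by (rule nn_integral_lborel_translate[symmetric]) measurable
    also have "\<dots> = (\<integral>\<^sup>+x. f (T x + y) * B x \<partial>lborel)"
      by (simp add: Tplus Tinv BT add.commute)
    finally show "(\<integral>\<^sup>+x. f (T x) * B (- T x + y) \<partial>lborel) = (\<integral>\<^sup>+x. f (T x + y) * B x \<partial>lborel)" .
  qed
  also have "\<dots> = (\<integral>\<^sup>+x. (\<integral>\<^sup>+y. f (T x + y) * B x \<partial>lborel) \<partial>lborel)"
    by (rule lborel_pair.Fubini') measurable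
  also have "\<dots> = (\<integral>\<^sup>+x. (\<integral>\<^sup>+y. f y \<partial>lborel) * B x \<partial>lborel)"
    by (simp add: nn_integral_multc nn_integral_lborel_translate)
  also have "\<dots> = b * (\<integral>\<^sup>+x. f x \<partial>lborel)"
    by (subst nn_integral_cmult) (simp_all add: b_def mult.commute)
  finally show ?thesis using b0 by (simp add: ennreal_mult_cancel_left)
qed

lemma
  shows space_sphere_uniform [simp]: "space (sphere_uniform R) = UNIV"
    and sets_sphere_uniform [simp, measurable_cong]: "sets (sphere_uniform R) = sets borel"
  by (simp_all add: sphere_uniform_def)

lemma prob_space_sphere_uniform: "prob_space (sphere_uniform R :: 'a::euclidean_space measure)"
  using sphere_uniform_in_borel_probability_measures by (auto simp: borel_probability_measures_def)

lemma sphere_uniform_orthogonal: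
  fixes T :: "'a::euclidean_space \<Rightarrow> 'a"
  assumes T: "orthogonal_transformation T"
  shows "distr (sphere_uniform R) borel T = sphere_uniform R"
proof -
  have [measurable]: "T \<in> borel_measurable borel"
    by (rule borel_measurable_orthogonal_transformation[OF T])
  let ?U = "uniform_measure lborel (ball (0::'a) 1)"
  have U: "distr ?U borel T = ?U"
  proof (rule measure_eqI)
    fix A assume "A \<in> sets (distr ?U borel T)"
    then have [measurable]: "A \<in> sets borel" by simp
    have "emeasure lborel (ball 0 1 \<inter> T -` A) = (\<integral>\<^sup>+x. indicator (ball 0 1 \<inter> A) (T x) \<partial>lborel)"
      by (subst nn_integral_indicator[symmetric])
         (auto intro!: nn_integral_cong simp: orthogonal_transformation_norm[OF T] measurable_sets_borel[OF \<open>T \<in> borel_measurable borel\<close>] split: split_indicator)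
    also have "\<dots> = emeasure lborel (ball 0 1 \<inter> A)"
      by (subst nn_integral_lborel_orthogonal[OF T]) (auto intro!: borel_measurable_indicator)
    finally show "emeasure (distr ?U borel T) A = emeasure ?U A"
      by (simp add: emeasure_distr measurable_sets_borel[OF \<open>T \<in> borel_measurable borel\<close>])
  qed simp
  have TR: "T \<circ> (\<lambda>x. (R / norm x) *\<^sub>R x) = (\<lambda>x. (R / norm x) *\<^sub>R x) \<circ> T"
    using orthogonal_transformation_linear[OF T] 
    by (auto simp: fun_eq_iff linear_scale orthogonal_transformation_norm[OF T])
  have "distr (sphere_uniform R) borel T = distr ?U borel (T \<circ> (\<lambda>x. (R / norm x) *\<^sub>R x))"
    unfolding sphere_uniform_def by (subst distr_distr) auto
  also have "\<dots> = distr (distr ?U borel T) borel (\<lambda>x. (R / norm x) *\<^sub>R x)"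
    unfolding TR by (subst distr_distr) auto
  finally show ?thesis unfolding U by (simp add: sphere_uniform_def)
qed

lemma sphere_uniform_eq_distr:
  "sphere_uniform R = distr (sphere_uniform 1 :: 'a::euclidean_space measure) borel (\<lambda>x. R *\<^sub>R x)"
  unfolding sphere_uniform_def by (subst distr_distr) (auto simp: o_def)

lemma AE_sphere_uniform_1_norm: "AE y in (sphere_uniform 1 :: 'a::euclidean_space measure). norm y = 1"
  using AE_sphere_uniform[of 1] by simp

text \<open>All points whose radial projection is \<open>e\<close> lie on one line, which is a null
  set in dimension at least 2.\<close>

lemma AE_sphere_uniform_1_neq:
  assumes "DIM('a::euclidean_space) \<ge> 2"
  shows "AE y in (sphere_uniform 1 :: 'a measure). y \<noteq> e"
proof -
  have "dim (span {e}) \<le> 1" by (auto simp: dim_span dim_singleton)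
  then have "negligible (span {e})" using assms by (intro negligible_lowdim) auto
  then have "span {e} \<in> null_sets lborel"
    by (simp add: negligible_iff_null_sets null_sets_completion_iff closed_subspace borel_closed)
  then have "AE x in lborel. x \<notin> span {e}" by (rule AE_not_in)
  moreover have "(1 / norm x) *\<^sub>R x \<noteq> e" if "x \<notin> span {e}" for x
  proof
    assume "(1 / norm x) *\<^sub>R x = e"
    then have "norm x *\<^sub>R e = x" by (cases "x = 0") auto
    then have "x \<in> span {e}" by (metis span_base span_mul singletonI)
    with that show False by simp
  qed
  ultimately have "AE x in lborel. (1 / norm x) *\<^sub>R x \<noteq> e" by fastforce
  then have "AE x in uniform_measure lborel (ball (0::'a) 1). (1 / norm x) *\<^sub>R x \<noteq> e"
    by (subst AE_uniform_measure)
       (use emeasure_lborel_ball_finite[of "0::'a" 1] content_ball_pos[of 1 "0::'a"] in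
         \<open>auto simp: emeasure_eq_ennreal_measure top.not_eq_extremum\<close>)
  then show ?thesis
    unfolding sphere_uniform_def by (subst AE_distr_iff) auto
qed

text \<open>Differentiation under the integral sign: the mean value inequality bounds the difference
  quotients by \<open>B\<close>, a constant that a finite measure integrates, so dominated
  convergence applies along every sequence tending to \<open>t0\<close>.\<close>

lemma has_real_derivative_integral:
  fixes F F' :: "real \<Rightarrow> 'a \<Rightarrow> real"
  assumes "finite_measure M" and t0: "a < t0" "t0 < b"
    and int: "\<And>t. a < t \<Longrightarrow> t < b \<Longrightarrow> integrable M (F t)"
    and meas: "F' t0 \<in> borel_measurable M"
    and der: "AE y in M. \<forall>t. a < t \<longrightarrow> t < b \<longrightarrow> ((\<lambda>t. F t y) has_real_derivative F' t y) (at t) \<and> \<bar>F' t y\<bar> \<le> B"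
  shows "((\<lambda>t. \<integral>y. F t y \<partial>M) has_real_derivative (\<integral>y. F' t0 y \<partial>M)) (at t0)"
proof -
  interpret finite_measure M by fact
  have "((\<lambda>t. ((\<integral>y. F t y \<partial>M) - (\<integral>y. F t0 y \<partial>M)) / (t - t0)) \<longlongrightarrow> (\<integral>y. F' t0 y \<partial>M)) (at t0)"
    unfolding tendsto_at_iff_sequentially
  proof (intro allI impI)
    fix X :: "nat \<Rightarrow> real" assume X: "\<forall>i. X i \<in> UNIV - {t0}" "X \<longlonglongrightarrow> t0"
    have "eventually (\<lambda>i. X i \<in> {a<..<b}) sequentially"
      using t0 by (intro topological_tendstoD[OF X(2)]) auto
    then obtain N where N: "\<And>i. i \<ge> N \<Longrightarrow> X i \<in> {a<..<b}"
      by (auto simp: eventually_sequentially)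
    define Y where "Y i = X (i + N)" for i
    have Y: "a < Y i" "Y i < b" "Y i \<noteq> t0" for i using N[of "i + N"] X(1) by (auto simp: Y_def)
    have Ylim: "Y \<longlonglongrightarrow> t0" unfolding Y_def using X(2) by (rule LIMSEQ_ignore_initial_segment)
    have "(\<lambda>i. \<integral>y. (F (Y i) y - F t0 y) / (Y i - t0) \<partial>M) \<longlonglongrightarrow> (\<integral>y. F' t0 y \<partial>M)"
    proof (rule integral_dominated_convergence[where w = "\<lambda>_. B"])
      show "AE y in M. (\<lambda>i. (F (Y i) y - F t0 y) / (Y i - t0)) \<longlonglongrightarrow> F' t0 y"
        using der
      proof eventually_elim
        case (elim y)
        then have "((\<lambda>t. (F t y - F t0 y) / (t - t0)) \<longlongrightarrow> F' t0 y) (at t0)"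
          using t0 by (simp add: has_field_derivative_iff)
        then show ?case
          unfolding tendsto_at_iff_sequentially using Y Ylim by (auto simp: o_def)
      qed
      show "AE y in M. norm ((F (Y i) y - F t0 y) / (Y i - t0)) \<le> B" for i
        using der
      proof eventually_elim
        case (elim y)
        have "norm (F (Y i) y - F t0 y) \<le> B * norm (Y i - t0)"
          by (rule field_differentiable_bound[of "{a<..<b}" "\<lambda>t. F t y" "\<lambda>t. F' t y"])
             (use elim Y t0 in \<open>auto intro: has_field_derivative_at_within\<close>)
        then show ?case using Y(3)[of i] by (simp add: divide_simps)
      qed
    qed (use Y t0 int meas in \<open>auto intro!: borel_measurable_integrable\<close>)
    moreover have "(\<integral>y. (F (Y i) y - F t0 y) / (Y i - t0) \<partial>M) = ((\<integral>y. F (Y i) y \<partial>M) - (\<integral>y. F t0 y \<partial>M)) / (Y i - t0)" for i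
      using Bochner_Integration.integral_diff[OF int[OF Y(1,2), of i] int[OF t0]] by simp
    ultimately have "(\<lambda>i. ((\<integral>y. F (Y i) y \<partial>M) - (\<integral>y. F t0 y \<partial>M)) / (Y i - t0)) \<longlonglongrightarrow> (\<integral>y. F' t0 y \<partial>M)"
      by (simp only:)
    then have "(\<lambda>i. ((\<integral>y. F (X (i + N)) y \<partial>M) - (\<integral>y. F t0 y \<partial>M)) / (X (i + N) - t0)) \<longlonglongrightarrow> (\<integral>y. F' t0 y \<partial>M)"
      unfolding Y_def .
    then show "((\<lambda>t. ((\<integral>y. F t y \<partial>M) - (\<integral>y. F t0 y \<partial>M)) / (t - t0)) \<circ> X) \<longlonglongrightarrow> (\<integral>y. F' t0 y \<partial>M)"
      unfolding o_def by (rule LIMSEQ_offset)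
  qed
  then show ?thesis by (simp add: has_field_derivative_iff)
qed

lemma continuous_on_unit_interval_bounded:
  fixes f :: "real \<Rightarrow> real"
  assumes "continuous_on {-1..1} f"
  obtains B where "\<And>x. \<bar>x\<bar> \<le> 1 \<Longrightarrow> \<bar>f x\<bar> \<le> B"
proof -
  have "bounded (f ` {-1..1})" by (intro compact_imp_bounded compact_continuous_image assms) simp
  then obtain B where B: "\<forall>x\<in>{-1..1}. \<bar>f x\<bar> \<le> B" by (auto simp: bounded_iff)
  show ?thesis
  proof (rule that[of B])
    fix x :: real assume "\<bar>x\<bar> \<le> 1"
    then have "x \<in> {-1..1}" by auto
    with B show "\<bar>f x\<bar> \<le> B" by blast
  qed
qed

lemma measurable_vec_nth [measurable]: "(\<lambda>y::real^'n. y $ k) \<in> borel_measurable borel"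
  by (intro borel_measurable_continuous_onI continuous_intros)

text \<open>The signs are such that, in the variable \<open>\<phi>\<close>, coordinate
  \<open>i\<close> of the image has coordinate \<open>j\<close> as its derivative, and coordinate
  \<open>j\<close> has minus coordinate \<open>i\<close>.\<close>

definition plane_rotation :: "'n \<Rightarrow> 'n \<Rightarrow> real \<Rightarrow> real ^ 'n \<Rightarrow> real ^ 'n::finite" where
  "plane_rotation i j \<phi> y =
     (\<chi> k. if k = i then cos \<phi> * y $ i + sin \<phi> * y $ j
           else if k = j then cos \<phi> * y $ j - sin \<phi> * y $ i else y $ k)"

lemma orthogonal_transformation_plane_rotation:
  fixes i j :: "'n::finite"
  assumes "i \<noteq> j"
  shows "orthogonal_transformation (plane_rotation i j \<phi>)"
  unfolding orthogonal_transformation_def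
proof (intro conjI allI)
  show "linear (plane_rotation i j \<phi>)"
    by (rule linearI) (auto simp: plane_rotation_def vec_eq_iff algebra_simps)
  fix v w :: "real ^ 'n"
  have split: "(\<Sum>k\<in>UNIV. f k) = f i + f j + (\<Sum>k\<in>UNIV - {i, j}. f k)" for f :: "'n \<Rightarrow> real"
    using sum.remove[of UNIV i f] sum.remove[of "UNIV - {i}" j f] assms
    by (simp add: insert_commute Diff_insert[symmetric] add.assoc)
  have "(cos \<phi> * v $ i + sin \<phi> * v $ j) * (cos \<phi> * w $ i + sin \<phi> * w $ j)
      + (cos \<phi> * v $ j - sin \<phi> * v $ i) * (cos \<phi> * w $ j - sin \<phi> * w $ i)
      = ((cos \<phi>)\<^sup>2 + (sin \<phi>)\<^sup>2) * (v $ i * w $ i + v $ j * w $ j)"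
    by algebra
  then show "plane_rotation i j \<phi> v \<bullet> plane_rotation i j \<phi> w = v \<bullet> w"
    unfolding inner_vec_def split using assms by (simp add: plane_rotation_def)
qed

text \<open>Infinitesimal rotation invariance: the integral of \<open>g (y $ i) * y $ j\<close> is
  unchanged when \<open>y\<close> is rotated in the plane of \<open>i\<close> and \<open>j\<close>,
  and the vanishing of its derivative at angle 0 is the identity.\<close>

lemma sphere_uniform_integration_by_parts_coordinate:
  fixes g g' :: "real \<Rightarrow> real" and i j :: "'n::finite"
  assumes "i \<noteq> j"
    and [measurable]: "g \<in> borel_measurable borel" "g' \<in> borel_measurable borel"
    and der: "\<And>x. \<bar>x\<bar> \<le> 1 \<Longrightarrow> (g has_real_derivative g' x) (at x within {-1..1})"
    and cont: "continuous_on {-1..1} g'"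
  shows "(\<integral>y. g' (y $ i) * (y $ j)\<^sup>2 \<partial>sphere_uniform 1) = (\<integral>y. g (y $ i) * y $ i \<partial>(sphere_uniform 1 :: (real ^ 'n) measure))"
proof -
  let ?S = "sphere_uniform 1 :: (real ^ 'n) measure"
  interpret S: prob_space ?S by (rule prob_space_sphere_uniform)
  obtain B' where B': "\<And>x. \<bar>x\<bar> \<le> 1 \<Longrightarrow> \<bar>g' x\<bar> \<le> B'"
    using continuous_on_unit_interval_bounded[OF cont] by blast
  have "continuous_on {-1..1} g"
    by (rule DERIV_continuous_on[OF der]) (auto simp: abs_le_iff)
  then obtain B where B: "\<And>x. \<bar>x\<bar> \<le> 1 \<Longrightarrow> \<bar>g x\<bar> \<le> B"
    using continuous_on_unit_interval_bounded by blast
  define u w where "u \<phi> y = cos \<phi> * y $ i + sin \<phi> * y $ j" and "w \<phi> y = cos \<phi> * y $ j - sin \<phi> * y $ i" for \<phi> and y :: "real ^ 'n"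
  have [measurable]: "(\<lambda>y. u \<phi> y) \<in> borel_measurable borel" "(\<lambda>y. w \<phi> y) \<in> borel_measurable borel" for \<phi>
    unfolding u_def w_def by measurable
  have rot: "u \<phi> y = plane_rotation i j \<phi> y $ i" "w \<phi> y = plane_rotation i j \<phi> y $ j" for \<phi> y
    using \<open>i \<noteq> j\<close> by (auto simp: u_def w_def plane_rotation_def)
  have le1: "\<bar>u \<phi> y\<bar> \<le> 1" "\<bar>w \<phi> y\<bar> \<le> 1" if "norm y = 1" for \<phi> y
    using that component_le_norm_cart[of "plane_rotation i j \<phi> y"] 
      orthogonal_transformation_norm[OF orthogonal_transformation_plane_rotation[OF \<open>i \<noteq> j\<close>], of \<phi> y]
    unfolding rot by metis+
  define F F' where "F \<phi> y = g (u \<phi> y) * w \<phi> y" and "F' \<phi> y = g' (u \<phi> y) * w \<phi> y * w \<phi> y - g (u \<phi> y) * u \<phi> y" for \<phi> y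
  have const: "(\<integral>y. F \<phi> y \<partial>?S) = (\<integral>y. g (y $ i) * y $ j \<partial>?S)" for \<phi>
  proof -
    note T = orthogonal_transformation_plane_rotation[OF \<open>i \<noteq> j\<close>, of \<phi>]
    have "(\<integral>y. g (y $ i) * y $ j \<partial>?S) = (\<integral>y. g (y $ i) * y $ j \<partial>distr ?S borel (plane_rotation i j \<phi>))"
      by (simp add: sphere_uniform_orthogonal[OF T])
    also have "\<dots> = (\<integral>y. F \<phi> y \<partial>?S)"
      using borel_measurable_orthogonal_transformation[OF T]
      by (subst integral_distr) (auto simp: F_def[abs_def] rot)
    finally show ?thesis by simp
  qed
  have "((\<lambda>\<phi>. \<integral>y. F \<phi> y \<partial>?S) has_real_derivative (\<integral>y. F' 0 y \<partial>?S)) (at 0)"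
  proof (rule has_real_derivative_integral[of _ "-1" _ 1])
    show "finite_measure ?S" by (rule S.finite_measure)
    show "integrable ?S (F t)" for t
    proof (rule S.integrable_const_bound[where B = B])
      show "AE y in ?S. norm (F t y) \<le> B"
        using AE_sphere_uniform_1_norm
      proof eventually_elim
        case (elim y)
        then have "\<bar>g (u t y)\<bar> * \<bar>w t y\<bar> \<le> B * 1"
          using B[of "u t y"] le1[OF elim, of t] by (intro mult_mono) auto
        then show ?case by (simp add: F_def abs_mult)
      qed
    qed (simp add: F_def[abs_def])
    show "AE y in ?S. \<forall>t. - 1 < t \<longrightarrow> t < 1 \<longrightarrow> ((\<lambda>t. F t y) has_real_derivative F' t y) (at t) \<and> \<bar>F' t y\<bar> \<le> B' + B"
      using AE_sphere_uniform_1_norm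
    proof eventually_elim
      case (elim y)
      have "((\<lambda>t. F t y) has_real_derivative F' t y) (at t)" for t
      proof -
        have u': "((\<lambda>t. u t y) has_real_derivative w t y) (at t)"
          unfolding u_def w_def by (auto intro!: derivative_eq_intros)
        have w': "((\<lambda>t. w t y) has_real_derivative - u t y) (at t)"
          unfolding u_def w_def by (auto intro!: derivative_eq_intros)
        have "(g has_real_derivative g' (u t y)) (at (u t y) within range (\<lambda>t. u t y))"
          using der[OF le1(1)[OF elim, of t]] by (rule DERIV_subset) (use le1(1)[OF elim] in \<open>fastforce simp: abs_le_iff\<close>)
        from DERIV_image_chain[OF this u'] have "((\<lambda>t. g (u t y)) has_real_derivative g' (u t y) * w t y) (at t)"
          by (simp add: o_def)
        from DERIV_mult[OF this w'] show ?thesis by (simp add: F_def F'_def algebra_simps)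
      qed
      moreover have "\<bar>F' t y\<bar> \<le> B' + B" for t
      proof -
        have "\<bar>g' (u t y)\<bar> * \<bar>w t y\<bar> * \<bar>w t y\<bar> \<le> B' * 1 * 1"
          using B'[of "u t y"] le1[OF elim, of t] by (intro mult_mono) auto
        moreover have "\<bar>g (u t y)\<bar> * \<bar>u t y\<bar> \<le> B * 1"
          using B[of "u t y"] le1[OF elim, of t] by (intro mult_mono) auto
        ultimately show ?thesis
          using abs_triangle_ineq4[of "g' (u t y) * w t y * w t y" "g (u t y) * u t y"]
          unfolding F'_def abs_mult by linarith
      qed
      ultimately show ?case by simp
    qed
  qed (auto simp: F'_def[abs_def])
  moreover have "((\<lambda>\<phi>. \<integral>y. F \<phi> y \<partial>?S) has_real_derivative 0) (at 0)"
    unfolding const by simp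
  ultimately have "(\<integral>y. F' 0 y \<partial>?S) = 0" by (rule DERIV_unique)
  moreover have "(\<integral>y. F' 0 y \<partial>?S) = (\<integral>y. g' (y $ i) * (y $ j)\<^sup>2 \<partial>?S) - (\<integral>y. g (y $ i) * y $ i \<partial>?S)"
  proof -
    have c1: "\<bar>y $ k\<bar> \<le> 1" if "norm y = 1" for y :: "real ^ 'n" and k
      using component_le_norm_cart[of y k] that by simp
    have "integrable ?S (\<lambda>y. g' (y $ i) * (y $ j)\<^sup>2)"
    proof (rule S.integrable_const_bound[where B = B'])
      show "AE y in ?S. norm (g' (y $ i) * (y $ j)\<^sup>2) \<le> B'"
        using AE_sphere_uniform_1_norm
      proof eventually_elim
        case (elim y)
        have "\<bar>g' (y $ i)\<bar> * \<bar>(y $ j)\<^sup>2\<bar> \<le> B' * 1"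
          using B'[OF c1[OF elim, of i]] c1[OF elim, of j] by (intro mult_mono) (auto simp: abs_square_le_1)
        then show ?case by (simp add: abs_mult)
      qed
    qed simp
    moreover have "integrable ?S (\<lambda>y. g (y $ i) * y $ i)"
    proof (rule S.integrable_const_bound[where B = B])
      show "AE y in ?S. norm (g (y $ i) * y $ i) \<le> B"
        using AE_sphere_uniform_1_norm
      proof eventually_elim
        case (elim y)
        have "\<bar>g (y $ i)\<bar> * \<bar>y $ i\<bar> \<le> B * 1"
          using B[OF c1[OF elim, of i]] c1[OF elim, of i] by (intro mult_mono) auto
        then show ?case by (simp add: abs_mult)
      qed
    qed simp
    ultimately show ?thesis
      unfolding F'_def u_def w_def by (simp add: power2_eq_square mult.assoc)
  qed
  ultimately show ?thesis by simp
qed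

text \<open>Sum of the coordinate version over all \<open>j \<noteq> i\<close>: on the unit sphere
  the squares of these coordinates add up to \<open>1 - (y $ i)\<^sup>2\<close>.\<close>

lemma sphere_uniform_integration_by_parts:
  fixes g g' :: "real \<Rightarrow> real" and i :: "'n::finite"
  assumes [measurable]: "g \<in> borel_measurable borel" "g' \<in> borel_measurable borel"
    and der: "\<And>x. \<bar>x\<bar> \<le> 1 \<Longrightarrow> (g has_real_derivative g' x) (at x within {-1..1})"
    and cont: "continuous_on {-1..1} g'"
  shows "(\<integral>y. g' (y $ i) * (1 - (y $ i)\<^sup>2) \<partial>sphere_uniform 1)
     = real (CARD('n) - 1) * (\<integral>y. g (y $ i) * y $ i \<partial>(sphere_uniform 1 :: (real ^ 'n) measure))"
proof -
  let ?S = "sphere_uniform 1 :: (real ^ 'n) measure"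
  interpret S: prob_space ?S by (rule prob_space_sphere_uniform)
  obtain B' where B': "\<And>x. \<bar>x\<bar> \<le> 1 \<Longrightarrow> \<bar>g' x\<bar> \<le> B'"
    using continuous_on_unit_interval_bounded[OF cont] by blast
  have int: "integrable ?S (\<lambda>y. g' (y $ i) * (y $ j)\<^sup>2)" for j
  proof (rule S.integrable_const_bound[where B = B'])
    show "AE y in ?S. norm (g' (y $ i) * (y $ j)\<^sup>2) \<le> B'"
      using AE_sphere_uniform_1_norm
    proof eventually_elim
      case (elim y)
      have "\<bar>g' (y $ i)\<bar> * \<bar>(y $ j)\<^sup>2\<bar> \<le> B' * 1"
        using B'[of "y $ i"] component_le_norm_cart[of y i] component_le_norm_cart[of y j] elim
        by (intro mult_mono) (auto simp: abs_square_le_1)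
      then show ?case by (simp add: abs_mult)
    qed
  qed simp
  have "(\<integral>y. g' (y $ i) * (1 - (y $ i)\<^sup>2) \<partial>?S) = (\<integral>y. (\<Sum>j\<in>UNIV - {i}. g' (y $ i) * (y $ j)\<^sup>2) \<partial>?S)"
  proof (rule integral_cong_AE)
    show "AE y in ?S. g' (y $ i) * (1 - (y $ i)\<^sup>2) = (\<Sum>j\<in>UNIV - {i}. g' (y $ i) * (y $ j)\<^sup>2)"
      using AE_sphere_uniform_1_norm
    proof eventually_elim
      case (elim y)
      have "(norm y)\<^sup>2 = (\<Sum>j\<in>UNIV. (y $ j)\<^sup>2)"
        unfolding power2_norm_eq_inner inner_vec_def by (simp add: power2_eq_square)
      then have "1 - (y $ i)\<^sup>2 = (\<Sum>j\<in>UNIV - {i}. (y $ j)\<^sup>2)"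
        using elim by (simp add: sum.remove[of UNIV i])
      then show ?case by (simp add: sum_distrib_left)
    qed
  qed simp_all
  also have "\<dots> = (\<Sum>j\<in>UNIV - {i}. (\<integral>y. g' (y $ i) * (y $ j)\<^sup>2 \<partial>?S))"
    by (rule Bochner_Integration.integral_sum) (rule int)
  also have "\<dots> = (\<Sum>j\<in>UNIV - {i}. (\<integral>y. g (y $ i) * y $ i \<partial>?S))"
    by (intro sum.cong refl sphere_uniform_integration_by_parts_coordinate der cont) auto
  finally show ?thesis by simp
qed

section \<open>Moments of the uniform measure on the sphere\<close>

lemma AE_sphere_uniform_1_component: "AE y in (sphere_uniform 1 :: (real ^ 'n::finite) measure). \<bar>y $ i\<bar> \<le> 1"
  using AE_sphere_uniform_1_norm by eventually_elim (metis component_le_norm_cart)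

lemma AE_sphere_uniform_1_component_neq:
  assumes "CARD('n::finite) \<ge> 2"
  shows "AE y in (sphere_uniform 1 :: (real ^ 'n) measure). \<bar>y $ i\<bar> \<le> 1 \<and> y $ i \<noteq> 1"
proof -
  have d': "DIM(real ^ 'n) \<ge> 2" using assms by simp
  show ?thesis
    using AE_sphere_uniform_1_norm AE_sphere_uniform_1_neq[OF d', of "axis i 1"]
  proof eventually_elim
    case (elim y)
    have "y = axis i 1" if "y $ i = 1"
    proof -
      have "(norm (y - axis i 1))\<^sup>2 = (norm y)\<^sup>2 - 2 * (y \<bullet> axis i 1) + (norm (axis i 1 :: real^'n))\<^sup>2"
        by (simp add: power2_norm_eq_inner inner_diff inner_commute)
      also have "\<dots> = 0" using elim that by (simp add: inner_axis)
      finally show ?thesis by simp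
    qed
    with elim show ?case using component_le_norm_cart[of y i] by auto
  qed
qed

text \<open>Integration by parts applied to the power \<open>m\<close>. For \<open>m = 0\<close> the
  truncated exponent \<open>m - 1\<close> is harmless, because the factor \<open>real m\<close>
  vanishes.\<close>

lemma sphere_uniform_moment_Suc:
  fixes i :: "'n::finite"
  assumes "CARD('n) \<ge> 2"
  shows "(real m + real CARD('n) - 1) * (\<integral>y. (y $ i) ^ Suc m \<partial>(sphere_uniform 1 :: (real ^ 'n) measure))
     = real m * (\<integral>y. (y $ i) ^ (m - 1) \<partial>(sphere_uniform 1 :: (real ^ 'n) measure))"
proof -
  let ?S = "sphere_uniform 1 :: (real ^ 'n) measure"
  interpret S: prob_space ?S by (rule prob_space_sphere_uniform)
  have int: "integrable ?S (\<lambda>y. (y $ i) ^ k)" for k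
  proof (rule S.integrable_const_bound[where B = 1])
    show "AE y in ?S. norm ((y $ i) ^ k) \<le> 1"
      using AE_sphere_uniform_1_norm
      by eventually_elim (metis component_le_norm_cart norm_power power_le_one real_norm_def abs_ge_zero)
  qed simp
  have "(\<integral>y. real m * (y $ i) ^ (m - 1) * (1 - (y $ i)\<^sup>2) \<partial>?S) = real (CARD('n) - 1) * (\<integral>y. (y $ i) ^ m * y $ i \<partial>?S)"
    by (rule sphere_uniform_integration_by_parts)
       (auto intro!: derivative_eq_intros continuous_intros)
  also have "(\<lambda>y::real^'n. real m * (y $ i) ^ (m - 1) * (1 - (y $ i)\<^sup>2)) = (\<lambda>y. real m * (y $ i) ^ (m - 1) - real m * (y $ i) ^ Suc m)"
    by (cases m) (auto simp: fun_eq_iff algebra_simps power2_eq_square)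
  also have "(\<integral>y. real m * (y $ i) ^ (m - 1) - real m * (y $ i) ^ Suc m \<partial>?S)
     = real m * (\<integral>y. (y $ i) ^ (m - 1) \<partial>?S) - real m * (\<integral>y. (y $ i) ^ Suc m \<partial>?S)"
    using int[of "m - 1"] int[of "Suc m"]
    by (subst Bochner_Integration.integral_diff) (auto simp del: power_Suc)
  also have "(\<integral>y. (y $ i) ^ m * y $ i \<partial>?S) = (\<integral>y. (y $ i) ^ Suc m \<partial>?S)"
    by (simp add: mult.commute)
  finally show ?thesis using assms by (simp add: of_nat_diff algebra_simps)
qed

lemma sphere_uniform_moments:
  fixes i :: "'n::finite"
  assumes "CARD('n) \<ge> 2"
  shows sphere_uniform_moment_odd: "(\<integral>y. (y $ i) ^ (2 * n + 1) \<partial>(sphere_uniform 1 :: (real ^ 'n) measure)) = 0"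
    and sphere_uniform_moment_even: "(\<integral>y. (y $ i) ^ (2 * n) \<partial>(sphere_uniform 1 :: (real ^ 'n) measure))
      = pochhammer (1 / 2) n / pochhammer (real CARD('n) / 2) n"
proof -
  let ?S = "sphere_uniform 1 :: (real ^ 'n) measure"
  interpret S: prob_space ?S by (rule prob_space_sphere_uniform)
  note rec = sphere_uniform_moment_Suc[OF assms]
  show "(\<integral>y. (y $ i) ^ (2 * n + 1) \<partial>?S) = 0"
  proof (induction n)
    case 0
    then show ?case using rec[of 0 i] assms by simp
  next
    case (Suc n)
    then show ?case using rec[of "2 * n + 2" i] assms by simp
  qed
  show "(\<integral>y. (y $ i) ^ (2 * n) \<partial>?S) = pochhammer (1 / 2) n / pochhammer (real CARD('n) / 2) n"
  proof (induction n)
    case 0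
    show ?case using S.prob_space by simp
  next
    case (Suc n)
    define E where "E m = (\<integral>y. (y $ i) ^ m \<partial>?S)" for m
    have q: "pochhammer (real CARD('n) / 2) n > 0" using assms by (intro pochhammer_pos) auto
    have "(real (2 * n + 1) + real CARD('n) - 1) * E (Suc (2 * n + 1)) = real (2 * n + 1) * E (2 * n + 1 - 1)"
      unfolding E_def by (rule rec)
    then have "(real CARD('n) / 2 + real n) * E (2 * Suc n) = (1 / 2 + real n) * E (2 * n)"
      by (simp add: algebra_simps)
    then have "E (2 * Suc n) = (1 / 2 + real n) * E (2 * n) / (real CARD('n) / 2 + real n)"
      using assms by (simp add: eq_divide_eq mult.commute)
    then show ?case
      using Suc unfolding E_def[symmetric] pochhammer_Suc by simp
  qed
qed

lemma binomial_series_pochhammer: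
  fixes a x :: real
  assumes "\<bar>x\<bar> < 1"
  shows "(\<lambda>n. pochhammer a n / fact n * x ^ n) sums (1 - x) powr (- a)"
    and "summable (\<lambda>n. \<bar>pochhammer a n / fact n * x ^ n\<bar>)"
proof -
  have *: "(- a gchoose n) * (- x) ^ n = pochhammer a n / fact n * x ^ n" for a x :: real and n
  proof -
    have "(- 1 :: real) ^ n * (- x) ^ n = x ^ n" by (simp flip: power_mult_distrib)
    then show ?thesis by (simp add: gbinomial_pochhammer)
  qed
  show "(\<lambda>n. pochhammer a n / fact n * x ^ n) sums (1 - x) powr (- a)"
    using gen_binomial_real[of "- x" "- a"] assms by (simp only: *) simp
  \<comment> \<open>Absolute convergence is read off the series with \<open>\<bar>a\<bar>\<close>
    and \<open>\<bar>x\<bar>\<close>, whose terms are nonnegative and dominate.\<close>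
  have "summable (\<lambda>n. pochhammer \<bar>a\<bar> n / fact n * \<bar>x\<bar> ^ n)"
    using gen_binomial_real[of "- \<bar>x\<bar>" "- \<bar>a\<bar>"] assms by (simp only: *) (auto simp: sums_iff)
  moreover have "\<bar>pochhammer a n\<bar> \<le> pochhammer \<bar>a\<bar> n" for n
    unfolding pochhammer_prod abs_prod by (intro prod_mono) auto
  then have "norm \<bar>pochhammer a n / fact n * x ^ n\<bar> \<le> pochhammer \<bar>a\<bar> n / fact n * \<bar>x\<bar> ^ n" for n
    by (simp add: abs_mult power_abs divide_right_mono mult_right_mono)
  ultimately show "summable (\<lambda>n. \<bar>pochhammer a n / fact n * x ^ n\<bar>)"
    by (intro summable_comparison_test'[of _ 0 "\<lambda>n. \<bar>pochhammer a n / fact n * x ^ n\<bar>"])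
qed

text \<open>Termwise integration of the binomial series. Odd moments vanish; in the even terms the
  doubling formulas for Pochhammer symbols and factorials cancel against the moment. Keeping
  \<open>z < 1\<close> supplies a summable majorant; the value at 1 is reached by a separate
  limit.\<close>

lemma sphere_uniform_binomial_series:
  fixes i :: "'n::finite" and a z :: real
  assumes d: "CARD('n) \<ge> 2" and z: "0 \<le> z" "z < 1"
  shows "(\<integral>y. (1 - z * y $ i) powr (- a) \<partial>(sphere_uniform 1 :: (real ^ 'n) measure))
     = (\<Sum>n. hyp_term (a / 2) (a / 2 + 1 / 2) (real CARD('n) / 2) n * z ^ (2 * n))"
proof -
  let ?S = "sphere_uniform 1 :: (real ^ 'n) measure"
  interpret S: prob_space ?S by (rule prob_space_sphere_uniform)
  define p where "p n = pochhammer a n / fact n" for n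
  have c1: "AE y in ?S. \<bar>y $ i\<bar> \<le> 1"
    using AE_sphere_uniform_1_norm by eventually_elim (metis component_le_norm_cart)
  have int: "integrable ?S (\<lambda>y. p n * (z * y $ i) ^ n)" for n
  proof (rule S.integrable_const_bound[where B = "\<bar>p n\<bar> * \<bar>z ^ n\<bar> * 1"])
    show "AE y in ?S. norm (p n * (z * y $ i) ^ n) \<le> \<bar>p n\<bar> * \<bar>z ^ n\<bar> * 1"
      using c1 by eventually_elim
       (auto simp: abs_mult power_mult_distrib power_abs intro!: mult_left_mono mult_left_le power_le_one)
  qed simp
  have sum: "summable (\<lambda>n. \<bar>p n * z ^ n\<bar>)"
    using binomial_series_pochhammer(2)[of z a] z by (simp add: p_def)
  have le: "\<bar>p n * (z * y $ i) ^ n\<bar> \<le> \<bar>p n * z ^ n\<bar>" if "\<bar>y $ i\<bar> \<le> 1" for n and y :: "real ^ 'n"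
    using that by (auto simp: abs_mult power_mult_distrib power_abs intro!: mult_left_mono mult_left_le power_le_one)
  have s: "(\<lambda>n. (\<integral>y. p n * (z * y $ i) ^ n \<partial>?S)) sums (\<integral>y. (\<Sum>n. p n * (z * y $ i) ^ n) \<partial>?S)"
  proof (rule sums_integral[OF int])
    show "AE y in ?S. summable (\<lambda>n. norm (p n * (z * y $ i) ^ n))"
      using c1
    proof eventually_elim
      case (elim y)
      show ?case by (rule summable_comparison_test'[OF sum, of 0]) (use le[OF elim] in simp)
    qed
    show "summable (\<lambda>n. \<integral>y. norm (p n * (z * y $ i) ^ n) \<partial>?S)"
    proof (rule summable_comparison_test'[OF sum, of 0])
      fix n
      have "(\<integral>y. norm (p n * (z * y $ i) ^ n) \<partial>?S) \<le> (\<integral>y. \<bar>p n * z ^ n\<bar> \<partial>?S)"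
        by (intro integral_mono_AE integrable_norm int) (use c1 le in auto)
      then show "norm (\<integral>y. norm (p n * (z * y $ i) ^ n) \<partial>?S) \<le> \<bar>p n * z ^ n\<bar>"
        using S.prob_space by simp
    qed
  qed
  have "(\<integral>y. (\<Sum>n. p n * (z * y $ i) ^ n) \<partial>?S) = (\<integral>y. (1 - z * y $ i) powr (- a) \<partial>?S)"
  proof (rule integral_cong_AE)
    show "AE y in ?S. (\<Sum>n. p n * (z * y $ i) ^ n) = (1 - z * y $ i) powr (- a)"
      using c1
    proof eventually_elim
      case (elim y)
      have "\<bar>z * y $ i\<bar> \<le> z * 1" unfolding abs_mult using z elim by (intro mult_mono) auto
      then have "\<bar>z * y $ i\<bar> < 1" using z by simp
      from binomial_series_pochhammer(1)[OF this, of a] show ?case by (simp add: p_def sums_iff)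
    qed
  qed simp_all
  with s have "(\<lambda>n. p n * z ^ n * (\<integral>y. (y $ i) ^ n \<partial>?S)) sums (\<integral>y. (1 - z * y $ i) powr (- a) \<partial>?S)"
    by (simp add: power_mult_distrib mult.assoc)
  then have "(\<lambda>n. p (2 * n) * z ^ (2 * n) * (\<integral>y. (y $ i) ^ (2 * n) \<partial>?S)) sums (\<integral>y. (1 - z * y $ i) powr (- a) \<partial>?S)"
  proof (subst sums_mono_reindex[where g = "\<lambda>n. 2 * n"])
    fix n :: nat assume "n \<notin> range (\<lambda>n. 2 * n)"
    then obtain k where "n = 2 * k + 1" by (metis oddE rangeI evenE)
    then show "p n * z ^ n * (\<integral>y. (y $ i) ^ n \<partial>?S) = 0" using sphere_uniform_moment_odd[OF d, of i k] by simp
  qed (auto simp: strict_mono_def)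
  moreover have "p (2 * n) * z ^ (2 * n) * (\<integral>y. (y $ i) ^ (2 * n) \<partial>?S)
      = hyp_term (a / 2) (a / 2 + 1 / 2) (real CARD('n) / 2) n * z ^ (2 * n)" for n
  proof -
    have "pochhammer a (2 * n) = 2 ^ (2 * n) * pochhammer (a / 2) n * pochhammer (a / 2 + 1 / 2) n"
      using pochhammer_double[of "a / 2" n] by simp
    moreover have "pochhammer (1 / 2 :: real) n > 0" by (rule pochhammer_pos) simp
    moreover have "(fact (2 * n) :: real) = 2 ^ (2 * n) * pochhammer (1 / 2) n * fact n" by (rule fact_double)
    ultimately show ?thesis
      unfolding sphere_uniform_moment_even[OF d] p_def hyp_term_def by simp
  qed
  ultimately show ?thesis by (simp add: sums_iff)
qed

text \<open>The limit of the binomial expansion as \<open>z\<close> increases to 1: the series is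
  controlled by its absolute summability at 1, the integral by a majorant built from the limit
  function. The integrability of that function is a genuine condition, as it is singular at
  \<open>y $ i = 1\<close> when \<open>s > 0\<close>.\<close>

lemma sphere_uniform_integral_eq_c_const:
  fixes i :: "'n::finite" and s :: real
  assumes s: "-2 < s" "s \<le> real CARD('n) - 4"
    and int: "integrable (sphere_uniform 1 :: (real ^ 'n) measure) (\<lambda>y. (1 - y $ i) powr (- s / 2))"
  shows "(\<integral>y. (2 - 2 * y $ i) powr (- s / 2) \<partial>(sphere_uniform 1 :: (real ^ 'n) measure)) = c_const s CARD('n)"
proof -
  let ?S = "sphere_uniform 1 :: (real ^ 'n) measure"
  interpret S: prob_space ?S by (rule prob_space_sphere_uniform)
  have d: "CARD('n) \<ge> 2" using s by linarith
  define a where "a = s / 2"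
  define h where "h = hyp_term (a / 2) (a / 2 + 1 / 2) (real CARD('n) / 2)"
  define z where "z k = 1 - 1 / real (k + 1)" for k
  have z: "0 \<le> z k" "z k < 1" for k by (auto simp: z_def)
  have "(\<lambda>k. 1 - 1 / real (k + 1)) \<longlonglongrightarrow> 1 - 0"
    by (intro tendsto_diff tendsto_const) (use LIMSEQ_inverse_real_of_nat in \<open>simp add: inverse_eq_divide\<close>)
  then have zlim: "z \<longlonglongrightarrow> 1" unfolding z_def[abs_def] by simp
  note c1 = AE_sphere_uniform_1_component_neq[OF d, of i]
  have sumh: "summable (\<lambda>n. \<bar>h n\<bar>)"
    unfolding h_def using s d by (intro summable_hyp_term) (auto simp: a_def)
  have "(\<lambda>k. \<Sum>n. h n * z k ^ (2 * n)) \<longlonglongrightarrow> suminf h"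
  proof (rule tannerys_theorem[THEN conjunct2, THEN conjunct2])
    show "(\<lambda>k. h n * z k ^ (2 * n)) \<longlonglongrightarrow> h n" for n
      using tendsto_mult[OF tendsto_const tendsto_power[OF zlim, of "2 * n"], of "h n"] by simp
    show "eventually (\<lambda>(n, k). norm (h n * z k ^ (2 * n)) \<le> \<bar>h n\<bar>) (at_top \<times>\<^sub>F sequentially)"
      using z(1) less_imp_le[OF z(2)]
      by (intro always_eventually) (auto simp: abs_mult intro!: mult_left_le power_le_one)
  qed (use sumh in auto)
  moreover have "(\<Sum>n. h n * z k ^ (2 * n)) = (\<integral>y. (1 - z k * y $ i) powr (- a) \<partial>?S)" for k
    unfolding h_def using sphere_uniform_binomial_series[OF d z(1)[of k] z(2)[of k], where a = a and i = i] by simp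
  moreover have "(\<lambda>k. (\<integral>y. (1 - z k * y $ i) powr (- a) \<partial>?S)) \<longlonglongrightarrow> (\<integral>y. (1 - y $ i) powr (- a) \<partial>?S)"
  proof (rule integral_dominated_convergence[where w = "\<lambda>y. (1 - y $ i) powr (- a) + (2 powr \<bar>a\<bar> + 1)"])
    show "integrable ?S (\<lambda>y. (1 - y $ i) powr (- a) + (2 powr \<bar>a\<bar> + 1))"
      using int by (auto simp: a_def)
    show "AE y in ?S. (\<lambda>k. (1 - z k * y $ i) powr (- a)) \<longlonglongrightarrow> (1 - y $ i) powr (- a)"
      using c1
    proof eventually_elim
      case (elim y)
      have "(\<lambda>k. (1 - z k * y $ i) powr (- a)) \<longlonglongrightarrow> (1 - 1 * y $ i) powr (- a)"
        using elim by (intro tendsto_intros zlim) auto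
      then show ?case by simp
    qed
    show "AE y in ?S. norm ((1 - z k * y $ i) powr (- a)) \<le> (1 - y $ i) powr (- a) + (2 powr \<bar>a\<bar> + 1)" for k
      using c1
    proof eventually_elim
      case (elim y)
      define t where "t = y $ i"
      have t: "\<bar>t\<bar> \<le> 1" "t < 1" using elim by (auto simp: t_def)
      have zt: "\<bar>z k * t\<bar> \<le> 1" unfolding abs_mult using t z[of k] by (intro mult_le_one) auto
      \<comment> \<open>Each summand of the majorant serves one case: the limit function itself, the
        constant 1, and the constant \<open>2 powr \<bar>a\<bar>\<close>.\<close>
      consider "a \<ge> 0" "t \<ge> 0" | "a \<ge> 0" "t < 0" | "a < 0" by linarith
      then have "(1 - z k * t) powr (- a) \<le> (1 - t) powr (- a) + (2 powr \<bar>a\<bar> + 1)"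
      proof cases
        case 1
        have "z k * t \<le> t" using 1 z[of k] by (intro mult_left_le_one_le) auto
        then have "(1 - z k * t) powr (- a) \<le> (1 - t) powr (- a)"
          using 1 t by (intro powr_mono2') auto
        then show ?thesis by (simp add: add_increasing2)
      next
        case 2
        have "z k * t \<le> 0" using 2 z[of k] by (simp add: mult_nonneg_nonpos)
        then have "(1 - z k * t) powr (- a) \<le> 1 powr (- a)"
          using 2 by (intro powr_mono2') auto
        then show ?thesis by (simp add: add_increasing)
      next
        case 3
        have "(1 - z k * t) powr (- a) \<le> 2 powr (- a)"
          using zt 3 by (intro powr_mono2) auto
        also have "\<dots> = 2 powr \<bar>a\<bar>" using 3 by simp
        finally show ?thesis by (simp add: add_increasing)
      qed
      then show ?case by (simp add: t_def)
    qed
  qed simp_all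
  ultimately have "(\<integral>y. (1 - y $ i) powr (- a) \<partial>?S) = suminf h"
    using LIMSEQ_unique by fastforce
  moreover have "(\<integral>y. (2 - 2 * y $ i) powr (- a) \<partial>?S) = 2 powr (- a) * (\<integral>y. (1 - y $ i) powr (- a) \<partial>?S)"
  proof -
    have "(\<integral>y. (2 - 2 * y $ i) powr (- a) \<partial>?S) = (\<integral>y. 2 powr (- a) * (1 - y $ i) powr (- a) \<partial>?S)"
    proof (rule integral_cong_AE)
      show "AE y in ?S. (2 - 2 * y $ i) powr (- a) = 2 powr (- a) * (1 - y $ i) powr (- a)"
        using c1
      proof eventually_elim
        case (elim y)
        have "2 - 2 * y $ i = 2 * (1 - y $ i)" by simp
        then show ?case using elim by (simp only: powr_mult)
      qed
    qed simp_all
    then show ?thesis by simp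
  qed
  ultimately show ?thesis
    using c_const_eq_Gauss[OF s] by (simp add: a_def h_def)
qed

section \<open>Spherical means of smooth radial profiles\<close>

lemma integrable_sphere_uniform_component:
  fixes h :: "real \<Rightarrow> real"
  assumes [measurable]: "h \<in> borel_measurable borel" and "continuous_on {-1..1} h"
  shows "integrable (sphere_uniform 1 :: (real ^ 'n::finite) measure) (\<lambda>y. h (y $ i))"
proof -
  interpret S: prob_space "sphere_uniform 1 :: (real ^ 'n) measure" by (rule prob_space_sphere_uniform)
  obtain B where B: "\<And>x. \<bar>x\<bar> \<le> 1 \<Longrightarrow> \<bar>h x\<bar> \<le> B"
    using continuous_on_unit_interval_bounded[OF assms(2)] by blast
  show ?thesis
  proof (rule S.integrable_const_bound[where B = B])
    show "AE y in sphere_uniform 1. norm (h (y $ i)) \<le> B"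
      using AE_sphere_uniform_1_component[of i] by eventually_elim (use B in simp)
  qed simp
qed

text \<open>The law of cosines: \<open>r\<close> and \<open>R\<close> are the distances of two
  points from the origin and \<open>\<tau>\<close> is the cosine of the angle between them.\<close>

definition sq_dist :: "real \<Rightarrow> real \<Rightarrow> real \<Rightarrow> real" where
  "sq_dist R r \<tau> = r\<^sup>2 + R\<^sup>2 - 2 * r * R * \<tau>"

lemma sq_dist_ge:
  assumes "\<bar>\<tau>\<bar> \<le> 1"
  shows "sq_dist R r \<tau> \<ge> (\<bar>r\<bar> - \<bar>R\<bar>)\<^sup>2"
proof -
  have "r * R * \<tau> \<le> \<bar>r * R\<bar> * 1"
    using mult_left_mono[OF assms, of "\<bar>r * R\<bar>"] abs_ge_self[of "r * R * \<tau>"] abs_mult[of "r * R" \<tau>] by linarith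
  then show ?thesis by (simp add: sq_dist_def power2_diff abs_mult)
qed

lemma sq_dist_nonneg: "\<bar>\<tau>\<bar> \<le> 1 \<Longrightarrow> sq_dist R r \<tau> \<ge> 0"
  by (rule order_trans[OF zero_le_power2 sq_dist_ge])

lemma sq_dist_le:
  assumes "\<bar>\<tau>\<bar> \<le> 1"
  shows "sq_dist R r \<tau> \<le> (\<bar>r\<bar> + \<bar>R\<bar>)\<^sup>2"
proof -
  have "- (r * R * \<tau>) \<le> \<bar>r * R\<bar> * 1"
    using mult_left_mono[OF assms, of "\<bar>r * R\<bar>"] abs_ge_minus_self[of "r * R * \<tau>"] abs_mult[of "r * R" \<tau>] by linarith
  then show ?thesis by (simp add: sq_dist_def power2_sum abs_mult mult_ac)
qed

definition sphere_mean :: "'n::finite \<Rightarrow> real \<Rightarrow> (real \<Rightarrow> real) \<Rightarrow> real \<Rightarrow> real" where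
  "sphere_mean i R f r = (\<integral>y. f (sq_dist R r (y $ i)) \<partial>(sphere_uniform 1 :: (real ^ 'n) measure))"

text \<open>
  Profiles are functions of the squared distance, smooth slightly beyond the half-line \<open>{0..}\<close>. By
  invariance the mean over the sphere only depends on the distance \<open>r\<close> from the center, and is taken
  at the point \<open>r\<close> on the axis \<open>i\<close>.
\<close>

locale smooth_profile =
  fixes i :: "'n::finite" and d :: nat and R e :: real and f f' f'' :: "real \<Rightarrow> real"
  assumes e_pos: "e > 0"
    and d_eq: "d = CARD('n)"
    and card_ge: "d \<ge> 3"
    and meas [measurable]: "f \<in> borel_measurable borel" "f' \<in> borel_measurable borel" "f'' \<in> borel_measurable borel"
    and der: "\<And>q. q > - e \<Longrightarrow> (f has_real_derivative f' q) (at q)"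
    and der': "\<And>q. q > - e \<Longrightarrow> (f' has_real_derivative f'' q) (at q)"
    and cont'': "continuous_on {- e<..} f''"
begin

abbreviation "S \<equiv> sphere_uniform 1 :: (real ^ 'n) measure"

definition mean' where "mean' r = (\<integral>y. f' (sq_dist R r (y $ i)) * (2 * r - 2 * R * y $ i) \<partial>S)"
text \<open>In dimension \<open>d\<close> the function \<open>f ((norm x)\<^sup>2)\<close> has
  Laplacian \<open>4 * q * f'' q + 2 * d * f' q\<close> at \<open>q = (norm x)\<^sup>2\<close>; this
  is averaged over the sphere.\<close>

definition laplacian where
  "laplacian r = (\<integral>y. 4 * sq_dist R r (y $ i) * f'' (sq_dist R r (y $ i)) + 2 * real d * f' (sq_dist R r (y $ i)) \<partial>S)"

lemma cont: "continuous_on {- e<..} f" and cont': "continuous_on {- e<..} f'"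
proof -
  show "continuous_on {- e<..} f"
    by (rule DERIV_continuous_on[where D = f']) (auto intro: has_field_derivative_at_within der)
  show "continuous_on {- e<..} f'"
    by (rule DERIV_continuous_on[where D = f'']) (auto intro: has_field_derivative_at_within der')
qed

lemma sq_dist_dom: "\<bar>\<tau>\<bar> \<le> 1 \<Longrightarrow> sq_dist R r \<tau> > - e"
  using sq_dist_nonneg[of \<tau> R r] e_pos by linarith

lemma cont_comp: "continuous_on {-1..1} (\<lambda>\<tau>. h (sq_dist R r \<tau>))" if "continuous_on {- e<..} h"
proof (rule continuous_on_compose2[OF that])
  show "continuous_on {-1..1} (sq_dist R r)" unfolding sq_dist_def[abs_def] by (intro continuous_intros)
  show "sq_dist R r ` {-1..1} \<subseteq> {- e<..}" using sq_dist_dom by (auto simp: abs_le_iff)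
qed

lemma meas_sq_dist [measurable]: "sq_dist R r \<in> borel_measurable borel"
  unfolding sq_dist_def[abs_def] by measurable

lemma bounded_on_sq_dist:
  fixes h :: "real \<Rightarrow> real"
  assumes "continuous_on {- e<..} h"
  obtains B where "B \<ge> 0" "\<And>t \<tau>. \<bar>t\<bar> \<le> M \<Longrightarrow> \<bar>\<tau>\<bar> \<le> 1 \<Longrightarrow> \<bar>h (sq_dist R t \<tau>)\<bar> \<le> B"
proof -
  have "continuous_on {0..(M + \<bar>R\<bar>)\<^sup>2} h" using e_pos by (intro continuous_on_subset[OF assms]) auto
  then have "bounded (h ` {0..(M + \<bar>R\<bar>)\<^sup>2})" by (intro compact_imp_bounded compact_continuous_image) auto
  then obtain B where B: "\<forall>q\<in>{0..(M + \<bar>R\<bar>)\<^sup>2}. \<bar>h q\<bar> \<le> B" by (auto simp: bounded_iff)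
  show ?thesis
  proof (rule that[of "\<bar>B\<bar>"])
    fix t \<tau> :: real assume t: "\<bar>t\<bar> \<le> M" "\<bar>\<tau>\<bar> \<le> 1"
    have "(\<bar>t\<bar> + \<bar>R\<bar>)\<^sup>2 \<le> (M + \<bar>R\<bar>)\<^sup>2" using t by (intro power_mono) auto
    then have "sq_dist R t \<tau> \<in> {0..(M + \<bar>R\<bar>)\<^sup>2}"
      using sq_dist_nonneg[OF t(2), of R t] sq_dist_le[OF t(2), of R t] by auto
    with B show "\<bar>h (sq_dist R t \<tau>)\<bar> \<le> \<bar>B\<bar>" by fastforce
  qed simp
qed

lemma der_sq_dist: "((\<lambda>t. sq_dist R t \<tau>) has_real_derivative (2 * t - 2 * R * \<tau>)) (at t)"
  unfolding sq_dist_def by (auto intro!: derivative_eq_intros)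

lemma bound_factor: "\<bar>2 * t - 2 * R * \<tau>\<bar> \<le> 2 * M + 2 * \<bar>R\<bar>" if "\<bar>t\<bar> \<le> M" "\<bar>\<tau>\<bar> \<le> 1" for t \<tau> M
proof -
  have "\<bar>R * \<tau>\<bar> \<le> \<bar>R\<bar> * 1" unfolding abs_mult using that by (intro mult_left_mono) auto
  then show ?thesis using that by linarith
qed

lemma mean_deriv: "(sphere_mean i R f has_real_derivative mean' r) (at r)"
proof -
  interpret S: prob_space S by (rule prob_space_sphere_uniform)
  define M where "M = \<bar>r\<bar> + 1"
  obtain B where B: "B \<ge> 0" "\<And>t \<tau>. \<bar>t\<bar> \<le> M \<Longrightarrow> \<bar>\<tau>\<bar> \<le> 1 \<Longrightarrow> \<bar>f' (sq_dist R t \<tau>)\<bar> \<le> B"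
    using bounded_on_sq_dist[OF cont'] by blast
  have "((\<lambda>t. \<integral>y. f (sq_dist R t (y $ i)) \<partial>S) has_real_derivative mean' r) (at r)"
    unfolding mean'_def
  proof (rule has_real_derivative_integral[of _ "r - 1" _ "r + 1"])
    show "finite_measure S" by (rule S.finite_measure)
    show "integrable S (\<lambda>y. f (sq_dist R t (y $ i)))" for t
      by (intro integrable_sphere_uniform_component cont_comp cont) measurable
    show "AE y in S. \<forall>t. r - 1 < t \<longrightarrow> t < r + 1 \<longrightarrow>
        ((\<lambda>t. f (sq_dist R t (y $ i))) has_real_derivative f' (sq_dist R t (y $ i)) * (2 * t - 2 * R * y $ i)) (at t) \<and>
        \<bar>f' (sq_dist R t (y $ i)) * (2 * t - 2 * R * y $ i)\<bar> \<le> B * (2 * M + 2 * \<bar>R\<bar>)"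
      using AE_sphere_uniform_1_component[of i]
    proof (eventually_elim, intro allI impI conjI)
      fix y :: "real ^ 'n" and t assume y: "\<bar>y $ i\<bar> \<le> 1" and t: "r - 1 < t" "t < r + 1"
      show "((\<lambda>t. f (sq_dist R t (y $ i))) has_real_derivative f' (sq_dist R t (y $ i)) * (2 * t - 2 * R * y $ i)) (at t)"
        by (rule DERIV_chain2[OF der[OF sq_dist_dom[OF y]] der_sq_dist])
      have "\<bar>t\<bar> \<le> M" using t by (auto simp: M_def)
      then show "\<bar>f' (sq_dist R t (y $ i)) * (2 * t - 2 * R * y $ i)\<bar> \<le> B * (2 * M + 2 * \<bar>R\<bar>)"
        unfolding abs_mult using B y bound_factor[of t M "y $ i"] by (intro mult_mono) auto
    qed
  qed (auto simp: measurable_compose)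
  then show ?thesis unfolding sphere_mean_def[abs_def] .
qed

lemma mean'_deriv: "(mean' has_real_derivative
    (\<integral>y. f'' (sq_dist R r (y $ i)) * (2 * r - 2 * R * y $ i)\<^sup>2 + 2 * f' (sq_dist R r (y $ i)) \<partial>S)) (at r)"
proof -
  interpret S: prob_space S by (rule prob_space_sphere_uniform)
  define M where "M = \<bar>r\<bar> + 1"
  obtain B where B: "B \<ge> 0" "\<And>t \<tau>. \<bar>t\<bar> \<le> M \<Longrightarrow> \<bar>\<tau>\<bar> \<le> 1 \<Longrightarrow> \<bar>f' (sq_dist R t \<tau>)\<bar> \<le> B"
    using bounded_on_sq_dist[OF cont'] by blast
  obtain C where C: "C \<ge> 0" "\<And>t \<tau>. \<bar>t\<bar> \<le> M \<Longrightarrow> \<bar>\<tau>\<bar> \<le> 1 \<Longrightarrow> \<bar>f'' (sq_dist R t \<tau>)\<bar> \<le> C"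
    using bounded_on_sq_dist[OF cont''] by blast
  have "((\<lambda>t. \<integral>y. f' (sq_dist R t (y $ i)) * (2 * t - 2 * R * y $ i) \<partial>S) has_real_derivative 
    (\<integral>y. f'' (sq_dist R r (y $ i)) * (2 * r - 2 * R * y $ i)\<^sup>2 + 2 * f' (sq_dist R r (y $ i)) \<partial>S)) (at r)"
  proof (rule has_real_derivative_integral[of _ "r - 1" _ "r + 1"])
    show "finite_measure S" by (rule S.finite_measure)
    show "integrable S (\<lambda>y. f' (sq_dist R t (y $ i)) * (2 * t - 2 * R * y $ i))" for t
      by (rule integrable_sphere_uniform_component[where h = "\<lambda>\<tau>. f' (sq_dist R t \<tau>) * (2 * t - 2 * R * \<tau>)"])
         (auto intro!: continuous_intros cont_comp cont')
    show "AE y in S. \<forall>t. r - 1 < t \<longrightarrow> t < r + 1 \<longrightarrow>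
        ((\<lambda>t. f' (sq_dist R t (y $ i)) * (2 * t - 2 * R * y $ i)) has_real_derivative
            f'' (sq_dist R t (y $ i)) * (2 * t - 2 * R * y $ i)\<^sup>2 + 2 * f' (sq_dist R t (y $ i))) (at t) \<and>
        \<bar>f'' (sq_dist R t (y $ i)) * (2 * t - 2 * R * y $ i)\<^sup>2 + 2 * f' (sq_dist R t (y $ i))\<bar>
          \<le> C * (2 * M + 2 * \<bar>R\<bar>)\<^sup>2 + 2 * B"
      using AE_sphere_uniform_1_component[of i]
    proof (eventually_elim, intro allI impI conjI)
      fix y :: "real ^ 'n" and t assume y: "\<bar>y $ i\<bar> \<le> 1" and t: "r - 1 < t" "t < r + 1"
      have 1: "((\<lambda>t. f' (sq_dist R t (y $ i))) has_real_derivative f'' (sq_dist R t (y $ i)) * (2 * t - 2 * R * y $ i)) (at t)"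
        by (rule DERIV_chain2[OF der'[OF sq_dist_dom[OF y]] der_sq_dist])
      have 2: "((\<lambda>t. 2 * t - 2 * R * y $ i) has_real_derivative 2) (at t)"
        by (auto intro!: derivative_eq_intros)
      show "((\<lambda>t. f' (sq_dist R t (y $ i)) * (2 * t - 2 * R * y $ i)) has_real_derivative
            f'' (sq_dist R t (y $ i)) * (2 * t - 2 * R * y $ i)\<^sup>2 + 2 * f' (sq_dist R t (y $ i))) (at t)"
        using DERIV_mult[OF 1 2] by (simp add: power2_eq_square mult.assoc add.commute)
      have tM: "\<bar>t\<bar> \<le> M" using t by (auto simp: M_def)
      have "\<bar>f'' (sq_dist R t (y $ i)) * (2 * t - 2 * R * y $ i)\<^sup>2\<bar> \<le> C * (2 * M + 2 * \<bar>R\<bar>)\<^sup>2"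
        unfolding abs_mult power_abs
        using C y tM power_mono[OF bound_factor[OF tM y], of 2] by (intro mult_mono) auto
      moreover have "\<bar>f' (sq_dist R t (y $ i))\<bar> \<le> B" using B(2)[OF tM y] .
      ultimately show "\<bar>f'' (sq_dist R t (y $ i)) * (2 * t - 2 * R * y $ i)\<^sup>2 + 2 * f' (sq_dist R t (y $ i))\<bar>
          \<le> C * (2 * M + 2 * \<bar>R\<bar>)\<^sup>2 + 2 * B" by linarith
    qed
  qed auto
  then show ?thesis unfolding mean'_def[abs_def] .
qed

text \<open>The polar form of the Laplacian of a radial function. Integration by parts on the sphere
  trades the mean of \<open>f' * \<tau>\<close> for one of
  \<open>f'' * (1 - \<tau>\<^sup>2)\<close>, and \<open>(2 * r - 2 * R * \<tau>)\<^sup>2 + 4 *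
  R\<^sup>2 * (1 - \<tau>\<^sup>2)\<close> is four times the squared distance.\<close>

lemma radial_laplacian: "((\<lambda>r. r ^ (d - 1) * mean' r) has_real_derivative r ^ (d - 1) * laplacian r) (at r)"
proof -
  let ?q = "\<lambda>y::real^'n. sq_dist R r (y $ i)"
  define D where "D = (\<integral>y. f'' (?q y) * (2 * r - 2 * R * y $ i)\<^sup>2 + 2 * f' (?q y) \<partial>S)"
  have int: "integrable S (\<lambda>y. h (?q y) * p (y $ i))"
    if "continuous_on {- e<..} h" "continuous_on {-1..1} p" "h \<in> borel_measurable borel" "p \<in> borel_measurable borel" for h p :: "real \<Rightarrow> real"
    using that by (intro integrable_sphere_uniform_component[where h = "\<lambda>\<tau>. h (sq_dist R r \<tau>) * p \<tau>"])
      (auto intro!: continuous_intros cont_comp)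
  have i1: "integrable S (\<lambda>y. f'' (?q y) * (2 * r - 2 * R * y $ i)\<^sup>2)"
    by (rule int[of f'' "\<lambda>\<tau>. (2 * r - 2 * R * \<tau>)\<^sup>2"]) (auto intro!: continuous_intros cont'')
  have i2: "integrable S (\<lambda>y. f' (?q y))"
    using int[of f' "\<lambda>\<tau>. 1"] cont' by simp
  have i3: "integrable S (\<lambda>y. f' (?q y) * y $ i)"
    by (rule int[of f' "\<lambda>\<tau>. \<tau>"]) (auto intro!: continuous_intros cont')
  have i4: "integrable S (\<lambda>y. f'' (?q y) * (1 - (y $ i)\<^sup>2))"
    by (rule int[of f'' "\<lambda>\<tau>. 1 - \<tau>\<^sup>2"]) (auto intro!: continuous_intros cont'')
  have ibp: "(\<integral>y. (- 2 * r * R * f'' (?q y)) * (1 - (y $ i)\<^sup>2) \<partial>S) = real (d - 1) * (\<integral>y. f' (?q y) * y $ i \<partial>S)"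
      unfolding d_eq
  proof (rule sphere_uniform_integration_by_parts[where g = "\<lambda>\<tau>. f' (sq_dist R r \<tau>)" and g' = "\<lambda>\<tau>. - 2 * r * R * f'' (sq_dist R r \<tau>)"])
    fix x :: real assume x: "\<bar>x\<bar> \<le> 1"
    have "(sq_dist R r has_real_derivative (- 2 * r * R)) (at x)"
      unfolding sq_dist_def[abs_def] by (auto intro!: derivative_eq_intros)
    from DERIV_chain2[OF der'[OF sq_dist_dom[OF x]] this]
    show "((\<lambda>\<tau>. f' (sq_dist R r \<tau>)) has_real_derivative - 2 * r * R * f'' (sq_dist R r x)) (at x within {- 1..1})"
      by (simp add: mult.commute has_field_derivative_at_within)
  next
    show "continuous_on {- 1..1} (\<lambda>\<tau>. - 2 * r * R * f'' (sq_dist R r \<tau>))"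
      by (intro continuous_intros cont_comp cont'')
  qed auto
  then have ibp': "real (d - 1) * (\<integral>y. f' (?q y) * y $ i \<partial>S) = - 2 * r * R * (\<integral>y. f'' (?q y) * (1 - (y $ i)\<^sup>2) \<partial>S)"
    by (simp add: mult.assoc)
  have m: "mean' r = 2 * r * (\<integral>y. f' (?q y) \<partial>S) - 2 * R * (\<integral>y. f' (?q y) * y $ i \<partial>S)"
  proof -
    have "mean' r = (\<integral>y. 2 * r * f' (?q y) - 2 * R * (f' (?q y) * y $ i) \<partial>S)"
      unfolding mean'_def by (intro Bochner_Integration.integral_cong refl) (simp add: algebra_simps)
    also have "\<dots> = 2 * r * (\<integral>y. f' (?q y) \<partial>S) - 2 * R * (\<integral>y. f' (?q y) * y $ i \<partial>S)"
      by (subst Bochner_Integration.integral_diff) (use i2 i3 in auto)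
    finally show ?thesis .
  qed
  have D: "D = (\<integral>y. f'' (?q y) * (2 * r - 2 * R * y $ i)\<^sup>2 \<partial>S) + 2 * (\<integral>y. f' (?q y) \<partial>S)"
    unfolding D_def by (subst Bochner_Integration.integral_add) (use i1 i2 in auto)
  have L: "laplacian r = (\<integral>y. f'' (?q y) * (2 * r - 2 * R * y $ i)\<^sup>2 \<partial>S) + 4 * R\<^sup>2 * (\<integral>y. f'' (?q y) * (1 - (y $ i)\<^sup>2) \<partial>S)
       + 2 * real d * (\<integral>y. f' (?q y) \<partial>S)"
  proof -
    have "laplacian r = (\<integral>y. (f'' (?q y) * (2 * r - 2 * R * y $ i)\<^sup>2 + 4 * R\<^sup>2 * (f'' (?q y) * (1 - (y $ i)\<^sup>2))) + 2 * real d * f' (?q y) \<partial>S)"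
      unfolding laplacian_def 
      by (intro Bochner_Integration.integral_cong refl) (simp add: sq_dist_def algebra_simps power2_eq_square)
    also have "\<dots> = (\<integral>y. f'' (?q y) * (2 * r - 2 * R * y $ i)\<^sup>2 \<partial>S) + 4 * R\<^sup>2 * (\<integral>y. f'' (?q y) * (1 - (y $ i)\<^sup>2) \<partial>S)
       + 2 * real d * (\<integral>y. f' (?q y) \<partial>S)"
      by (subst Bochner_Integration.integral_add, use i1 i2 i4 in simp, use i2 in simp,
          subst Bochner_Integration.integral_add) (use i1 i2 i4 in auto)
    finally show ?thesis .
  qed
  have dr: "real (d - 1) = real d - 1" using card_ge by (simp add: of_nat_diff)
  have "real (d - 1) * mean' r + r * D = r * laplacian r"
  proof -
    define A B C Q where "A = (\<integral>y. f' (?q y) \<partial>S)" and "B = (\<integral>y. f' (?q y) * y $ i \<partial>S)"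
      and "C = (\<integral>y. f'' (?q y) * (1 - (y $ i)\<^sup>2) \<partial>S)"
      and "Q = (\<integral>y. f'' (?q y) * (2 * r - 2 * R * y $ i)\<^sup>2 \<partial>S)"
    note defs = A_def[symmetric] B_def[symmetric] C_def[symmetric] Q_def[symmetric]
    have "(real d - 1) * mean' r = 2 * r * (real d - 1) * A - 2 * R * ((real d - 1) * B)"
      unfolding m defs by (simp add: algebra_simps)
    also have "(real d - 1) * B = - 2 * r * R * C" using ibp' unfolding defs dr .
    finally show ?thesis unfolding D L defs dr by (simp add: algebra_simps power2_eq_square)
  qed
  moreover have "((\<lambda>r. r ^ (d - 1) * mean' r) has_real_derivative 
      real (d - 1) * r ^ (d - 1 - 1) * mean' r + D * r ^ (d - 1)) (at r)"
    using DERIV_mult[OF DERIV_pow[of "d - 1" r UNIV] mean'_deriv[of r]] by (simp add: D_def)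
  moreover have "r ^ (d - 1) = r ^ (d - 1 - 1) * r"
    using card_ge power_minus_mult[of "d - 1" r] by simp
  moreover have "r ^ (d - 1 - 1) * (real (d - 1) * mean' r + r * D) = real (d - 1) * r ^ (d - 1 - 1) * mean' r + D * (r ^ (d - 1 - 1) * r)"
    by (simp add: algebra_simps)
  ultimately show ?thesis by (simp add: algebra_simps)
qed

text \<open>For a superharmonic profile the flux \<open>r ^ (d - 1) * mean' r\<close> has derivative
  at most 0, and it starts from 0 because \<open>d > 1\<close>.\<close>

lemma mean'_nonpos:
  assumes sup: "\<And>q. q \<ge> 0 \<Longrightarrow> 4 * q * f'' q + 2 * real d * f' q \<le> 0" and "r > 0"
  shows "mean' r \<le> 0"
proof -
  have lap: "laplacian r \<le> 0" for r
  proof -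
    have "(\<integral>y. - (4 * sq_dist R r (y $ i) * f'' (sq_dist R r (y $ i)) + 2 * real d * f' (sq_dist R r (y $ i))) \<partial>S) \<ge> 0"
    proof (rule integral_nonneg_AE)
      show "AE y in S. - (4 * sq_dist R r (y $ i) * f'' (sq_dist R r (y $ i)) + 2 * real d * f' (sq_dist R r (y $ i))) \<ge> 0"
        using AE_sphere_uniform_1_component[of i]
      proof eventually_elim
        case (elim y)
        show ?case using sup[OF sq_dist_nonneg[OF elim, of R r]] by simp
      qed
    qed
    then show ?thesis unfolding laplacian_def by (simp only: Bochner_Integration.integral_minus)
  qed
  have "r ^ (d - 1) * mean' r \<le> 0 ^ (d - 1) * mean' 0"
  proof (rule DERIV_nonpos_imp_nonincreasing[where f = "\<lambda>r. r ^ (d - 1) * mean' r"])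
    fix x :: real assume "0 \<le> x"
    then show "\<exists>y. ((\<lambda>r. r ^ (d - 1) * mean' r) has_real_derivative y) (at x) \<and> y \<le> 0"
      using radial_laplacian lap by (intro exI conjI) (auto intro: mult_nonneg_nonpos)
  qed (use \<open>r > 0\<close> in simp)
  also have "0 ^ (d - 1) * mean' 0 = 0" using card_ge by simp
  finally show ?thesis using \<open>r > 0\<close> by (metis mult_le_cancel_left_pos mult_zero_right zero_less_power)
qed

lemma sphere_mean_antimono:
  assumes sup: "\<And>q. q \<ge> 0 \<Longrightarrow> 4 * q * f'' q + 2 * real d * f' q \<le> 0" and r: "0 \<le> r" "r \<le> r'"
  shows "sphere_mean i R f r' \<le> sphere_mean i R f r"
proof (cases "r = r'")
  case False
  show ?thesis
  proof (rule DERIV_nonpos_imp_decreasing_open[OF r(2)])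
    show "\<exists>y. (sphere_mean i R f has_real_derivative y) (at x) \<and> y \<le> 0" if "r < x" for x
      using mean_deriv mean'_nonpos[OF sup, of x] that r by (intro exI conjI) auto
    show "continuous_on {r..r'} (sphere_mean i R f)"
      by (intro continuous_at_imp_continuous_on ballI DERIV_isCont[OF mean_deriv])
  qed
qed simp

text \<open>
  If the Laplacian of the mean is, up to a small error, minus a radially nonincreasing function, then
  \<open>mean' r / r\<close>, which is a multiple of the average of the Laplacian over the ball of radius \<open>r\<close>, is
  almost nondecreasing, and so the mean lies almost above its tangent in the variable \<open>r\<^sup>2\<close>.
\<close>

lemma sphere_mean_above_tangent:
  fixes P E :: "real \<Rightarrow> real"
  assumes lap: "\<And>r. r \<ge> 0 \<Longrightarrow> laplacian r = - P r - E r"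
    and P: "\<And>r r'. 0 \<le> r \<Longrightarrow> r \<le> r' \<Longrightarrow> P r' \<le> P r"
    and E: "\<And>r. E r \<ge> 0" "continuous_on {0..} E"
    and R: "R > 0" and r: "r \<ge> 0"
  shows "sphere_mean i R f r \<ge> sphere_mean i R f R + mean' R / R * (r\<^sup>2 - R\<^sup>2) / 2
     - integral {0..max r R} (\<lambda>\<eta>. \<eta> ^ (d - 1) * E \<eta>) / R ^ d * \<bar>r\<^sup>2 - R\<^sup>2\<bar> / 2"
proof -
  \<comment> \<open>\<open>G\<close> collects the contribution of the error \<open>E\<close> to
    minus the flux, and \<open>F\<close> is what remains: its derivative is
    \<open>x ^ (d - 1) * P x\<close>.\<close>
  define G where "G x = integral {0..x} (\<lambda>\<eta>. \<eta> ^ (d - 1) * E \<eta>)" for x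
  define F where "F x = - (x ^ (d - 1) * mean' x) - G x" for x
  have contE: "continuous_on {0..b} (\<lambda>\<eta>. \<eta> ^ (d - 1) * E \<eta>)" for b
    by (intro continuous_intros continuous_on_subset[OF E(2)]) auto
  have intE: "(\<lambda>\<eta>. \<eta> ^ (d - 1) * E \<eta>) integrable_on {a..b}" if "0 \<le> a" for a b
    by (rule integrable_continuous_real) (use that in \<open>intro continuous_on_subset[OF contE[of b]], auto\<close>)
  have G_der: "(G has_real_derivative x ^ (d - 1) * E x) (at x)" if "x > 0" for x
  proof -
    have "(G has_real_derivative x ^ (d - 1) * E x) (at x within {0..x + 1})"
      unfolding G_def using integral_has_real_derivative[OF contE, of x "x + 1"] that by simp
    then show ?thesis using that by (simp add: at_within_Icc_at)
  qed
  have G_mono: "G x \<le> G y" if "0 \<le> x" "x \<le> y" for x y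
    unfolding G_def using that E(1) by (intro integral_subset_le intE) auto
  have G_nonneg: "G x \<ge> 0" if "x \<ge> 0" for x
    using G_mono[of 0 x] that by (simp add: G_def)
  have F_der: "(F has_real_derivative x ^ (d - 1) * P x) (at x)" if "x > 0" for x
  proof -
    have "(F has_real_derivative - (x ^ (d - 1) * laplacian x) - x ^ (d - 1) * E x) (at x)"
      unfolding F_def[abs_def] by (intro DERIV_diff DERIV_minus radial_laplacian G_der that)
    then show ?thesis using lap[of x] that by (simp add: algebra_simps)
  qed
  have F0: "F 0 = 0" using card_ge by (simp add: F_def G_def)
  have contG: "continuous_on {0..b} G" for b
    unfolding G_def by (intro indefinite_integral_continuous_1 intE) simp
  have contm: "continuous_on A mean'" for A
    by (intro continuous_at_imp_continuous_on ballI DERIV_isCont[OF mean'_deriv])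
  have contF: "continuous_on {0..b} F" for b
    unfolding F_def[abs_def] by (intro continuous_intros contG contm)
  have d0: "d > 0" using card_ge by simp
  \<comment> \<open>On the interval from 0 to \<open>x\<close> the function \<open>P\<close> is at
    least its value at \<open>x\<close>, and \<open>x ^ d / d\<close> is the integral of
    \<open>\<eta> ^ (d - 1)\<close>.\<close>
  have F_ge: "F x \<ge> P x * x ^ d / d" if "x > 0" for x
  proof -
    have "F 0 - P x * 0 ^ d / d \<le> F x - P x * x ^ d / d"
    proof (rule DERIV_nonneg_imp_increasing_open[of 0 x "\<lambda>\<eta>. F \<eta> - P x * \<eta> ^ d / d"])
      fix \<eta> assume \<eta>: "0 < \<eta>" "\<eta> < x"
      have "((\<lambda>\<eta>. F \<eta> - P x * \<eta> ^ d / d) has_real_derivative \<eta> ^ (d - 1) * P \<eta> - P x * \<eta> ^ (d - 1)) (at \<eta>)"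
        using d0 by (auto intro!: derivative_eq_intros F_der \<eta>)
      moreover have "\<eta> ^ (d - 1) * P \<eta> - P x * \<eta> ^ (d - 1) \<ge> 0"
        using P[of \<eta> x] \<eta> by (simp flip: left_diff_distrib add: mult.commute[of "\<eta> ^ (d - 1)"])
      ultimately show "\<exists>y. ((\<lambda>\<eta>. F \<eta> - P x * \<eta> ^ d / d) has_real_derivative y) (at \<eta>) \<and> 0 \<le> y" by blast
    qed (use that d0 in \<open>auto intro!: continuous_intros contF\<close>)
    moreover have "P x * 0 ^ d / d = 0" using d0 by simp
    ultimately show ?thesis using F0 by linarith
  qed
  \<comment> \<open>Up to the factor \<open>1 / d\<close>, \<open>F x / x ^ d\<close> is the average
    of \<open>P\<close> over the ball of radius \<open>x\<close>, so it decreases with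
    \<open>P\<close>. The sign of its derivative is exactly the content of
    \<open>F_ge\<close>.\<close>
  have F_mono: "F y / y ^ d \<le> F x / x ^ d" if "0 < x" "x \<le> y" for x y
  proof (rule DERIV_nonpos_imp_nonincreasing[OF that(2)])
    fix \<eta> assume "x \<le> \<eta>"
    then have \<eta>: "\<eta> > 0" using that by simp
    have "((\<lambda>\<eta>. F \<eta> / \<eta> ^ d) has_real_derivative (\<eta> ^ (d - 1) * P \<eta> * \<eta> ^ d - F \<eta> * (real d * \<eta> ^ (d - 1))) / (\<eta> ^ d * \<eta> ^ d)) (at \<eta>)"
      using \<eta> by (auto intro!: derivative_eq_intros F_der)
    moreover have "\<eta> ^ (d - 1) * P \<eta> * \<eta> ^ d - F \<eta> * (real d * \<eta> ^ (d - 1)) \<le> 0"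
    proof -
      have "real d * (P \<eta> * \<eta> ^ d / d) \<le> real d * F \<eta>" using F_ge[OF \<eta>] by (intro mult_left_mono) auto
      then have "\<eta> ^ (d - 1) * (P \<eta> * \<eta> ^ d) \<le> \<eta> ^ (d - 1) * (real d * F \<eta>)" 
        using \<eta> d0 by (intro mult_left_mono) auto
      then show ?thesis by (simp add: algebra_simps)
    qed
    ultimately show "\<exists>y. ((\<lambda>\<eta>. F \<eta> / \<eta> ^ d) has_real_derivative y) (at \<eta>) \<and> y \<le> 0"
      using \<eta> by (intro exI conjI) (auto intro!: divide_nonpos_pos)
  qed
  have Z: "mean' x = x * (- F x / x ^ d - G x / x ^ d)" if "x > 0" for x
  proof -
    have "x ^ d = x ^ (d - 1) * x" using d0 by (metis power_minus_mult)
    then show ?thesis using that by (simp add: F_def field_simps)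
  qed
  have contH: "continuous_on A (sphere_mean i R f)" for A
    by (intro continuous_at_imp_continuous_on ballI DERIV_isCont[OF mean_deriv])
  have ZR: "mean' R / R = - F R / R ^ d - G R / R ^ d" using Z[OF R] R by simp
  show ?thesis
  proof (cases "R \<le> r")
    case True
    \<comment> \<open>Beyond \<open>R\<close> the slope is lowered by \<open>G r / R ^ d\<close>, a
      bound for the error \<open>G x / x ^ d\<close> at every \<open>x\<close> between
      \<open>R\<close> and \<open>r\<close>; then \<open>mean' x \<ge> c * x\<close> there.\<close>
    define c where "c = mean' R / R - G r / R ^ d"
    have "sphere_mean i R f R - c * R\<^sup>2 / 2 \<le> sphere_mean i R f r - c * r\<^sup>2 / 2"
    proof (rule DERIV_nonneg_imp_increasing_open[OF True, where f = "\<lambda>x. sphere_mean i R f x - c * x\<^sup>2 / 2"])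
      fix x assume x: "R < x" "x < r"
      then have x0: "x > 0" using R by simp
      have "((\<lambda>x. sphere_mean i R f x - c * x\<^sup>2 / 2) has_real_derivative mean' x - c * x) (at x)"
        by (auto intro!: derivative_eq_intros mean_deriv)
      moreover have "mean' x - c * x \<ge> 0"
      proof -
        have "G x / x ^ d \<le> G r / R ^ d"
          using G_mono[of x r] G_nonneg[of r] x R by (intro frac_le power_mono) auto
        moreover have "G R / R ^ d \<ge> 0" using G_nonneg[of R] R by simp
        ultimately have "c \<le> - F x / x ^ d - G x / x ^ d"
          using F_mono[of R x] x R by (simp add: c_def ZR)
        then have "c * x \<le> (- F x / x ^ d - G x / x ^ d) * x" using x0 by (intro mult_right_mono) auto
        then show ?thesis unfolding Z[OF x0] by (simp add: mult.commute)
      qed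
      ultimately show "\<exists>y. ((\<lambda>x. sphere_mean i R f x - c * x\<^sup>2 / 2) has_real_derivative y) (at x) \<and> 0 \<le> y" by blast
    qed (intro continuous_intros contH; simp)+
    moreover have "\<bar>r\<^sup>2 - R\<^sup>2\<bar> = r\<^sup>2 - R\<^sup>2" "max r R = r"
      using True R by (auto intro!: power_mono)
    ultimately show ?thesis unfolding c_def G_def[symmetric] by (simp add: algebra_simps diff_divide_distrib)
  next
    case False
    \<comment> \<open>Below \<open>R\<close> the comparison is reversed. The added term cancels the
      error at \<open>R\<close>, so that \<open>c = - F R / R ^ d\<close>, while the error at
      \<open>x < R\<close> has the favourable sign.\<close>
    define c where "c = mean' R / R + G R / R ^ d"
    have "sphere_mean i R f R - c * R\<^sup>2 / 2 \<le> sphere_mean i R f r - c * r\<^sup>2 / 2"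
    proof (rule DERIV_nonpos_imp_decreasing_open[of r R "\<lambda>x. sphere_mean i R f x - c * x\<^sup>2 / 2"])
      fix x assume x: "r < x" "x < R"
      then have x0: "x > 0" using r by simp
      have "((\<lambda>x. sphere_mean i R f x - c * x\<^sup>2 / 2) has_real_derivative mean' x - c * x) (at x)"
        by (auto intro!: derivative_eq_intros mean_deriv)
      moreover have "mean' x - c * x \<le> 0"
      proof -
        have "G x / x ^ d \<ge> 0" using G_nonneg[of x] x0 by simp
        then have "- F x / x ^ d - G x / x ^ d \<le> c"
          using F_mono[of x R] x x0 by (simp add: c_def ZR)
        then have "(- F x / x ^ d - G x / x ^ d) * x \<le> c * x" using x0 by (intro mult_right_mono) auto
        then show ?thesis unfolding Z[OF x0] by (simp add: mult.commute)
      qed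
      ultimately show "\<exists>y. ((\<lambda>x. sphere_mean i R f x - c * x\<^sup>2 / 2) has_real_derivative y) (at x) \<and> y \<le> 0" by blast
    qed (use False in \<open>auto intro!: continuous_intros contH\<close>)
    moreover have "\<bar>r\<^sup>2 - R\<^sup>2\<bar> = R\<^sup>2 - r\<^sup>2" "max r R = R"
      using False r power_mono[of r R 2] by auto
    ultimately show ?thesis unfolding c_def G_def[symmetric] by (simp add: algebra_simps diff_divide_distrib add_divide_distrib)
  qed
qed

end

section \<open>The Riesz potential of a sphere\<close>

text \<open>The kernel as a function of the squared distance, with \<open>a = s / 2\<close>; its
  derivative is \<open>- (1 / 2) * q powr (- a - 1)\<close> for every \<open>a\<close>, the
  logarithmic case included. At \<open>q = 0\<close> the value is 0: correct for
  \<open>a < 0\<close>, a default in place of infinity for \<open>a \<ge> 0\<close>.\<close>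

definition riesz_profile :: "real \<Rightarrow> real \<Rightarrow> real" where
  "riesz_profile a q = (if a = 0 then - ln q / 2 else q powr (- a) / (2 * a))"

lemma measurable_riesz_profile [measurable]: "riesz_profile a \<in> borel_measurable borel"
  unfolding riesz_profile_def[abs_def] by measurable

lemma riesz_profile_deriv:
  assumes "q > 0"
  shows "(riesz_profile a has_real_derivative - (1 / 2) * q powr (- a - 1)) (at q)"
proof (cases "a = 0")
  case True
  have "((\<lambda>q. - ln q / 2) has_real_derivative - (1 / q) / 2) (at q)"
    using assms by (auto intro!: derivative_eq_intros)
  then show ?thesis using assms True by (simp add: riesz_profile_def[abs_def] powr_minus_divide mult.commute)
next
  case False
  have "((\<lambda>q. q powr (- a) / (2 * a)) has_real_derivative (- a * q powr (- a - 1)) / (2 * a)) (at q)"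
    using assms by (auto intro!: derivative_eq_intros)
  then show ?thesis using False by (simp add: riesz_profile_def[abs_def])
qed

lemma riesz_profile_antimono:
  assumes "0 < q" "q \<le> q'"
  shows "riesz_profile a q' \<le> riesz_profile a q"
proof (rule DERIV_nonpos_imp_nonincreasing[OF assms(2)])
  fix x assume "q \<le> x"
  then show "\<exists>y. (riesz_profile a has_real_derivative y) (at x) \<and> y \<le> 0"
    using riesz_profile_deriv[of x a] assms(1) by (intro exI conjI) auto
qed

lemma smooth_profile_riesz:
  assumes "e > 0" "d = CARD('n::finite)" "d \<ge> 3"
  shows "smooth_profile TYPE('n) d e (\<lambda>q. riesz_profile a (q + e)) (\<lambda>q. - (1 / 2) * (q + e) powr (- a - 1))
    (\<lambda>q. (a + 1) / 2 * (q + e) powr (- a - 2))"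
proof
  fix q :: real assume q: "q > - e"
  then have "((\<lambda>q. riesz_profile a (q + e)) has_real_derivative - (1 / 2) * (q + e) powr (- a - 1) * 1) (at q)"
    by (intro DERIV_chain2[OF riesz_profile_deriv]) (auto intro!: derivative_eq_intros)
  then show "((\<lambda>q. riesz_profile a (q + e)) has_real_derivative - (1 / 2) * (q + e) powr (- a - 1)) (at q)"
    by simp
  have "((\<lambda>q. (q + e) powr (- a - 1)) has_real_derivative (- a - 1) * (q + e) powr (- a - 1 - 1)) (at q)"
    using q by (auto intro!: derivative_eq_intros)
  from DERIV_cmult[OF this, of "- (1 / 2)"]
  show "((\<lambda>q. - (1 / 2) * (q + e) powr (- a - 1)) has_real_derivative (a + 1) / 2 * (q + e) powr (- a - 2)) (at q)"
    by (simp add: algebra_simps add_divide_distrib)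
qed (use assms in \<open>auto intro!: continuous_intros\<close>)

lemma smooth_profile_powr:
  assumes "e > 0" "d = CARD('n::finite)" "d \<ge> 3"
  shows "smooth_profile TYPE('n) d e (\<lambda>q. (q + e) powr (- b)) (\<lambda>q. - b * (q + e) powr (- b - 1))
    (\<lambda>q. b * (b + 1) * (q + e) powr (- b - 2))"
proof
  fix q :: real assume q: "q > - e"
  show "((\<lambda>q. (q + e) powr (- b)) has_real_derivative - b * (q + e) powr (- b - 1)) (at q)"
    using q by (auto intro!: derivative_eq_intros)
  have "((\<lambda>q. (q + e) powr (- b - 1)) has_real_derivative (- b - 1) * (q + e) powr (- b - 1 - 1)) (at q)"
    using q by (auto intro!: derivative_eq_intros)
  from DERIV_cmult[OF this, of "- b"]
  show "((\<lambda>q. - b * (q + e) powr (- b - 1)) has_real_derivative b * (b + 1) * (q + e) powr (- b - 2)) (at q)"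
    by (simp add: algebra_simps)
qed (use assms in \<open>auto intro!: continuous_intros\<close>)

lemma AE_sq_dist_pos:
  assumes "CARD('n::finite) \<ge> 2" "R > 0" "r \<ge> 0"
  shows "AE y in (sphere_uniform 1 :: (real ^ 'n) measure). sq_dist R r (y $ i) > 0"
  using AE_sphere_uniform_1_component_neq[OF assms(1), of i]
proof eventually_elim
  case (elim y)
  show ?case
  proof (cases "r = R")
    case True
    have "R\<^sup>2 * (1 - y $ i) > 0" using elim assms by auto
    then show ?thesis using True by (simp add: sq_dist_def algebra_simps power2_eq_square)
  next
    case False
    then have "(\<bar>r\<bar> - \<bar>R\<bar>)\<^sup>2 > 0" using assms by simp
    then show ?thesis using sq_dist_ge[where \<tau> = "y $ i" and R = R and r = r] elim by linarith
  qed
qed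

lemma sphere_mean_0:
  fixes i :: "'n::finite"
  shows "sphere_mean i R f 0 = f (R\<^sup>2)"
proof -
  interpret S: prob_space "sphere_uniform 1 :: (real ^ 'n) measure" by (rule prob_space_sphere_uniform)
  show ?thesis using S.prob_space by (simp add: sphere_mean_def sq_dist_def)
qed

text \<open>As the shift decreases to 0 the shifted profiles increase to \<open>f\<close> almost
  everywhere on the sphere. A bound uniform in the shift then yields integrability of the singular
  profile as a conclusion of monotone convergence.\<close>

lemma sphere_mean_monotone_limit:
  fixes i :: "'n::finite" and f :: "real \<Rightarrow> real"
  assumes d: "CARD('n) \<ge> 2" and R: "R > 0" and r: "r \<ge> 0"
    and [measurable]: "f \<in> borel_measurable borel"
    and anti: "\<And>q q'. 0 < q \<Longrightarrow> q \<le> q' \<Longrightarrow> f q' \<le> f q"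
    and cont: "continuous_on {0<..} f"
    and bound: "\<And>n. sphere_mean i R (\<lambda>q. f (q + inverse (real (Suc n)))) r \<le> B"
  shows "integrable (sphere_uniform 1 :: (real ^ 'n) measure) (\<lambda>y. f (sq_dist R r (y $ i)))"
    and "sphere_mean i R f r \<le> B"
    and "(\<lambda>n. sphere_mean i R (\<lambda>q. f (q + inverse (real (Suc n)))) r) \<longlonglongrightarrow> sphere_mean i R f r"
proof -
  let ?S = "sphere_uniform 1 :: (real ^ 'n) measure"
  define e where "e n = inverse (real (Suc n))" for n
  have e: "e n > 0" "e (Suc n) \<le> e n" for n by (auto simp: e_def intro!: le_imp_inverse_le)
  have elim: "e \<longlonglongrightarrow> 0" unfolding e_def by (rule LIMSEQ_inverse_real_of_nat)
  have [measurable]: "sq_dist R r \<in> borel_measurable borel" unfolding sq_dist_def[abs_def] by measurable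
  have [measurable]: "(\<lambda>x. f (x + c)) \<in> borel_measurable borel" for c by measurable
  have int: "integrable ?S (\<lambda>y. f (sq_dist R r (y $ i) + e n))" for n
  proof (rule integrable_sphere_uniform_component[where h = "\<lambda>\<tau>. f (sq_dist R r \<tau> + e n)"])
    show "continuous_on {-1..1} (\<lambda>\<tau>. f (sq_dist R r \<tau> + e n))"
    proof (rule continuous_on_compose2[OF cont])
      show "(\<lambda>\<tau>. sq_dist R r \<tau> + e n) ` {-1..1} \<subseteq> {0<..}"
        using e(1)[of n] by (auto intro!: add_nonneg_pos sq_dist_nonneg)
    qed (auto simp: sq_dist_def intro!: continuous_intros)
  qed measurable
  note pos = AE_sq_dist_pos[OF d R r, of i]
  have mono: "AE y in ?S. mono (\<lambda>n. f (sq_dist R r (y $ i) + e n))"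
    using pos by eventually_elim (use e in \<open>auto simp: mono_iff_le_Suc intro!: anti add_pos_pos\<close>)
  have lim: "AE y in ?S. (\<lambda>n. f (sq_dist R r (y $ i) + e n)) \<longlonglongrightarrow> f (sq_dist R r (y $ i))"
    using pos
  proof eventually_elim
    case (elim y)
    have c: "isCont f (sq_dist R r (y $ i))"
      using cont elim by (simp add: continuous_on_eq_continuous_at)
    have "(\<lambda>n. sq_dist R r (y $ i) + e n) \<longlonglongrightarrow> sq_dist R r (y $ i) + 0"
      by (intro tendsto_intros \<open>e \<longlonglongrightarrow> 0\<close>)
    then show ?case using isCont_tendsto_compose[OF c] by simp
  qed
  define I where "I n = (\<integral>y. f (sq_dist R r (y $ i) + e n) \<partial>?S)" for n
  have I: "sphere_mean i R (\<lambda>q. f (q + inverse (real (Suc n)))) r = I n" for n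
    by (simp add: sphere_mean_def I_def e_def)
  have incI: "incseq I"
    unfolding I_def using mono by (intro incseq_SucI integral_mono_AE int) (auto simp: mono_iff_le_Suc)
  obtain L where L: "I \<longlonglongrightarrow> L" "\<And>n. I n \<le> L"
    using incseq_convergent[OF incI, of B] bound unfolding I by blast
  have "L \<le> B" using L(1) bound unfolding I by (intro LIMSEQ_le_const2[OF L(1)]) auto
  show int': "integrable ?S (\<lambda>y. f (sq_dist R r (y $ i)))"
    by (rule integrable_monotone_convergence[OF int mono lim L(1)[unfolded I_def]]) measurable
  have "sphere_mean i R f r = L" unfolding sphere_mean_def
    by (rule integral_monotone_convergence[OF int mono lim L(1)[unfolded I_def]]) measurable
  then show "sphere_mean i R f r \<le> B" 
    and "(\<lambda>n. sphere_mean i R (\<lambda>q. f (q + inverse (real (Suc n)))) r) \<longlonglongrightarrow> sphere_mean i R f r"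
    using \<open>L \<le> B\<close> L(1) unfolding I by auto
qed

text \<open>Each claim is proved for the kernel with \<open>q + e n\<close> in place of
  \<open>q\<close>, and survives the limit \<open>e n \<rightarrow> 0\<close>. The upper bound is
  the value of the potential at the center of the sphere. The bounds on \<open>s\<close> also force
  the dimension to be at least 3.\<close>

lemma sphere_potential:
  fixes i :: "'n::finite" and s R r :: real
  assumes s: "-2 < s" "s \<le> real CARD('n) - 4" and R: "R > 0" and r: "r \<ge> 0"
  shows integrable_sphere_potential:
      "integrable (sphere_uniform 1 :: (real ^ 'n) measure) (\<lambda>y. riesz_profile (s / 2) (sq_dist R r (y $ i)))"
    and sphere_potential_le: "sphere_mean i R (riesz_profile (s / 2)) r \<le> riesz_profile (s / 2) (R\<^sup>2)"
    and sphere_potential_Euler_Lagrange: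
      "sphere_mean i R (riesz_profile (s / 2)) r
        \<ge> sphere_mean i R (riesz_profile (s / 2)) R - c_const s CARD('n) / (4 * R powr (s + 2)) * (r\<^sup>2 - R\<^sup>2)"
proof -
  let ?S = "sphere_uniform 1 :: (real ^ 'n) measure"
  interpret S: prob_space ?S by (rule prob_space_sphere_uniform)
  define a d where "a = s / 2" and "d = CARD('n)"
  have a: "a > -1" "2 * (a + 2) \<le> real d" using s by (auto simp: a_def d_def)
  have d3: "d \<ge> 3" and d2: "CARD('n) \<ge> 2" using a by (auto simp: d_def)
  define e where "e n = inverse (real (Suc n))" for n
  have e: "e n > 0" for n by (simp add: e_def)
  have elim: "e \<longlonglongrightarrow> 0" unfolding e_def by (rule LIMSEQ_inverse_real_of_nat)
  have [measurable]: "sq_dist R r \<in> borel_measurable borel" for r unfolding sq_dist_def[abs_def] by measurable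
  note smk = smooth_profile_riesz[OF e d_def d3, of _ a] 
  note smp = smooth_profile_powr[OF e d_def d3, of _ "a + 1"]
  note smq = smooth_profile_powr[OF e d_def d3, of _ "a + 2"]
  have anti_p: "(q' powr (- (a + 1)) :: real) \<le> q powr (- (a + 1))" if "0 < q" "q \<le> q'" for q q'
    using that a by (intro powr_mono2') auto
  have cont_p: "continuous_on {0<..} (\<lambda>q. q powr (- (a + 1)))"
    by (auto intro!: continuous_intros)
  have cont_k: "continuous_on {0<..} (riesz_profile a)"
    using riesz_profile_deriv by (intro continuous_at_imp_continuous_on) (auto intro: DERIV_isCont)

  \<comment> \<open>Laplacian of the regularized kernel: a negative multiple of
    \<open>(q + e n) powr (- (a + 1))\<close>, and a further negative term carrying the factor
    \<open>e n\<close>, which plays the role of the error.\<close>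
  have split: "4 * q * ((a + 1) / 2 * (q + e n) powr (- a - 2)) + 2 * real d * (- (1 / 2) * (q + e n) powr (- a - 1))
     = - ((real d - 2 * (a + 1)) * (q + e n) powr (- (a + 1))) - 2 * (a + 1) * e n * (q + e n) powr (- (a + 2))"
    if "q \<ge> 0" for q n
  proof -
    define X where "X = (q + e n) powr (- a - 2)"
    have "(q + e n) powr (- a - 1) = (q + e n) powr ((- a - 2) + 1)"
      by (rule arg_cong[where f = "(powr) (q + e n)"]) simp
    also have "\<dots> = (q + e n) * X" unfolding X_def powr_add using that e[of n] by simp
    finally have 1: "(q + e n) powr (- a - 1) = (q + e n) * X" .
    have 2: "- (a + 1) = - a - 1" "- (a + 2) = - a - 2" by simp_all
    show ?thesis unfolding 2 1 X_def[symmetric] by (simp add: algebra_simps)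
  qed
  have sup_k: "4 * q * ((a + 1) / 2 * (q + e n) powr (- a - 2)) + 2 * real d * (- (1 / 2) * (q + e n) powr (- a - 1)) \<le> 0"
    if "q \<ge> 0" for q n
  proof -
    have "(real d - 2 * (a + 1)) * (q + e n) powr (- (a + 1)) \<ge> 0"
      using a by (intro mult_nonneg_nonneg) auto
    moreover have "2 * (a + 1) * e n * (q + e n) powr (- (a + 2)) \<ge> 0"
      using a e[of n] by (intro mult_nonneg_nonneg) auto
    ultimately show ?thesis unfolding split[OF that] by linarith
  qed
  \<comment> \<open>Superharmonicity of the main part of that Laplacian. The inequality
    \<open>2 * (a + 2) \<le> real d\<close>, equivalent to the upper bound on \<open>s\<close>,
    enters here.\<close>
  have sup_p: "4 * q * ((a + 1) * (a + 1 + 1) * (q + e n) powr (- (a + 1) - 2)) + 2 * real d * (- (a + 1) * (q + e n) powr (- (a + 1) - 1)) \<le> 0"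
    if "q \<ge> 0" for q n
  proof -
    define X where "X = (q + e n) powr (- (a + 1) - 2)"
    have "(q + e n) powr (- (a + 1) - 1) = (q + e n) powr ((- (a + 1) - 2) + 1)"
      by (rule arg_cong[where f = "(powr) (q + e n)"]) simp
    also have "\<dots> = (q + e n) * X" unfolding X_def powr_add using that e[of n] by simp
    finally have 1: "(q + e n) powr (- (a + 1) - 1) = (q + e n) * X" .
    have "2 * (a + 2) * q \<le> real d * q" using a that by (intro mult_right_mono) auto
    moreover have "0 \<le> real d * e n" using e[of n] by simp
    ultimately have "4 * (a + 2) * q - 2 * real d * (q + e n) \<le> 0" by (simp add: algebra_simps)
    then have "(a + 1) * X * (4 * (a + 2) * q - 2 * real d * (q + e n)) \<le> 0"
      using a by (intro mult_nonneg_nonpos) (auto simp: X_def)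
    then show ?thesis unfolding 1 X_def[symmetric] by (simp add: algebra_simps)
  qed
  have k_anti: "sphere_mean i R (\<lambda>q. riesz_profile a (q + e n)) r' \<le> sphere_mean i R (\<lambda>q. riesz_profile a (q + e n)) r"
    if "0 \<le> r" "r \<le> r'" for r r' n
    using smooth_profile.sphere_mean_antimono[OF smk sup_k that] .
  have p_anti: "sphere_mean i R (\<lambda>q. (q + e n) powr (- (a + 1))) r' \<le> sphere_mean i R (\<lambda>q. (q + e n) powr (- (a + 1))) r"
    if "0 \<le> r" "r \<le> r'" for r r' n
    using smooth_profile.sphere_mean_antimono[OF smp sup_p that] .
  \<comment> \<open>A mean that decreases in \<open>r\<close> is largest at the center, where it
    equals the profile at \<open>R\<^sup>2\<close>; dropping the shift only increases it. This is
    the bound independent of \<open>n\<close> that monotone convergence needs.\<close>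
  have k_le: "sphere_mean i R (\<lambda>q. riesz_profile a (q + e n)) r \<le> riesz_profile a (R\<^sup>2)" if "r \<ge> 0" for r n
    using k_anti[of 0 r n] that riesz_profile_antimono[of "R\<^sup>2" "R\<^sup>2 + e n" a] R e[of n]
    by (simp add: sphere_mean_0)
  have p_le: "sphere_mean i R (\<lambda>q. (q + e n) powr (- (a + 1))) r \<le> (R\<^sup>2) powr (- (a + 1))" if "r \<ge> 0" for r n
    using p_anti[of 0 r n] that anti_p[of "R\<^sup>2" "R\<^sup>2 + e n"] R e[of n]
    by (simp add: sphere_mean_0)
  have k_lim: "integrable ?S (\<lambda>y. riesz_profile a (sq_dist R r (y $ i)))"
      "sphere_mean i R (riesz_profile a) r \<le> riesz_profile a (R\<^sup>2)"
      "(\<lambda>n. sphere_mean i R (\<lambda>q. riesz_profile a (q + e n)) r) \<longlonglongrightarrow> sphere_mean i R (riesz_profile a) r"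
    if "r \<ge> 0" for r
    unfolding e_def
    by (rule sphere_mean_monotone_limit[OF d2 R that measurable_riesz_profile _ cont_k];
        rule riesz_profile_antimono k_le[OF that, unfolded e_def]; assumption)+
  have pint: "integrable ?S (\<lambda>y. sq_dist R r (y $ i) powr (- (a + 1)))" if "r \<ge> 0" for r
    by (rule sphere_mean_monotone_limit(1)[OF d2 R that _ _ cont_p p_le[OF that, unfolded e_def]])
       (measurable, rule anti_p)
  show "integrable ?S (\<lambda>y. riesz_profile (s / 2) (sq_dist R r (y $ i)))"
    and "sphere_mean i R (riesz_profile (s / 2)) r \<le> riesz_profile (s / 2) (R\<^sup>2)"
    using k_lim(1,2)[OF r] by (auto simp: a_def)

  define En where "En n r = 2 * (a + 1) * e n * sphere_mean i R (\<lambda>q. (q + e n) powr (- (a + 2))) r" for n r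
  \<comment> \<open>Absorbing the factor \<open>e n\<close> into \<open>q + e n\<close> bounds the
    error by the main part of the Laplacian, uniformly in \<open>n\<close>.\<close>
  have ee_le: "e n * (q + e n) powr (- (a + 2)) \<le> (q + e n) powr (- (a + 1))" if "q \<ge> 0" for q n
  proof -
    have "(q + e n) powr (- (a + 1)) = (q + e n) powr (- (a + 2) + 1)"
      by (rule arg_cong[where f = "(powr) (q + e n)"]) simp
    also have "\<dots> = (q + e n) * (q + e n) powr (- (a + 2))" unfolding powr_add using that e[of n] by simp
    finally show ?thesis using that by (simp add: mult_right_mono)
  qed
  have int_powr: "integrable ?S (\<lambda>y. (sq_dist R r (y $ i) + e n) powr b)" for r b n
  proof (rule integrable_sphere_uniform_component[where h = "\<lambda>\<tau>. (sq_dist R r \<tau> + e n) powr b"])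
    have "sq_dist R r \<tau> + e n > 0" if "\<tau> \<in> {-1..1}" for \<tau>
      using that e[of n] sq_dist_nonneg[of \<tau> R r] by (intro add_nonneg_pos) (auto simp: abs_le_iff)
    then show "continuous_on {-1..1} (\<lambda>\<tau>. (sq_dist R r \<tau> + e n) powr b)"
      by (intro continuous_on_powr) (auto simp: sq_dist_def intro!: continuous_intros less_imp_neq[symmetric])
  qed measurable
  have En_nonneg: "En n r \<ge> 0" for n r
    unfolding En_def sphere_mean_def using a e[of n] by (intro mult_nonneg_nonneg integral_nonneg_AE) auto
  have En_cont: "continuous_on A (En n)" for A n
    unfolding En_def
    by (intro continuous_intros continuous_at_imp_continuous_on ballI DERIV_isCont[OF smooth_profile.mean_deriv[OF smq]])
  have En_le: "En n r \<le> 2 * (a + 1) * (R\<^sup>2) powr (- (a + 1))" if "r \<ge> 0" for n r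
  proof -
    have "e n * sphere_mean i R (\<lambda>q. (q + e n) powr (- (a + 2))) r \<le> sphere_mean i R (\<lambda>q. (q + e n) powr (- (a + 1))) r"
      unfolding sphere_mean_def Bochner_Integration.integral_mult_right_zero[symmetric]
    proof (intro integral_mono_AE integrable_mult_right int_powr)
      show "AE y in ?S. e n * (sq_dist R r (y $ i) + e n) powr (- (a + 2)) \<le> (sq_dist R r (y $ i) + e n) powr (- (a + 1))"
        using AE_sphere_uniform_1_component[of i] by eventually_elim (rule ee_le[OF sq_dist_nonneg])
    qed
    also note p_le[OF that]
    finally have "2 * (a + 1) * (e n * sphere_mean i R (\<lambda>q. (q + e n) powr (- (a + 2))) r) \<le> 2 * (a + 1) * (R\<^sup>2) powr (- (a + 1))"
      using a by (intro mult_left_mono) auto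
    then show ?thesis by (simp add: En_def mult.assoc)
  qed
  \<comment> \<open>Wherever the squared distance is positive, hence almost everywhere, the error
    tends to 0. It stays below the unregularized main part, whose integrability is
    \<open>pint\<close>; this covers \<open>r = R\<close> as well.\<close>
  have En_lim: "(\<lambda>n. En n r) \<longlonglongrightarrow> 0" if "r \<ge> 0" for r
  proof -
    have "(\<lambda>n. \<integral>y. e n * (sq_dist R r (y $ i) + e n) powr (- (a + 2)) \<partial>?S) \<longlonglongrightarrow> (\<integral>y. 0 \<partial>?S)"
    proof (rule integral_dominated_convergence[OF _ _ pint[OF that]])
      show "AE y in ?S. (\<lambda>n. e n * (sq_dist R r (y $ i) + e n) powr (- (a + 2))) \<longlonglongrightarrow> 0"
        using AE_sq_dist_pos[OF d2 R that, of i]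
      proof eventually_elim
        case (elim y)
        have "(\<lambda>n. e n * (sq_dist R r (y $ i) + e n) powr (- (a + 2))) \<longlonglongrightarrow> 0 * (sq_dist R r (y $ i) + 0) powr (- (a + 2))"
          using elim by (intro tendsto_intros \<open>e \<longlonglongrightarrow> 0\<close>) auto
        then show ?case by simp
      qed
      show "AE y in ?S. norm (e n * (sq_dist R r (y $ i) + e n) powr (- (a + 2))) \<le> sq_dist R r (y $ i) powr (- (a + 1))" for n
        using AE_sq_dist_pos[OF d2 R that, of i]
      proof eventually_elim
        case (elim y)
        have "norm (e n * (sq_dist R r (y $ i) + e n) powr (- (a + 2))) = e n * (sq_dist R r (y $ i) + e n) powr (- (a + 2))"
          using e[of n] by (simp add: abs_mult)
        also have "\<dots> \<le> (sq_dist R r (y $ i) + e n) powr (- (a + 1))"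
          by (rule ee_le[OF less_imp_le[OF elim]])
        also have "\<dots> \<le> sq_dist R r (y $ i) powr (- (a + 1))"
          by (rule anti_p[OF elim]) (use e[of n] in simp)
        finally show ?case .
      qed
    qed measurable
    from tendsto_mult_left[OF this, of "2 * (a + 1)"] show ?thesis
      by (simp add: En_def sphere_mean_def mult.assoc)
  qed

  define M where "M = max r R"
  define G where "G n = integral {0..M} (\<lambda>\<eta>. \<eta> ^ (d - 1) * En n \<eta>)" for n
  have G_lim: "G \<longlonglongrightarrow> 0"
  proof -
    have "(\<lambda>n. integral {0..M} (\<lambda>\<eta>. \<eta> ^ (d - 1) * En n \<eta>)) \<longlonglongrightarrow> integral {0..M} (\<lambda>\<eta>. 0)"
    proof (rule dominated_convergence(2)[where h = "\<lambda>_. M ^ (d - 1) * (2 * (a + 1) * (R\<^sup>2) powr (- (a + 1)))"])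
      show "(\<lambda>\<eta>. \<eta> ^ (d - 1) * En n \<eta>) integrable_on {0..M}" for n
        by (intro integrable_continuous_real continuous_intros En_cont)
      show "norm (\<eta> ^ (d - 1) * En n \<eta>) \<le> M ^ (d - 1) * (2 * (a + 1) * (R\<^sup>2) powr (- (a + 1)))"
        if "\<eta> \<in> {0..M}" for n \<eta>
        using that En_nonneg[of n \<eta>] En_le[of \<eta> n] by (auto simp: abs_mult intro!: mult_mono power_mono)
      show "(\<lambda>n. \<eta> ^ (d - 1) * En n \<eta>) \<longlonglongrightarrow> 0" if "\<eta> \<in> {0..M}" for \<eta>
        using tendsto_mult_right_zero[OF En_lim[of \<eta>]] that by simp
    qed (auto intro!: integrable_continuous_real continuous_intros)
    then show ?thesis by (simp add: G_def[abs_def])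
  qed

  define Dn where "Dn n = (\<integral>y. - (1 / 2) * (sq_dist R R (y $ i) + e n) powr (- a - 1) * (2 * R - 2 * R * y $ i) \<partial>?S)" for n
  \<comment> \<open>On the sphere itself the factor \<open>2 * R - 2 * R * \<tau>\<close> of the
    radial derivative is proportional to the squared distance and cancels one power of the
    singularity; in the limit only the power \<open>- a\<close> is left.\<close>
  have qR: "sq_dist R R \<tau> = R * (2 * R - 2 * R * \<tau>)" for \<tau>
    by (simp add: sq_dist_def algebra_simps power2_eq_square)
  have tangent: "sphere_mean i R (\<lambda>q. riesz_profile a (q + e n)) r \<ge> sphere_mean i R (\<lambda>q. riesz_profile a (q + e n)) R
     + Dn n / R * (r\<^sup>2 - R\<^sup>2) / 2 - G n / R ^ d * \<bar>r\<^sup>2 - R\<^sup>2\<bar> / 2" for n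
  proof -
    interpret k: smooth_profile i d R "e n" "\<lambda>q. riesz_profile a (q + e n)" "\<lambda>q. - (1 / 2) * (q + e n) powr (- a - 1)"
        "\<lambda>q. (a + 1) / 2 * (q + e n) powr (- a - 2)"
      by (rule smk)
    define P where "P r = (real d - 2 * (a + 1)) * sphere_mean i R (\<lambda>q. (q + e n) powr (- (a + 1))) r" for r
    have lap: "k.laplacian r = - P r - En n r" for r
    proof -
      have "k.laplacian r = (\<integral>y. - ((real d - 2 * (a + 1)) * (sq_dist R r (y $ i) + e n) powr (- (a + 1)))
          - 2 * (a + 1) * e n * (sq_dist R r (y $ i) + e n) powr (- (a + 2)) \<partial>?S)"
        unfolding k.laplacian_def
      proof (rule integral_cong_AE)
        show "AE y in ?S. 4 * sq_dist R r (y $ i) * ((a + 1) / 2 * (sq_dist R r (y $ i) + e n) powr (- a - 2))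
            + 2 * real d * (- (1 / 2) * (sq_dist R r (y $ i) + e n) powr (- a - 1))
          = - ((real d - 2 * (a + 1)) * (sq_dist R r (y $ i) + e n) powr (- (a + 1)))
            - 2 * (a + 1) * e n * (sq_dist R r (y $ i) + e n) powr (- (a + 2))"
          using AE_sphere_uniform_1_component[of i] by eventually_elim (rule split[OF sq_dist_nonneg])
      qed measurable
      also have "\<dots> = - P r - En n r"
        unfolding P_def En_def sphere_mean_def
        by (subst Bochner_Integration.integral_diff) (auto intro!: integrable_mult_right int_powr)
      finally show ?thesis .
    qed
    have "k.mean' R = Dn n" by (simp only: k.mean'_def Dn_def)
    moreover have "P r' \<le> P r" if "0 \<le> r" "r \<le> r'" for r r'
      unfolding P_def using a p_anti[OF that] by (intro mult_left_mono) auto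
    ultimately show ?thesis
      using k.sphere_mean_above_tangent[of P "En n" r] lap En_nonneg En_cont R r
      unfolding G_def M_def by fastforce
  qed
  have "Dn \<longlonglongrightarrow> (- (R powr (- s - 1)) * c_const s CARD('n) / 2)"
  proof -
    have "Dn \<longlonglongrightarrow> (\<integral>y. - (1 / 2) * sq_dist R R (y $ i) powr (- a - 1) * (2 * R - 2 * R * y $ i) \<partial>?S)"
      unfolding Dn_def
    proof (rule integral_dominated_convergence[where w = "\<lambda>y. 2 * R * sq_dist R R (y $ i) powr (- (a + 1))"])
      show "integrable ?S (\<lambda>y. 2 * R * sq_dist R R (y $ i) powr (- (a + 1)))"
        using R by (intro integrable_mult_right pint) auto
      show "AE y in ?S. (\<lambda>n. - (1 / 2) * (sq_dist R R (y $ i) + e n) powr (- a - 1) * (2 * R - 2 * R * y $ i))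
          \<longlonglongrightarrow> - (1 / 2) * sq_dist R R (y $ i) powr (- a - 1) * (2 * R - 2 * R * y $ i)"
        using AE_sq_dist_pos[OF d2 R less_imp_le[OF R], of i]
      proof eventually_elim
        case (elim y)
        have "(\<lambda>n. - (1 / 2) * (sq_dist R R (y $ i) + e n) powr (- a - 1) * (2 * R - 2 * R * y $ i))
          \<longlonglongrightarrow> - (1 / 2) * (sq_dist R R (y $ i) + 0) powr (- a - 1) * (2 * R - 2 * R * y $ i)"
          using elim by (intro tendsto_intros \<open>e \<longlonglongrightarrow> 0\<close>) auto
        then show ?case by simp
      qed
      show "AE y in ?S. norm (- (1 / 2) * (sq_dist R R (y $ i) + e n) powr (- a - 1) * (2 * R - 2 * R * y $ i))
          \<le> 2 * R * sq_dist R R (y $ i) powr (- (a + 1))" for n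
        using AE_sq_dist_pos[OF d2 R less_imp_le[OF R], of i] AE_sphere_uniform_1_component[of i]
      proof eventually_elim
        case (elim y)
        have "\<bar>R * y $ i\<bar> \<le> R * 1" unfolding abs_mult using elim R by (intro mult_mono) auto
        then have "\<bar>2 * R - 2 * R * y $ i\<bar> \<le> 4 * R" by linarith
        moreover have "(sq_dist R R (y $ i) + e n) powr (- (a + 1)) \<le> sq_dist R R (y $ i) powr (- (a + 1))"
          using elim e[of n] by (intro anti_p) auto
        ultimately have "(sq_dist R R (y $ i) + e n) powr (- (a + 1)) * \<bar>2 * R - 2 * R * y $ i\<bar>
            \<le> sq_dist R R (y $ i) powr (- (a + 1)) * (4 * R)"
          by (intro mult_mono) auto
        moreover have "norm (- (1 / 2) * (sq_dist R R (y $ i) + e n) powr (- a - 1) * (2 * R - 2 * R * y $ i))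
            = (1 / 2) * ((sq_dist R R (y $ i) + e n) powr (- (a + 1)) * \<bar>2 * R - 2 * R * y $ i\<bar>)"
          by (simp add: abs_mult)
        ultimately show ?case by (simp add: mult_ac)
      qed
    qed measurable
    also have "(\<integral>y. - (1 / 2) * sq_dist R R (y $ i) powr (- a - 1) * (2 * R - 2 * R * y $ i) \<partial>?S)
        = (\<integral>y. - (R powr (- s - 1)) / 2 * (2 - 2 * y $ i) powr (- s / 2) \<partial>?S)"
    proof (rule integral_cong_AE)
      show "AE y in ?S. - (1 / 2) * sq_dist R R (y $ i) powr (- a - 1) * (2 * R - 2 * R * y $ i)
          = - (R powr (- s - 1)) / 2 * (2 - 2 * y $ i) powr (- s / 2)"
        using AE_sphere_uniform_1_component_neq[OF d2, of i]
      proof eventually_elim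
        case (elim y)
        define x where "x = 2 - 2 * y $ i"
        have x: "x > 0" using elim by (auto simp: x_def)
        have q: "sq_dist R R (y $ i) = R powr 2 * x" 
          unfolding qR x_def using R by (simp add: powr_numeral power2_eq_square algebra_simps)
        have 1: "sq_dist R R (y $ i) powr (- a - 1) = R powr (2 * (- a - 1)) * x powr (- a - 1)"
          unfolding q by (simp only: powr_mult powr_powr)
        have 2: "2 * R - 2 * R * y $ i = R powr 1 * x powr 1"
          using R x by (simp add: x_def algebra_simps)
        have "sq_dist R R (y $ i) powr (- a - 1) * (2 * R - 2 * R * y $ i) = (R powr (2 * (- a - 1)) * R powr 1) * (x powr (- a - 1) * x powr 1)"
          unfolding 1 2 by (simp only: mult_ac)
        also have "\<dots> = R powr (- s - 1) * x powr (- s / 2)"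
          unfolding powr_add[symmetric] by (intro arg_cong2[where f = times] arg_cong2[where f = "(powr)"]) (auto simp: a_def)
        finally have "- (1 / 2) * (sq_dist R R (y $ i) powr (- a - 1) * (2 * R - 2 * R * y $ i))
            = - (1 / 2) * (R powr (- s - 1) * x powr (- s / 2))" by (simp only:)
        then show ?case by (simp add: x_def mult_ac)
      qed
    qed measurable
    also have "\<dots> = - (R powr (- s - 1)) / 2 * (\<integral>y. (2 - 2 * y $ i) powr (- s / 2) \<partial>?S)"
      by simp
    also have "(\<integral>y. (2 - 2 * y $ i) powr (- s / 2) \<partial>?S) = c_const s CARD('n)"
    proof (rule sphere_uniform_integral_eq_c_const[OF s])
      \<comment> \<open>Integrability of the power \<open>- a\<close> of the squared distance
        follows from that of the power \<open>- (a + 1)\<close>, since the squared distance is at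
        most \<open>4 * R\<^sup>2\<close> on the sphere.\<close>
      have "integrable ?S (\<lambda>y. (2 * R\<^sup>2) powr a * (sq_dist R R (y $ i) * sq_dist R R (y $ i) powr (- (a + 1))))"
      proof (rule Bochner_Integration.integrable_bound)
        show "integrable ?S (\<lambda>y. (2 * R\<^sup>2) powr a * (4 * R\<^sup>2 * sq_dist R R (y $ i) powr (- (a + 1))))"
          using R by (intro integrable_mult_right pint) auto
        show "AE y in ?S. norm ((2 * R\<^sup>2) powr a * (sq_dist R R (y $ i) * sq_dist R R (y $ i) powr (- (a + 1))))
            \<le> norm ((2 * R\<^sup>2) powr a * (4 * R\<^sup>2 * sq_dist R R (y $ i) powr (- (a + 1))))"
          using AE_sphere_uniform_1_component[of i]
        proof eventually_elim
          case (elim y)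
          have "\<bar>sq_dist R R (y $ i)\<bar> \<le> 4 * R\<^sup>2"
            using sq_dist_nonneg[OF elim, of R R] sq_dist_le[OF elim, of R R] R by (simp add: power2_eq_square)
          then show ?case by (simp add: abs_mult mult_left_mono mult_right_mono)
        qed
      qed measurable
      also have "?this \<longleftrightarrow> integrable ?S (\<lambda>y. (1 - y $ i) powr (- s / 2))"
      proof (rule integrable_cong_AE)
        show "AE y in ?S. (2 * R\<^sup>2) powr a * (sq_dist R R (y $ i) * sq_dist R R (y $ i) powr (- (a + 1))) = (1 - y $ i) powr (- s / 2)"
          using AE_sphere_uniform_1_component_neq[OF d2, of i]
        proof eventually_elim
          case (elim y)
          define x where "x = 1 - y $ i"
          have x: "x > 0" using elim by (auto simp: x_def)
          have q: "sq_dist R R (y $ i) = (2 * R\<^sup>2) * x" 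
            unfolding qR x_def using R by (simp add: power2_eq_square algebra_simps)
          have q0: "sq_dist R R (y $ i) > 0" unfolding q using x R by simp
          have "sq_dist R R (y $ i) * sq_dist R R (y $ i) powr (- (a + 1)) = sq_dist R R (y $ i) powr (1 + - (a + 1))"
            unfolding powr_add using q0 by simp
          also have "\<dots> = (2 * R\<^sup>2) powr (- a) * x powr (- a)"
            unfolding q using R x by (simp add: powr_mult)
          finally have "(2 * R\<^sup>2) powr a * (sq_dist R R (y $ i) * sq_dist R R (y $ i) powr (- (a + 1)))
              = ((2 * R\<^sup>2) powr a * (2 * R\<^sup>2) powr (- a)) * x powr (- a)" by simp
          also have "\<dots> = x powr (- a)" using R by (simp flip: powr_add)
          finally show ?case by (simp add: x_def a_def)
        qed
      qed measurable
      finally show "integrable ?S (\<lambda>y. (1 - y $ i) powr (- s / 2))" .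
    qed
    finally show ?thesis by simp
  qed
  then have "(\<lambda>n. sphere_mean i R (\<lambda>q. riesz_profile a (q + e n)) R
     + Dn n / R * (r\<^sup>2 - R\<^sup>2) / 2 - G n / R ^ d * \<bar>r\<^sup>2 - R\<^sup>2\<bar> / 2)
     \<longlonglongrightarrow> sphere_mean i R (riesz_profile a) R + (- (R powr (- s - 1)) * c_const s CARD('n) / 2) / R * (r\<^sup>2 - R\<^sup>2) / 2
        - 0 / R ^ d * \<bar>r\<^sup>2 - R\<^sup>2\<bar> / 2"
    using R k_lim(3)[OF less_imp_le[OF R]]
    by (intro tendsto_add tendsto_diff tendsto_mult tendsto_divide tendsto_const G_lim) (auto simp: e_def)
  then have "sphere_mean i R (riesz_profile a) R + (- (R powr (- s - 1)) * c_const s CARD('n) / 2) / R * (r\<^sup>2 - R\<^sup>2) / 2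
        - 0 / R ^ d * \<bar>r\<^sup>2 - R\<^sup>2\<bar> / 2 \<le> sphere_mean i R (riesz_profile a) r"
    using k_lim(3)[OF r] tangent by (intro LIMSEQ_le) (auto simp: e_def)
  \<comment> \<open>Dividing the radial derivative at \<open>R\<close> by \<open>2 * R\<close> gives
    the slope in the variable \<open>r\<^sup>2\<close>. The two factors 1/2, from the profile and
    from this change of variable, make up the 4 in the denominator.\<close>
  also have "(- (R powr (- s - 1)) * c_const s CARD('n) / 2) / R * (r\<^sup>2 - R\<^sup>2) / 2
      = - (c_const s CARD('n) / (4 * R powr (s + 2)) * (r\<^sup>2 - R\<^sup>2))"
  proof -
    have "R powr (- s - 1) = R powr (- (s + 2) + 1)"
      by (rule arg_cong[where f = "(powr) R"]) simp
    also have "\<dots> = R / R powr (s + 2)"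
      unfolding powr_add[of R "- (s + 2)" 1] powr_minus_divide[of R "s + 2"] using R by simp
    finally show ?thesis using R by simp
  qed
  finally show "sphere_mean i R (riesz_profile (s / 2)) r
        \<ge> sphere_mean i R (riesz_profile (s / 2)) R - c_const s CARD('n) / (4 * R powr (s + 2)) * (r\<^sup>2 - R\<^sup>2)"
    by (simp add: a_def)
qed

section \<open>Riesz kernels as mixtures of Gaussians\<close>

text \<open>The lower limit 0 is admissible exactly in the case \<open>a < 0\<close>: the exponent
  \<open>- a - 1\<close> then exceeds -1, and the profile is continuous at 0.\<close>

lemma has_integral_riesz_profile:
  assumes q: "0 \<le> p" "p \<le> q" and dom: "p > 0 \<or> a < 0"
  shows "((\<lambda>\<eta>. \<eta> powr (- a - 1)) has_integral 2 * (riesz_profile a p - riesz_profile a q)) {p..q}"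
proof -
  have "((\<lambda>\<eta>. \<eta> powr (- a - 1)) has_integral (- 2 * riesz_profile a q - (- 2 * riesz_profile a p))) {p..q}"
  proof (rule fundamental_theorem_of_calculus_interior[OF q(2)])
    show "continuous_on {p..q} (\<lambda>x. - 2 * riesz_profile a x)"
    proof (cases "a = 0")
      case True
      then show ?thesis using dom q unfolding riesz_profile_def[abs_def] by (auto intro!: continuous_intros)
    next
      case False
      have "continuous_on {p..q} (\<lambda>x. x powr (- a))"
        using dom q by (intro continuous_on_powr' continuous_intros) auto
      then show ?thesis using False unfolding riesz_profile_def[abs_def] by (auto intro!: continuous_intros)
    qed
    fix x assume "x \<in> {p<..<q}"
    then have "x > 0" using q by auto
    from DERIV_cmult[OF riesz_profile_deriv[OF this, of a], of "- 2"]
    show "((\<lambda>x. - 2 * riesz_profile a x) has_vector_derivative x powr (- a - 1)) (at x)"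
      by (simp add: has_real_derivative_iff_has_vector_derivative)
  qed
  then show ?thesis by (simp add: algebra_simps)
qed

lemma nn_integral_powr_exp:
  assumes "a > -1" "\<eta> > 0"
  shows "(\<integral>\<^sup>+t. ennreal (indicator {0..} t * (t powr a * exp (- t * \<eta>))) \<partial>lborel) = ennreal (Gamma (a + 1) * \<eta> powr (- a - 1))"
proof -
  have "(\<integral>\<^sup>+t. ennreal (indicator {0..} t * (t powr a * exp (- t * \<eta>))) \<partial>lborel)
      = ennreal \<bar>inverse \<eta>\<bar> * (\<integral>\<^sup>+u. ennreal (indicator {0..} (0 + inverse \<eta> * u) * ((0 + inverse \<eta> * u) powr a * exp (- (0 + inverse \<eta> * u) * \<eta>))) \<partial>lborel)"
    using assms by (intro nn_integral_real_affine) auto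
  also have "(\<integral>\<^sup>+u. ennreal (indicator {0..} (0 + inverse \<eta> * u) * ((0 + inverse \<eta> * u) powr a * exp (- (0 + inverse \<eta> * u) * \<eta>))) \<partial>lborel)
     = (\<integral>\<^sup>+u. ennreal (inverse \<eta> powr a) * ennreal (indicator {0..} u * u powr (a + 1 - 1) / exp u) \<partial>lborel)"
  proof (rule nn_integral_cong)
    fix u :: real
    show "ennreal (indicator {0..} (0 + inverse \<eta> * u) * ((0 + inverse \<eta> * u) powr a * exp (- (0 + inverse \<eta> * u) * \<eta>)))
       = ennreal (inverse \<eta> powr a) * ennreal (indicator {0..} u * u powr (a + 1 - 1) / exp u)"
    proof (cases "u \<ge> 0")
      case True
      have 1: "(inverse \<eta> * u) powr a = inverse \<eta> powr a * u powr a" by (rule powr_mult)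
      have 2: "- (inverse \<eta> * u) * \<eta> = - u" using assms by simp
      have "ennreal (inverse \<eta> powr a) * ennreal (indicator {0..} u * u powr (a + 1 - 1) / exp u)
          = ennreal (inverse \<eta> powr a * (u powr a * exp (- u)))"
        using True by (simp add: ennreal_mult exp_minus divide_inverse)
      moreover have "inverse \<eta> * u \<ge> 0" using True assms by simp
      ultimately show ?thesis unfolding add_0 1 2 by (simp add: mult.assoc)
    next
      case False
      then have "\<not> inverse \<eta> * u \<ge> 0" using assms by (simp add: zero_le_mult_iff)
      then show ?thesis using False by simp
    qed
  qed
  also have "\<dots> = ennreal (inverse \<eta> powr a) * ennreal (Gamma (a + 1))"
    using Gamma_conv_nn_integral_real[of "a + 1"] assms by (subst nn_integral_cmult) auto
  also have "ennreal \<bar>inverse \<eta>\<bar> * (ennreal (inverse \<eta> powr a) * ennreal (Gamma (a + 1))) = ennreal (Gamma (a + 1) * (inverse \<eta> powr 1 * inverse \<eta> powr a))"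
    using assms Gamma_real_pos[of "a + 1"] by (simp flip: ennreal_mult add: mult_ac)
  also have "inverse \<eta> powr 1 * inverse \<eta> powr a = \<eta> powr (- a - 1)"
  proof -
    have "inverse \<eta> powr 1 * inverse \<eta> powr a = inverse \<eta> powr (1 + a)" by (simp only: powr_add)
    also have "\<dots> = \<eta> powr (- (1 + a))" using assms by (simp only: inverse_powr powr_minus less_imp_le)
    also have "- (1 + a) = - a - 1" by simp
    finally show ?thesis .
  qed
  finally show ?thesis .
qed

text \<open>The difference of exponentials is the integral of \<open>t * exp (- t * \<eta>)\<close>
  over \<open>\<eta>\<close> between \<open>p\<close> and \<open>q\<close>. After exchanging the
  integrals the inner one is a Gamma integral, convergent because \<open>a > -1\<close>, and the
  outer one is a difference of profiles.\<close>

lemma nn_integral_riesz_profile: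
  assumes a: "a > -1" and q: "0 \<le> p" "p \<le> q" and dom: "p > 0 \<or> a < 0"
  shows "(\<integral>\<^sup>+t. ennreal (indicator {0..} t * (t powr (a - 1) * (exp (- t * p) - exp (- t * q)))) \<partial>lborel)
     = ennreal (2 * Gamma (a + 1) * (riesz_profile a p - riesz_profile a q))"
proof -
  have inner: "ennreal (indicator {0..} t * (t powr (a - 1) * (exp (- t * p) - exp (- t * q))))
     = (\<integral>\<^sup>+\<eta>. ennreal (indicator {p..q} \<eta> * (indicator {0..} t * (t powr a * exp (- t * \<eta>)))) \<partial>lborel)" for t
  proof (cases "t > 0")
    case False
    then show ?thesis by (cases "t = 0") auto
  next
    case True
    have "((\<lambda>\<eta>. t powr a * exp (- t * \<eta>)) has_integral (- (t powr (a - 1)) * exp (- t * q) - (- (t powr (a - 1)) * exp (- t * p)))) {p..q}"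
    proof (rule fundamental_theorem_of_calculus[OF q(2)])
      fix x
      have "((\<lambda>x. - (t powr (a - 1)) * exp (- t * x)) has_real_derivative t powr (a - 1) * t powr 1 * exp (- t * x)) (at x within {p..q})"
        using True by (auto intro!: derivative_eq_intros)
      also have "t powr (a - 1) * t powr 1 = t powr a" unfolding powr_add[symmetric] by simp
      finally show "((\<lambda>x. - (t powr (a - 1)) * exp (- t * x)) has_vector_derivative t powr a * exp (- t * x)) (at x within {p..q})"
        by (simp add: has_real_derivative_iff_has_vector_derivative)
    qed
    then have "(\<integral>\<^sup>+\<eta>. ennreal (indicator {p..q} \<eta> * (t powr a * exp (- t * \<eta>))) \<partial>lborel)
       = ennreal (- (t powr (a - 1)) * exp (- t * q) - (- (t powr (a - 1)) * exp (- t * p)))"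
      by (intro nn_integral_has_integral_lebesgue) auto
    then show ?thesis using True by (simp add: algebra_simps)
  qed
  have "(\<integral>\<^sup>+t. ennreal (indicator {0..} t * (t powr (a - 1) * (exp (- t * p) - exp (- t * q)))) \<partial>lborel)
     = (\<integral>\<^sup>+\<eta>. (\<integral>\<^sup>+t. ennreal (indicator {p..q} \<eta> * (indicator {0..} t * (t powr a * exp (- t * \<eta>)))) \<partial>lborel) \<partial>lborel)"
    unfolding inner by (rule lborel_pair.Fubini') measurable
  also have "\<dots> = (\<integral>\<^sup>+\<eta>. ennreal (Gamma (a + 1)) * ennreal (indicator {p..q} \<eta> * \<eta> powr (- a - 1)) \<partial>lborel)"
  proof (rule nn_integral_cong_AE)
    have "AE \<eta> in lborel. \<eta> \<noteq> (0::real)" by (rule AE_lborel_singleton)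
    then show "AE \<eta> in lborel. (\<integral>\<^sup>+t. ennreal (indicator {p..q} \<eta> * (indicator {0..} t * (t powr a * exp (- t * \<eta>)))) \<partial>lborel)
       = ennreal (Gamma (a + 1)) * ennreal (indicator {p..q} \<eta> * \<eta> powr (- a - 1))"
    proof eventually_elim
      case (elim \<eta>)
      show ?case
      proof (cases "\<eta> \<in> {p..q}")
        case True
        then have "\<eta> > 0" using elim q by auto
        then show ?thesis using True nn_integral_powr_exp[OF a, of \<eta>] Gamma_real_pos[of "a + 1"] a
          by (simp add: ennreal_mult)
      qed simp
    qed
  qed
  also have "\<dots> = ennreal (Gamma (a + 1)) * ennreal (2 * (riesz_profile a p - riesz_profile a q))"
    by (subst nn_integral_cmult, measurable, subst nn_integral_has_integral_lebesgue[OF _ has_integral_riesz_profile[OF q dom]]) auto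
  also have "\<dots> = ennreal (2 * Gamma (a + 1) * (riesz_profile a p - riesz_profile a q))"
    using a Gamma_real_pos[of "a + 1"] by (subst ennreal_mult'[symmetric]) (auto simp: algebra_simps)
  finally show ?thesis .
qed

text \<open>Subtracting the exponential for \<open>q = 1\<close> gains one power of \<open>t\<close>
  near 0, which makes the weight \<open>t powr (a - 1)\<close> integrable there for every
  \<open>a > -1\<close>.\<close>

definition gauss_mix :: "real \<Rightarrow> real \<Rightarrow> real \<Rightarrow> real" where
  "gauss_mix a q t = indicator {0..} t * (t powr (a - 1) * (exp (- t * q) - exp (- t)))"

lemma riesz_profile_antimono':
  assumes "0 \<le> p" "p \<le> q" "p > 0 \<or> a < 0"
  shows "riesz_profile a q \<le> riesz_profile a p"
proof (cases "p = 0")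
  case True
  then show ?thesis using assms by (auto simp: riesz_profile_def divide_nonneg_neg)
next
  case False
  then show ?thesis using assms by (intro riesz_profile_antimono) auto
qed

text \<open>In \<open>t\<close> the integrand has a constant sign, decided by whether
  \<open>q \<le> 1\<close>. Hence its integral and the integral of its norm agree up to sign, which
  gives the norm in closed form for the use of Fubini's theorem.\<close>

lemma gauss_mix_integrals:
  assumes a: "a > -1" and q: "0 \<le> q" and dom: "q > 0 \<or> a < 0"
  shows integrable_gauss_mix: "integrable lborel (gauss_mix a q)"
    and integral_gauss_mix: "(\<integral>t. gauss_mix a q t \<partial>lborel) = 2 * Gamma (a + 1) * (riesz_profile a q - riesz_profile a 1)"
    and integral_norm_gauss_mix: "(\<integral>t. norm (gauss_mix a q t) \<partial>lborel) = 2 * Gamma (a + 1) * \<bar>riesz_profile a q - riesz_profile a 1\<bar>"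
proof -
  have G: "Gamma (a + 1) > 0" using a by (intro Gamma_real_pos) auto
  have [measurable]: "gauss_mix a q \<in> borel_measurable borel"
    unfolding gauss_mix_def[abs_def] by measurable
  have "integrable lborel (gauss_mix a q) \<and> (\<integral>t. gauss_mix a q t \<partial>lborel) = 2 * Gamma (a + 1) * (riesz_profile a q - riesz_profile a 1)
     \<and> (\<integral>t. norm (gauss_mix a q t) \<partial>lborel) = 2 * Gamma (a + 1) * \<bar>riesz_profile a q - riesz_profile a 1\<bar>"
  proof (cases "q \<le> 1")
    case True
    have nn: "gauss_mix a q t \<ge> 0" for t
      using True unfolding gauss_mix_def by (cases "t \<ge> 0") (auto intro!: mult_nonneg_nonneg mult_left_le)
    have k: "riesz_profile a q - riesz_profile a 1 \<ge> 0" using riesz_profile_antimono'[OF q True dom] by simp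
    have "(\<integral>\<^sup>+t. ennreal (gauss_mix a q t) \<partial>lborel) = ennreal (2 * Gamma (a + 1) * (riesz_profile a q - riesz_profile a 1))"
      unfolding gauss_mix_def using nn_integral_riesz_profile[OF a q True dom] by simp
    then have "integrable lborel (gauss_mix a q) \<and> (\<integral>t. gauss_mix a q t \<partial>lborel) = 2 * Gamma (a + 1) * (riesz_profile a q - riesz_profile a 1)"
      by (subst (asm) nn_integral_eq_integrable) (use nn k G in auto)
    then show ?thesis using nn k by simp
  next
    case False
    then have q1: "1 \<le> q" by simp
    have nn: "- gauss_mix a q t \<ge> 0" for t
      using q1 unfolding gauss_mix_def by (cases "t \<ge> 0") (auto intro!: mult_nonneg_nonpos simp: mult_le_cancel_left1)
    have k: "riesz_profile a 1 - riesz_profile a q \<ge> 0" using riesz_profile_antimono'[OF _ q1, of a] by simp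
    have "(\<integral>\<^sup>+t. ennreal (- gauss_mix a q t) \<partial>lborel) = ennreal (2 * Gamma (a + 1) * (riesz_profile a 1 - riesz_profile a q))"
    proof -
      have "- gauss_mix a q t = indicator {0..} t * (t powr (a - 1) * (exp (- t * 1) - exp (- t * q)))" for t
        by (simp add: gauss_mix_def algebra_simps)
      then show ?thesis using nn_integral_riesz_profile[OF a _ q1] by simp
    qed
    then have "integrable lborel (\<lambda>t. - gauss_mix a q t) \<and> (\<integral>t. - gauss_mix a q t \<partial>lborel) = 2 * Gamma (a + 1) * (riesz_profile a 1 - riesz_profile a q)"
      by (subst (asm) nn_integral_eq_integrable) (use nn k G in auto)
    moreover have "norm (gauss_mix a q t) = - gauss_mix a q t" for t using nn[of t] by simp
    ultimately show ?thesis using k by (simp add: algebra_simps)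
  qed
  then show "integrable lborel (gauss_mix a q)"
    and "(\<integral>t. gauss_mix a q t \<partial>lborel) = 2 * Gamma (a + 1) * (riesz_profile a q - riesz_profile a 1)"
    and "(\<integral>t. norm (gauss_mix a q t) \<partial>lborel) = 2 * Gamma (a + 1) * \<bar>riesz_profile a q - riesz_profile a 1\<bar>"
    by blast+
qed

definition gauss_energy :: "'a::euclidean_space measure \<Rightarrow> 'a measure \<Rightarrow> real \<Rightarrow> real" where
  "gauss_energy \<mu> \<nu> t = (\<integral>z. exp (- t * (norm (fst z - snd z))\<^sup>2) \<partial>(\<mu> \<Otimes>\<^sub>M \<nu>))"

text \<open>The condition on the diagonal excludes the junk value of the kernel there when \<open>a \<ge> 0\<close>.\<close>

lemma riesz_energy_gauss_mix:
  fixes \<mu> \<nu> :: "'a::euclidean_space measure"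
  assumes \<mu>: "prob_space \<mu>" "sets \<mu> = sets borel" and \<nu>: "prob_space \<nu>" "sets \<nu> = sets borel" and a: "a > -1"
    and int: "integrable (\<mu> \<Otimes>\<^sub>M \<nu>) (\<lambda>z. riesz_profile a ((norm (fst z - snd z))\<^sup>2))"
    and diag: "a < 0 \<or> (AE z in \<mu> \<Otimes>\<^sub>M \<nu>. fst z \<noteq> snd z)"
  shows "integrable lborel (\<lambda>t. indicator {0..} t * (t powr (a - 1) * (gauss_energy \<mu> \<nu> t - exp (- t))))"
    and "(\<integral>t. indicator {0..} t * (t powr (a - 1) * (gauss_energy \<mu> \<nu> t - exp (- t))) \<partial>lborel)
      = 2 * Gamma (a + 1) * ((\<integral>z. riesz_profile a ((norm (fst z - snd z))\<^sup>2) \<partial>(\<mu> \<Otimes>\<^sub>M \<nu>)) - riesz_profile a 1)"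
proof -
  interpret \<mu>: prob_space \<mu> by fact
  interpret \<nu>: prob_space \<nu> by fact
  note [measurable_cong] = \<mu>(2) \<nu>(2)
  interpret pair_prob_space \<mu> \<nu> ..
  let ?M = "\<mu> \<Otimes>\<^sub>M \<nu>"
  interpret L: pair_sigma_finite ?M "lborel :: real measure" ..
  define q where "q z = (norm (fst z - snd z :: 'a))\<^sup>2" for z
  have [measurable]: "q \<in> borel_measurable ?M" unfolding q_def[abs_def] by measurable
  have dom: "AE z in ?M. q z > 0 \<or> a < 0"
    using diag
  proof
    assume "AE z in ?M. fst z \<noteq> snd z"
    then show ?thesis by eventually_elim (simp add: q_def)
  qed simp
  have [measurable]: "(\<lambda>x. gauss_mix a (q (fst x)) (snd x)) \<in> borel_measurable (?M \<Otimes>\<^sub>M lborel)"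
    unfolding gauss_mix_def by measurable
  have intf: "integrable (?M \<Otimes>\<^sub>M lborel) (\<lambda>x. gauss_mix a (q (fst x)) (snd x))"
  proof (rule L.Fubini_integrable)
    \<comment> \<open>The norm in \<open>t\<close> is a multiple of a difference of kernel values,
      so joint integrability reduces to the assumed integrability of the kernel.\<close>
    have "integrable ?M (\<lambda>z. 2 * Gamma (a + 1) * \<bar>riesz_profile a (q z) - riesz_profile a 1\<bar>)"
      using int unfolding q_def by (intro integrable_mult_right integrable_abs Bochner_Integration.integrable_diff) auto
    then show "integrable ?M (\<lambda>z. \<integral>t. norm (gauss_mix a (q (fst (z, t))) (snd (z, t))) \<partial>lborel)"
    proof (rule integrable_cong_AE_imp)
      show "AE z in ?M. 2 * Gamma (a + 1) * \<bar>riesz_profile a (q z) - riesz_profile a 1\<bar> = (\<integral>t. norm (gauss_mix a (q (fst (z, t))) (snd (z, t))) \<partial>lborel)"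
        using dom by eventually_elim (use integral_norm_gauss_mix[OF a] in \<open>simp add: q_def\<close>)
    qed measurable
    show "AE z in ?M. integrable lborel (\<lambda>t. gauss_mix a (q (fst (z, t))) (snd (z, t)))"
      using dom by eventually_elim (use integrable_gauss_mix[OF a] in \<open>simp add: q_def\<close>)
  qed measurable
  then have intf': "integrable (?M \<Otimes>\<^sub>M lborel) (case_prod (\<lambda>z t. gauss_mix a (q z) t))"
    by (simp add: case_prod_unfold)
  have inner: "(\<integral>z. gauss_mix a (q z) t \<partial>?M) = indicator {0..} t * (t powr (a - 1) * (gauss_energy \<mu> \<nu> t - exp (- t)))" for t
  proof (cases "t \<ge> 0")
    case True
    have "integrable ?M (\<lambda>z. exp (- t * q z))"
      using True by (intro integrable_const_bound[where B = 1]) (auto simp: q_def)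
    then have "(\<integral>z. exp (- t * q z) - exp (- t) \<partial>?M) = gauss_energy \<mu> \<nu> t - exp (- t)"
      using prob_space by (subst Bochner_Integration.integral_diff) (auto simp: gauss_energy_def q_def)
    then show ?thesis by (simp add: gauss_mix_def)
  qed (simp add: gauss_mix_def)
  show "integrable lborel (\<lambda>t. indicator {0..} t * (t powr (a - 1) * (gauss_energy \<mu> \<nu> t - exp (- t))))"
    using L.integrable_snd[OF intf'] unfolding inner .
  have "(\<integral>t. indicator {0..} t * (t powr (a - 1) * (gauss_energy \<mu> \<nu> t - exp (- t))) \<partial>lborel)
      = (\<integral>z. (\<integral>t. gauss_mix a (q z) t \<partial>lborel) \<partial>?M)"
    using L.Fubini_integral[OF intf'] unfolding inner .
  also have "\<dots> = (\<integral>z. 2 * Gamma (a + 1) * (riesz_profile a (q z) - riesz_profile a 1) \<partial>?M)"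
  proof (rule integral_cong_AE)
    show "AE z in ?M. (\<integral>t. gauss_mix a (q z) t \<partial>lborel) = 2 * Gamma (a + 1) * (riesz_profile a (q z) - riesz_profile a 1)"
      using dom by eventually_elim (use integral_gauss_mix[OF a] in \<open>simp add: q_def\<close>)
  qed (use intf in \<open>auto simp: gauss_mix_def\<close>)
  also have "\<dots> = 2 * Gamma (a + 1) * ((\<integral>z. riesz_profile a (q z) \<partial>?M) - riesz_profile a 1)"
    using int prob_space unfolding q_def
    by (subst integral_mult_right_zero, subst Bochner_Integration.integral_diff) auto
  finally show "(\<integral>t. indicator {0..} t * (t powr (a - 1) * (gauss_energy \<mu> \<nu> t - exp (- t))) \<partial>lborel)
      = 2 * Gamma (a + 1) * ((\<integral>z. riesz_profile a ((norm (fst z - snd z))\<^sup>2) \<partial>?M) - riesz_profile a 1)"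
    unfolding q_def .
qed

section \<open>Strict positive definiteness\<close>

lemma integrable_gaussian:
  assumes "\<tau> > 0"
  shows "integrable lborel (\<lambda>x::'a::euclidean_space. exp (- \<tau> * (norm x)\<^sup>2))"
proof -
  define \<sigma> where "\<sigma> = sqrt (1 / (2 * \<tau>))"
  have \<sigma>: "\<sigma> > 0" "\<sigma>\<^sup>2 = 1 / (2 * \<tau>)" using assms by (auto simp: \<sigma>_def)
  have "exp (- \<tau> * x\<^sup>2) = sqrt (2 * pi * \<sigma>\<^sup>2) * normal_density 0 \<sigma> x" for x
    using assms \<sigma> by (simp add: normal_density_def)
  then have "integrable lborel (\<lambda>x. exp (- \<tau> * x\<^sup>2) :: real)"
    using integrable_normal_density[OF \<sigma>(1), of 0] by simp
  then have fin: "(\<integral>\<^sup>+x. ennreal (exp (- \<tau> * x\<^sup>2)) \<partial>lborel) < \<infinity>"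
    by (simp add: integrable_iff_bounded)
  have "exp (- \<tau> * (norm x)\<^sup>2) = (\<Prod>b\<in>Basis. exp (- \<tau> * (x \<bullet> b)\<^sup>2))" for x :: 'a
  proof -
    have "(norm x)\<^sup>2 = (\<Sum>b\<in>Basis. (x \<bullet> b)\<^sup>2)"
      unfolding power2_norm_eq_inner by (subst euclidean_inner) (simp add: power2_eq_square)
    then show ?thesis by (simp add: exp_sum[symmetric] sum_distrib_left sum_negf)
  qed
  then have "(\<integral>\<^sup>+(x::'a). ennreal (exp (- \<tau> * (norm x)\<^sup>2)) \<partial>lborel)
      = (\<integral>\<^sup>+(x::'a). (\<Prod>b\<in>Basis. ennreal (exp (- \<tau> * (x \<bullet> b)\<^sup>2))) \<partial>lborel)"
    by (simp add: prod_ennreal)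
  also have "\<dots> = (\<Prod>b\<in>(Basis::'a set). (\<integral>\<^sup>+x. ennreal (exp (- \<tau> * x\<^sup>2)) \<partial>lborel))"
    by (rule nn_integral_lborel_prod) auto
  also have "\<dots> < \<infinity>"
    using fin by (simp add: power_less_top_ennreal)
  finally show ?thesis by (simp add: integrable_iff_bounded)
qed

lemma integral_gaussian_pos:
  assumes "\<tau> > 0"
  shows "integral\<^sup>L lborel (\<lambda>x::'a::euclidean_space. exp (- \<tau> * (norm x)\<^sup>2)) > 0"
proof -
  have "(\<integral>(x::'a). exp (- \<tau> * (norm x)\<^sup>2) \<partial>lborel) \<noteq> 0"
  proof
    assume "(\<integral>(x::'a). exp (- \<tau> * (norm x)\<^sup>2) \<partial>lborel) = 0"
    then have "AE x::'a in lborel. exp (- \<tau> * (norm x)\<^sup>2) = 0"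
      using integral_nonneg_eq_0_iff_AE[OF integrable_gaussian[OF assms, where 'a = 'a]] by simp
    then have "AE x::'a in lborel. x \<notin> UNIV" by simp
    then have "(UNIV :: 'a set) \<in> null_sets lborel" by (subst AE_iff_null_sets) auto
    then show False by (simp add: null_sets_def)
  qed
  moreover have "(\<integral>(x::'a). exp (- \<tau> * (norm x)\<^sup>2) \<partial>lborel) \<ge> 0" by simp
  ultimately show ?thesis by linarith
qed

text \<open>The exponent is doubled so that the product of two such Gaussians, integrated over their
  common center, is a multiple of the Gaussian with exponent \<open>t\<close>.\<close>

definition gauss_smooth :: "real \<Rightarrow> 'a::euclidean_space measure \<Rightarrow> 'a \<Rightarrow> real" where
  "gauss_smooth t \<mu> z = (\<integral>x. exp (- 2 * t * (norm (x - z))\<^sup>2) \<partial>\<mu>)"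

text \<open>With \<open>m\<close> the midpoint of \<open>x\<close> and \<open>y\<close>, the
  parallelogram law turns \<open>2 * t\<close> times the sum of the squared distances from
  \<open>m + z\<close> to \<open>x\<close> and \<open>y\<close> into
  \<open>t * (norm (x - y))\<^sup>2 + 4 * t * (norm z)\<^sup>2\<close>; the second summand
  integrates to a constant.\<close>

lemma gauss_energy_eq_integral:
  fixes \<mu> \<nu> :: "'a::euclidean_space measure"
  assumes \<mu>: "prob_space \<mu>" "sets \<mu> = sets borel" and \<nu>: "prob_space \<nu>" "sets \<nu> = sets borel" and t: "t > 0"
  shows "integrable lborel (\<lambda>z. gauss_smooth t \<mu> z * gauss_smooth t \<nu> z)"
    and "(\<integral>z. gauss_smooth t \<mu> z * gauss_smooth t \<nu> z \<partial>lborel)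
       = (\<integral>(z::'a). exp (- (4 * t) * (norm z)\<^sup>2) \<partial>lborel) * gauss_energy \<mu> \<nu> t"
proof -
  interpret \<mu>: prob_space \<mu> by fact
  interpret \<nu>: prob_space \<nu> by fact
  note [measurable_cong] = \<mu>(2) \<nu>(2)
  interpret pair_prob_space \<mu> \<nu> ..
  interpret L: pair_sigma_finite "\<mu> \<Otimes>\<^sub>M \<nu>" "lborel :: 'a measure" ..
  define g where "g x z = exp (- 2 * t * (norm (x - z))\<^sup>2)" for x z :: 'a
  define c where "c = (\<integral>(z::'a). exp (- (4 * t) * (norm z)\<^sup>2) \<partial>lborel)"
  have c0: "c \<ge> 0" by (simp add: c_def)
  have g_meas: "(\<lambda>x. g x z) \<in> borel_measurable borel" "(\<lambda>z. g x z) \<in> borel_measurable borel" for x z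
    unfolding g_def by measurable
  have g01: "0 \<le> g x z" "g x z \<le> 1" for x z using t by (auto simp: g_def)
  have nn1: "(\<integral>\<^sup>+x. ennreal (g x z) \<partial>\<mu>) = ennreal (gauss_smooth t \<mu> z)" for z
    unfolding gauss_smooth_def g_def[symmetric]
    by (rule nn_integral_eq_integral)
       (use g01 g_meas in \<open>auto intro!: \<mu>.integrable_const_bound[where B = 1]\<close>)
  have nn2: "(\<integral>\<^sup>+x. ennreal (g x z) \<partial>\<nu>) = ennreal (gauss_smooth t \<nu> z)" for z
    unfolding gauss_smooth_def g_def[symmetric]
    by (rule nn_integral_eq_integral)
       (use g01 g_meas in \<open>auto intro!: \<nu>.integrable_const_bound[where B = 1]\<close>)
  have [measurable]: "gauss_smooth t \<mu> \<in> borel_measurable borel" "gauss_smooth t \<nu> \<in> borel_measurable borel"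
    unfolding gauss_smooth_def[abs_def] by measurable
  have smooth_nonneg: "gauss_smooth t \<mu> z \<ge> 0" "gauss_smooth t \<nu> z \<ge> 0" for z
    unfolding gauss_smooth_def by auto
  have prod: "(\<integral>\<^sup>+z. ennreal (g x z * g y z) \<partial>lborel) = ennreal (c * exp (- t * (norm (x - y))\<^sup>2))" for x y
  proof -
    define m where "m = (1/2) *\<^sub>R (x + y)"
    have gg: "g x (m + z) * g y (m + z) = exp (- t * (norm (x - y))\<^sup>2) * exp (- (4 * t) * (norm z)\<^sup>2)" for z
    proof -
      define w where "w = (1/2) *\<^sub>R (x - y)"
      have "x - (m + z) = w - z" "y - (m + z) = - (w + z)"
        by (auto simp: m_def w_def algebra_simps simp flip: scaleR_add_left)
      then have A: "(norm (x - (m + z)))\<^sup>2 + (norm (y - (m + z)))\<^sup>2 = 2 * (norm w)\<^sup>2 + 2 * (norm z)\<^sup>2"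
        by (simp only: norm_minus_cancel) (simp add: power2_norm_eq_inner inner_diff inner_add inner_commute)
      have B: "(norm w)\<^sup>2 = (norm (x - y))\<^sup>2 / 4" by (simp add: w_def power_divide)
      have "- 2 * t * (norm (x - (m + z)))\<^sup>2 + - 2 * t * (norm (y - (m + z)))\<^sup>2
          = - 2 * t * ((norm (x - (m + z)))\<^sup>2 + (norm (y - (m + z)))\<^sup>2)"
        by (simp only: distrib_left)
      also have "\<dots> = - t * (norm (x - y))\<^sup>2 + - (4 * t) * (norm z)\<^sup>2"
        unfolding A B by (simp add: algebra_simps)
      finally have "- 2 * t * (norm (x - (m + z)))\<^sup>2 + - 2 * t * (norm (y - (m + z)))\<^sup>2
          = - t * (norm (x - y))\<^sup>2 + - (4 * t) * (norm z)\<^sup>2" .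
      then show ?thesis unfolding g_def exp_add[symmetric] by simp
    qed
    have "(\<integral>\<^sup>+z. ennreal (g x z * g y z) \<partial>lborel) = (\<integral>\<^sup>+z. ennreal (g x (m + z) * g y (m + z)) \<partial>lborel)"
      using g_meas by (intro nn_integral_lborel_translate[symmetric]) auto
    also have "\<dots> = ennreal (exp (- t * (norm (x - y))\<^sup>2)) * (\<integral>\<^sup>+(z::'a). ennreal (exp (- (4 * t) * (norm z)\<^sup>2)) \<partial>lborel)"
      unfolding gg by (subst nn_integral_cmult[symmetric]) (auto simp: ennreal_mult)
    also have "(\<integral>\<^sup>+(z::'a). ennreal (exp (- (4 * t) * (norm z)\<^sup>2)) \<partial>lborel) = ennreal c"
      unfolding c_def using t by (intro nn_integral_eq_integral integrable_gaussian) auto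
    finally show ?thesis using c0 by (simp flip: ennreal_mult add: mult.commute)
  qed
  have "(\<integral>\<^sup>+z. ennreal (gauss_smooth t \<mu> z * gauss_smooth t \<nu> z) \<partial>lborel)
     = (\<integral>\<^sup>+z. (\<integral>\<^sup>+w. ennreal (g (fst w) z * g (snd w) z) \<partial>(\<mu> \<Otimes>\<^sub>M \<nu>)) \<partial>lborel)"
  proof (rule nn_integral_cong)
    fix z :: 'a
    have "ennreal (gauss_smooth t \<mu> z * gauss_smooth t \<nu> z) = (\<integral>\<^sup>+x. ennreal (g x z) \<partial>\<mu>) * (\<integral>\<^sup>+y. ennreal (g y z) \<partial>\<nu>)"
      unfolding nn1 nn2 using smooth_nonneg by (simp add: ennreal_mult)
    also have "\<dots> = (\<integral>\<^sup>+x. (\<integral>\<^sup>+y. ennreal (g x z) * ennreal (g y z) \<partial>\<nu>) \<partial>\<mu>)"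
      using g_meas by (simp add: nn_integral_cmult nn_integral_multc)
    also have "\<dots> = (\<integral>\<^sup>+x. (\<integral>\<^sup>+y. ennreal (g (fst (x, y)) z * g (snd (x, y)) z) \<partial>\<nu>) \<partial>\<mu>)"
      using g01 by (simp add: ennreal_mult)
    also have "\<dots> = (\<integral>\<^sup>+w. ennreal (g (fst w) z * g (snd w) z) \<partial>(\<mu> \<Otimes>\<^sub>M \<nu>))"
      unfolding g_def by (rule \<nu>.nn_integral_fst) measurable
    finally show "ennreal (gauss_smooth t \<mu> z * gauss_smooth t \<nu> z) = (\<integral>\<^sup>+w. ennreal (g (fst w) z * g (snd w) z) \<partial>(\<mu> \<Otimes>\<^sub>M \<nu>))" .
  qed
  also have "\<dots> = (\<integral>\<^sup>+w. (\<integral>\<^sup>+z. ennreal (g (fst w) z * g (snd w) z) \<partial>lborel) \<partial>(\<mu> \<Otimes>\<^sub>M \<nu>))"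
    unfolding g_def by (rule L.Fubini') measurable
  also have "\<dots> = (\<integral>\<^sup>+w. ennreal (c * exp (- t * (norm (fst w - snd w))\<^sup>2)) \<partial>(\<mu> \<Otimes>\<^sub>M \<nu>))"
    unfolding prod ..
  also have "\<dots> = ennreal (\<integral>w. c * exp (- t * (norm (fst w - snd w))\<^sup>2) \<partial>(\<mu> \<Otimes>\<^sub>M \<nu>))"
    using t c0 by (intro nn_integral_eq_integral integrable_mult_right integrable_const_bound[where B = 1]) auto
  also have "(\<integral>w. c * exp (- t * (norm (fst w - snd w))\<^sup>2) \<partial>(\<mu> \<Otimes>\<^sub>M \<nu>)) = c * gauss_energy \<mu> \<nu> t"
    by (simp add: gauss_energy_def)
  finally have *: "(\<integral>\<^sup>+z. ennreal (gauss_smooth t \<mu> z * gauss_smooth t \<nu> z) \<partial>lborel) = ennreal (c * gauss_energy \<mu> \<nu> t)" .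
  have "0 \<le> c * gauss_energy \<mu> \<nu> t" using c0 unfolding gauss_energy_def by (intro mult_nonneg_nonneg) auto
  then show "integrable lborel (\<lambda>z. gauss_smooth t \<mu> z * gauss_smooth t \<nu> z)"
    and "(\<integral>z. gauss_smooth t \<mu> z * gauss_smooth t \<nu> z \<partial>lborel) = (\<integral>(z::'a). exp (- (4 * t) * (norm z)\<^sup>2) \<partial>lborel) * gauss_energy \<mu> \<nu> t"
    using * smooth_nonneg unfolding c_def[symmetric] by (subst (asm) nn_integral_eq_integrable; simp)+
qed

text \<open>Up to a positive constant the quadratic form is the squared L2 norm of the difference of
  the two smoothed measures.\<close>

lemma gauss_energy_pos_def:
  fixes \<mu> \<nu> :: "'a::euclidean_space measure"
  assumes \<mu>: "prob_space \<mu>" "sets \<mu> = sets borel" and \<nu>: "prob_space \<nu>" "sets \<nu> = sets borel" and t: "t > 0"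
  shows "gauss_energy \<mu> \<mu> t - 2 * gauss_energy \<mu> \<nu> t + gauss_energy \<nu> \<nu> t \<ge> 0"
    and "gauss_energy \<mu> \<mu> t - 2 * gauss_energy \<mu> \<nu> t + gauss_energy \<nu> \<nu> t = 0
      \<Longrightarrow> AE z in lborel. gauss_smooth t \<mu> z = gauss_smooth t \<nu> z"
proof -
  let ?D = "gauss_energy \<mu> \<mu> t - 2 * gauss_energy \<mu> \<nu> t + gauss_energy \<nu> \<nu> t"
  let ?m = "gauss_smooth t \<mu>" and ?n = "gauss_smooth t \<nu>"
  define c where "c = (\<integral>(z::'a). exp (- (4 * t) * (norm z)\<^sup>2) \<partial>lborel)"
  have c: "c > 0" unfolding c_def using t by (intro integral_gaussian_pos) auto
  note MM = gauss_energy_eq_integral[OF \<mu> \<mu> t, folded c_def]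
  note MN = gauss_energy_eq_integral[OF \<mu> \<nu> t, folded c_def]
  note NN = gauss_energy_eq_integral[OF \<nu> \<nu> t, folded c_def]
  have sq: "(?m z - ?n z)\<^sup>2 = ?m z * ?m z - 2 * (?m z * ?n z) + ?n z * ?n z" for z
    by (simp add: power2_eq_square algebra_simps)
  have int: "integrable lborel (\<lambda>z. (?m z - ?n z)\<^sup>2)"
    unfolding sq by (intro Bochner_Integration.integrable_add Bochner_Integration.integrable_diff integrable_mult_right MM NN MN)
  have eq: "(\<integral>z. (?m z - ?n z)\<^sup>2 \<partial>lborel) = c * ?D"
    unfolding sq using MM MN NN by (simp add: algebra_simps)
  have "c * ?D \<ge> 0" unfolding eq[symmetric] by simp
  then show "?D \<ge> 0" using c by (simp add: zero_le_mult_iff)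
  assume "?D = 0"
  then have "(\<integral>z. (?m z - ?n z)\<^sup>2 \<partial>lborel) = 0" unfolding eq by simp
  then have "AE z in lborel. (?m z - ?n z)\<^sup>2 = 0"
    using integral_nonneg_eq_0_iff_AE[OF int] by simp
  then show "AE z in lborel. ?m z = ?n z" by simp
qed

text \<open>The indicator of an open set is the increasing limit of truncated multiples of the
  distance to the complement, and the open sets form a generator stable under intersection.\<close>

lemma prob_measure_eqI_continuous:
  fixes \<mu> \<nu> :: "'a::euclidean_space measure"
  assumes \<mu>: "prob_space \<mu>" "sets \<mu> = sets borel" and \<nu>: "prob_space \<nu>" "sets \<nu> = sets borel"
    and eq: "\<And>f :: 'a \<Rightarrow> real. continuous_on UNIV f \<Longrightarrow> (\<And>x. 0 \<le> f x \<and> f x \<le> 1) \<Longrightarrow> (\<integral>x. f x \<partial>\<mu>) = (\<integral>x. f x \<partial>\<nu>)"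
  shows "\<mu> = \<nu>"
proof -
  interpret \<mu>: prob_space \<mu> by fact
  interpret \<nu>: prob_space \<nu> by fact
  note [measurable_cong] = \<mu>(2) \<nu>(2)
  have sp: "space \<mu> = UNIV" "space \<nu> = UNIV" using sets_eq_imp_space_eq[OF \<mu>(2)] sets_eq_imp_space_eq[OF \<nu>(2)] by auto
  have U: "measure \<mu> U = measure \<nu> U" if U: "open U" for U
  \<comment> \<open>The whole space is separate because \<open>infdist\<close> to the empty set is
    0.\<close>
  proof (cases "U = UNIV")
    case True
    then show ?thesis using \<mu>.prob_space \<nu>.prob_space sp by simp
  next
    case False
    then have ne: "- U \<noteq> {}" by auto
    have cl: "closed (- U)" using U by (simp add: closed_Compl)
    define f where "f n x = min 1 (real n * infdist x (- U))" for n :: nat and x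
    have cont: "continuous_on UNIV (f n)" for n
      unfolding f_def by (intro continuous_intros continuous_on_infdist)
    have f01: "0 \<le> f n x \<and> f n x \<le> 1" for n x by (auto simp: f_def infdist_nonneg)
    have lim: "(\<lambda>n. f n x) \<longlonglongrightarrow> indicator U x" for x
    proof (cases "x \<in> U")
      case True
      then have p: "infdist x (- U) > 0" using cl ne by (intro infdist_pos_not_in_closed) auto
      obtain N where N: "real N > 1 / infdist x (- U)" using reals_Archimedean2 by blast
      have "eventually (\<lambda>n. f n x = 1) sequentially"
        unfolding eventually_sequentially
      proof (intro exI[of _ N] allI impI)
        fix n assume "n \<ge> N"
        then have "real n > 1 / infdist x (- U)" using N by (meson less_le_trans of_nat_le_iff)
        then have "real n * infdist x (- U) > 1" using p by (simp add: pos_divide_less_eq)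
        then show "f n x = 1" by (simp add: f_def)
      qed
      then show ?thesis using True by (auto intro: tendsto_eventually)
    next
      case False
      then have "infdist x (- U) = 0" by (intro infdist_zero) auto
      then show ?thesis using False by (simp add: f_def)
    qed
    have [measurable]: "f n \<in> borel_measurable borel" for n
      using cont by (intro borel_measurable_continuous_onI)
    have [measurable]: "U \<in> sets borel" using U by simp
    have "(\<lambda>n. \<integral>x. f n x \<partial>\<mu>) \<longlonglongrightarrow> (\<integral>x. indicator U x \<partial>\<mu>)"
      by (rule integral_dominated_convergence[where w = "\<lambda>_. 1"]) (use lim f01 in auto)
    moreover have "(\<lambda>n. \<integral>x. f n x \<partial>\<nu>) \<longlonglongrightarrow> (\<integral>x. indicator U x \<partial>\<nu>)"
      by (rule integral_dominated_convergence[where w = "\<lambda>_. 1"]) (use lim f01 in auto)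
    moreover have "(\<integral>x. f n x \<partial>\<mu>) = (\<integral>x. f n x \<partial>\<nu>)" for n by (rule eq[OF cont f01])
    ultimately have "(\<integral>x. indicator U x \<partial>\<mu>) = (\<integral>x. indicator U x \<partial>\<nu> :: real)"
      using LIMSEQ_unique by simp
    then show ?thesis by (simp add: sp)
  qed
  show ?thesis
  proof (rule measure_eqI_generator_eq[where E = "{S. open S}" and \<Omega> = UNIV and A = "\<lambda>_. UNIV"])
    show "Int_stable {S :: 'a set. open S}" by (auto simp: Int_stable_def)
    show "emeasure \<mu> X = emeasure \<nu> X" if "X \<in> {S. open S}" for X
      using U that by (simp add: \<mu>.emeasure_eq_measure \<nu>.emeasure_eq_measure)
  qed (use \<mu> \<nu> sp in \<open>auto simp: borel_def\<close>)
qed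

text \<open>Approximate identity: testing a continuous function against the smoothed measure is, up
  to normalization, testing a Gaussian average of that function against the measure, and these
  averages converge pointwise as \<open>T n\<close> grows.\<close>

lemma gauss_smooth_determines_measure:
  fixes \<mu> \<nu> :: "'a::euclidean_space measure"
  assumes \<mu>: "prob_space \<mu>" "sets \<mu> = sets borel" and \<nu>: "prob_space \<nu>" "sets \<nu> = sets borel"
    and T: "\<And>n. T n > 0" "filterlim T at_top sequentially"
    and eq: "\<And>n. AE z in lborel. gauss_smooth (T n) \<mu> z = gauss_smooth (T n) \<nu> z"
  shows "\<mu> = \<nu>"
proof (rule prob_measure_eqI_continuous[OF \<mu> \<nu>])
  fix f :: "'a \<Rightarrow> real"
  assume cont: "continuous_on UNIV f" and f01: "\<And>x. 0 \<le> f x \<and> f x \<le> 1"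
  have [measurable]: "f \<in> borel_measurable borel" using cont by (rule borel_measurable_continuous_onI)
  \<comment> \<open>This width turns
    \<open>exp (- 2 * T n * (norm (h n *\<^sub>R w))\<^sup>2)\<close> into the fixed Gaussian
    \<open>exp (- (norm w)\<^sup>2)\<close>.\<close>
  define h where "h n = 1 / sqrt (2 * T n)" for n
  have h: "h n > 0" "(h n)\<^sup>2 = 1 / (2 * T n)" for n using T(1)[of n] by (auto simp: h_def power_divide)
  have hlim: "h \<longlonglongrightarrow> 0"
  proof -
    have "filterlim (\<lambda>n. sqrt (2 * T n)) at_top sequentially"
      by (rule filterlim_compose[OF sqrt_at_top], rule filterlim_tendsto_pos_mult_at_top[OF tendsto_const _ T(2)]) simp
    from tendsto_inverse_0_at_top[OF this] show ?thesis unfolding h_def by (simp add: inverse_eq_divide)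
  qed
  define g where "g w = exp (- 1 * (norm w)\<^sup>2)" for w :: 'a
  have g_int: "integrable lborel g" unfolding g_def by (rule integrable_gaussian) simp
  have g0: "g w \<ge> 0" for w by (simp add: g_def)
  have [measurable]: "g \<in> borel_measurable borel" unfolding g_def[abs_def] by measurable
  have smooth: "(\<integral>z. f z * gauss_smooth (T n) \<rho> z \<partial>lborel) = h n ^ DIM('a) * (\<integral>x. (\<integral>w. f (x + h n *\<^sub>R w) * g w \<partial>lborel) \<partial>\<rho>)"
    if \<rho>: "prob_space \<rho>" "sets \<rho> = sets borel" for \<rho> n
  proof -
    interpret \<rho>: prob_space \<rho> by fact
    note [measurable_cong] = \<rho>(2)
    interpret L: pair_sigma_finite \<rho> "lborel :: 'a measure" ..
    have sub: "(\<integral>z. F z \<partial>lborel) = h n ^ DIM('a) * (\<integral>w. F (x + h n *\<^sub>R w) \<partial>lborel)"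
      if [measurable]: "F \<in> borel_measurable borel" for F :: "'a \<Rightarrow> real" and x
    proof -
      have "(\<integral>z. F z \<partial>lborel) = (\<integral>z. F z \<partial>density (distr lborel borel (\<lambda>w. x + h n *\<^sub>R w)) (\<lambda>_. ennreal (\<bar>h n\<bar> ^ DIM('a))))"
        using lborel_affine[of "h n" x] h(1)[of n] by (simp add: ennreal_power)
      also have "\<dots> = h n ^ DIM('a) * (\<integral>w. F (x + h n *\<^sub>R w) \<partial>lborel)"
        using h(1)[of n] by (subst integral_density) (auto simp: integral_distr)
      finally show ?thesis .
    qed
    have gs: "exp (- 2 * T n * (norm (x - (x + h n *\<^sub>R w)))\<^sup>2) = g w" for x w :: 'a
      using h[of n] T(1)[of n] by (simp add: g_def power_mult_distrib)
    have inner: "(\<integral>z. f z * exp (- 2 * T n * (norm (x - z))\<^sup>2) \<partial>lborel) = h n ^ DIM('a) * (\<integral>w. f (x + h n *\<^sub>R w) * g w \<partial>lborel)" for x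
      using sub[of "\<lambda>z. f z * exp (- 2 * T n * (norm (x - z))\<^sup>2)" x] unfolding gs by simp
    have ginx: "integrable lborel (\<lambda>z::'a. exp (- 2 * T n * (norm (x - z))\<^sup>2))" 
      and gval: "(\<integral>(z::'a). exp (- 2 * T n * (norm (x - z))\<^sup>2) \<partial>lborel) = h n ^ DIM('a) * (\<integral>w. g w \<partial>lborel)" for x
    proof -
      have "(\<integral>\<^sup>+(z::'a). ennreal (exp (- 2 * T n * (norm (x - z))\<^sup>2)) \<partial>lborel) = (\<integral>\<^sup>+(z::'a). ennreal (exp (- 2 * T n * (norm (x - (x + z)))\<^sup>2)) \<partial>lborel)"
        by (rule nn_integral_lborel_translate[symmetric]) measurable
      also have "\<dots> < \<infinity>"
        using integrable_gaussian[of "2 * T n", where 'a = 'a] T(1)[of n] by (simp add: integrable_iff_bounded)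
      finally show "integrable lborel (\<lambda>z::'a. exp (- 2 * T n * (norm (x - z))\<^sup>2))"
        by (simp add: integrable_iff_bounded)
      show "(\<integral>(z::'a). exp (- 2 * T n * (norm (x - z))\<^sup>2) \<partial>lborel) = h n ^ DIM('a) * (\<integral>w. g w \<partial>lborel)"
        using sub[of "\<lambda>z. exp (- 2 * T n * (norm (x - z))\<^sup>2)" x] unfolding gs by simp
    qed
    have int: "integrable (\<rho> \<Otimes>\<^sub>M lborel) (\<lambda>(x, z). f z * exp (- 2 * T n * (norm (x - z))\<^sup>2))"
    proof (rule Bochner_Integration.integrable_bound)
      show "integrable (\<rho> \<Otimes>\<^sub>M lborel) (\<lambda>(x, z). exp (- 2 * T n * (norm (x - z))\<^sup>2))"
        by (rule L.Fubini_integrable) (use ginx gval in \<open>auto simp: case_prod_unfold\<close>)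
      show "AE w in \<rho> \<Otimes>\<^sub>M lborel. norm (case w of (x, z) \<Rightarrow> f z * exp (- 2 * T n * (norm (x - z))\<^sup>2))
          \<le> norm (case w of (x, z) \<Rightarrow> exp (- 2 * T n * (norm (x - z))\<^sup>2))"
        using f01 by (auto simp: abs_mult intro!: mult_left_le_one_le AE_I2)
    qed measurable
    have "(\<integral>z. f z * gauss_smooth (T n) \<rho> z \<partial>lborel) = (\<integral>z. (\<integral>x. f z * exp (- 2 * T n * (norm (x - z))\<^sup>2) \<partial>\<rho>) \<partial>lborel)"
      by (simp add: gauss_smooth_def)
    also have "\<dots> = (\<integral>x. (\<integral>z. f z * exp (- 2 * T n * (norm (x - z))\<^sup>2) \<partial>lborel) \<partial>\<rho>)"
      using int by (rule L.Fubini_integral)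
    finally show ?thesis unfolding inner by simp
  qed
  define I where "I \<rho> n = (\<integral>x. (\<integral>w. f (x + h n *\<^sub>R w) * g w \<partial>lborel) \<partial>\<rho>)" for \<rho> n
  have I_eq: "I \<mu> n = I \<nu> n" for n
  proof -
    interpret \<mu>: prob_space \<mu> by fact
    interpret \<nu>: prob_space \<nu> by fact
    note [measurable_cong] = \<mu>(2) \<nu>(2)
    have [measurable]: "gauss_smooth (T n) \<mu> \<in> borel_measurable borel" "gauss_smooth (T n) \<nu> \<in> borel_measurable borel"
      unfolding gauss_smooth_def[abs_def] by measurable
    have "(\<integral>z. f z * gauss_smooth (T n) \<mu> z \<partial>lborel) = (\<integral>z. f z * gauss_smooth (T n) \<nu> z \<partial>lborel)"
      using eq[of n] by (intro integral_cong_AE) (auto elim: eventually_mono)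
    then show ?thesis
      unfolding smooth[OF \<mu>] smooth[OF \<nu>] I_def[symmetric] using h(1)[of n] by simp
  qed
  have I_lim: "I \<rho> \<longlonglongrightarrow> (\<integral>x. f x * (\<integral>w. g w \<partial>lborel) \<partial>\<rho>)" if \<rho>: "prob_space \<rho>" "sets \<rho> = sets borel" for \<rho>
  proof -
    interpret \<rho>: prob_space \<rho> by fact
    note [measurable_cong] = \<rho>(2)
    have le: "\<bar>f x * g w\<bar> \<le> g w" for x w
      using f01[of x] g0[of w] by (auto simp: abs_mult intro!: mult_left_le_one_le)
    have intg: "integrable lborel (\<lambda>w. f (x + h n *\<^sub>R w) * g w)" for x n
      by (rule Bochner_Integration.integrable_bound[OF g_int]) (use le g0 in auto)
    show ?thesis unfolding I_def
    proof (rule integral_dominated_convergence[where w = "\<lambda>_. \<integral>w. g w \<partial>lborel"])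
      show "AE x in \<rho>. (\<lambda>n. \<integral>w. f (x + h n *\<^sub>R w) * g w \<partial>lborel) \<longlonglongrightarrow> f x * (\<integral>w. g w \<partial>lborel)"
      proof (rule AE_I2)
        fix x
        have "(\<lambda>n. \<integral>w. f (x + h n *\<^sub>R w) * g w \<partial>lborel) \<longlonglongrightarrow> (\<integral>w. f x * g w \<partial>lborel)"
        proof (rule integral_dominated_convergence[OF _ _ g_int])
          show "AE w in lborel. (\<lambda>n. f (x + h n *\<^sub>R w) * g w) \<longlonglongrightarrow> f x * g w"
          proof (rule AE_I2)
            fix w
            have "(\<lambda>n. x + h n *\<^sub>R w) \<longlonglongrightarrow> x + 0 *\<^sub>R w" by (intro tendsto_intros hlim)
            then have "(\<lambda>n. f (x + h n *\<^sub>R w)) \<longlonglongrightarrow> f x"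
              using cont by (intro continuous_on_tendsto_compose[OF cont]) auto
            then show "(\<lambda>n. f (x + h n *\<^sub>R w) * g w) \<longlonglongrightarrow> f x * g w" by (intro tendsto_intros)
          qed
        qed (use le in auto)
        then show "(\<lambda>n. \<integral>w. f (x + h n *\<^sub>R w) * g w \<partial>lborel) \<longlonglongrightarrow> f x * (\<integral>w. g w \<partial>lborel)" by simp
      qed
      show "AE x in \<rho>. norm (\<integral>w. f (x + h n *\<^sub>R w) * g w \<partial>lborel) \<le> (\<integral>w. g w \<partial>lborel)" for n
      proof (rule AE_I2)
        fix x
        show "norm (\<integral>w. f (x + h n *\<^sub>R w) * g w \<partial>lborel) \<le> (\<integral>w. g w \<partial>lborel)"
          by (rule order_trans[OF integral_norm_bound]) (use le intg g_int in \<open>auto intro!: integral_mono integrable_abs\<close>)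
      qed
    qed measurable
  qed
  have "(\<integral>x. f x * (\<integral>w. g w \<partial>lborel) \<partial>\<mu>) = (\<integral>x. f x * (\<integral>w. g w \<partial>lborel) \<partial>\<nu>)"
    using I_lim[OF \<mu>] I_lim[OF \<nu>] unfolding I_eq[abs_def] by (rule LIMSEQ_unique)
  moreover have "(\<integral>w. g w \<partial>lborel) > 0" unfolding g_def by (rule integral_gaussian_pos) simp
  ultimately show "(\<integral>x. f x \<partial>\<mu>) = (\<integral>x. f x \<partial>\<nu>)" by simp
qed

text \<open>The terms with \<open>exp (- t)\<close> and \<open>riesz_profile a 1\<close> cancel in
  the combination 1, -2, 1, so the form is an integral of Gaussian forms with the weight
  \<open>t powr (a - 1)\<close>, positive for \<open>t > 0\<close>.\<close>

lemma riesz_energy_pos_def: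
  fixes \<mu> \<nu> :: "'a::euclidean_space measure" and a :: real
  defines "E \<equiv> \<lambda>\<mu> \<nu> :: 'a measure. (\<integral>z. riesz_profile a ((norm (fst z - snd z))\<^sup>2) \<partial>(\<mu> \<Otimes>\<^sub>M \<nu>))"
  assumes \<mu>: "prob_space \<mu>" "sets \<mu> = sets borel" and \<nu>: "prob_space \<nu>" "sets \<nu> = sets borel" and a: "a > -1"
    and int: "integrable (\<mu> \<Otimes>\<^sub>M \<mu>) (\<lambda>z. riesz_profile a ((norm (fst z - snd z))\<^sup>2))"
      "integrable (\<mu> \<Otimes>\<^sub>M \<nu>) (\<lambda>z. riesz_profile a ((norm (fst z - snd z))\<^sup>2))"
      "integrable (\<nu> \<Otimes>\<^sub>M \<nu>) (\<lambda>z. riesz_profile a ((norm (fst z - snd z))\<^sup>2))"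
    and diag: "a < 0 \<or> (AE z in \<mu> \<Otimes>\<^sub>M \<mu>. fst z \<noteq> snd z)"
      "a < 0 \<or> (AE z in \<mu> \<Otimes>\<^sub>M \<nu>. fst z \<noteq> snd z)"
      "a < 0 \<or> (AE z in \<nu> \<Otimes>\<^sub>M \<nu>. fst z \<noteq> snd z)"
  shows "E \<mu> \<mu> - 2 * E \<mu> \<nu> + E \<nu> \<nu> \<ge> 0"
    and "E \<mu> \<mu> - 2 * E \<mu> \<nu> + E \<nu> \<nu> = 0 \<Longrightarrow> \<mu> = \<nu>"
proof -
  define D where "D t = gauss_energy \<mu> \<mu> t - 2 * gauss_energy \<mu> \<nu> t + gauss_energy \<nu> \<nu> t" for t
  define F where "F \<mu> \<nu> t = indicator {0..} t * (t powr (a - 1) * (gauss_energy \<mu> \<nu> t - exp (- t)))" for \<mu> \<nu> :: "'a measure" and t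
  note MM = riesz_energy_gauss_mix[OF \<mu> \<mu> a int(1) diag(1), folded F_def]
  note MN = riesz_energy_gauss_mix[OF \<mu> \<nu> a int(2) diag(2), folded F_def]
  note NN = riesz_energy_gauss_mix[OF \<nu> \<nu> a int(3) diag(3), folded F_def]
  have G: "Gamma (a + 1) > 0" using a by (intro Gamma_real_pos) auto
  have F: "F \<mu> \<mu> t - 2 * F \<mu> \<nu> t + F \<nu> \<nu> t = indicator {0..} t * (t powr (a - 1) * D t)" for t
    by (simp add: F_def D_def algebra_simps)
  have Fint: "integrable lborel (\<lambda>t. indicator {0..} t * (t powr (a - 1) * D t))"
    unfolding F[symmetric] using MM MN NN by (intro Bochner_Integration.integrable_add Bochner_Integration.integrable_diff integrable_mult_right)
  have eq: "(\<integral>t. indicator {0..} t * (t powr (a - 1) * D t) \<partial>lborel) = 2 * Gamma (a + 1) * (E \<mu> \<mu> - 2 * E \<mu> \<nu> + E \<nu> \<nu>)"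
    unfolding F[symmetric] E_def using MM MN NN by (simp add: algebra_simps)
  have nn: "indicator {0..} t * (t powr (a - 1) * D t) \<ge> 0" for t
    using gauss_energy_pos_def(1)[OF \<mu> \<nu>, of t] by (cases "t > 0"; cases "t = 0") (auto simp: D_def)
  have "2 * Gamma (a + 1) * (E \<mu> \<mu> - 2 * E \<mu> \<nu> + E \<nu> \<nu>) \<ge> 0"
    unfolding eq[symmetric] using nn by (intro integral_nonneg_AE) auto
  then show "E \<mu> \<mu> - 2 * E \<mu> \<nu> + E \<nu> \<nu> \<ge> 0" using G by (simp add: zero_le_mult_iff)
  assume "E \<mu> \<mu> - 2 * E \<mu> \<nu> + E \<nu> \<nu> = 0"
  then have "(\<integral>t. indicator {0..} t * (t powr (a - 1) * D t) \<partial>lborel) = 0" unfolding eq by simp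
  then have AE: "AE t in lborel. indicator {0..} t * (t powr (a - 1) * D t) = 0"
    using integral_nonneg_eq_0_iff_AE[OF Fint] nn by simp
  \<comment> \<open>The Gaussian form vanishes for almost every \<open>t > 0\<close>, so it has
    zeros in every interval of positive length, in particular arbitrarily large ones.\<close>
  have "\<exists>t. t > real n \<and> t > 0 \<and> D t = 0" for n
  proof (rule ccontr)
    assume neg: "\<not> (\<exists>t. t > real n \<and> t > 0 \<and> D t = 0)"
    have "AE t in lborel. t \<notin> {real n<..<real n + 1}"
      using AE
    proof eventually_elim
      case (elim t)
      show ?case
      proof
        assume t: "t \<in> {real n<..<real n + 1}"
        then have "t > 0" by (auto intro: le_less_trans[of 0 "real n"])
        then show False using elim neg t by auto
      qed
    qed
    then have "{real n<..<real n + 1} \<in> null_sets lborel" by (subst AE_iff_null_sets) auto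
    then show False by (simp add: null_sets_def)
  qed
  then obtain T where T: "\<And>n. T n > real n" "\<And>n. T n > 0" "\<And>n. D (T n) = 0" by metis
  show "\<mu> = \<nu>"
  proof (rule gauss_smooth_determines_measure[OF \<mu> \<nu> T(2)])
    show "filterlim T at_top sequentially"
      by (rule filterlim_at_top_mono[OF filterlim_real_sequentially]) (use T(1) in \<open>auto intro: always_eventually less_imp_le\<close>)
    show "AE z in lborel. gauss_smooth (T n) \<mu> z = gauss_smooth (T n) \<nu> z" for n
      using gauss_energy_pos_def(2)[OF \<mu> \<nu> T(2)] T(3)[of n] by (simp add: D_def)
  qed
qed

section \<open>Minimality of the sphere\<close>

lemma riesz_kernel_eq:
  assumes "x \<noteq> 0 \<or> s < 0"
  shows "riesz_kernel s x = ereal (riesz_profile (s / 2) ((norm x)\<^sup>2))"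
proof (cases "x = 0")
  case True
  then show ?thesis using assms by (simp add: riesz_kernel_def riesz_profile_def)
next
  case False
  have sq: "(norm x)\<^sup>2 = norm x powr 2" using False by (simp add: powr_numeral)
  have "(norm x)\<^sup>2 powr (- (s / 2)) = norm x powr (- s)"
    unfolding sq powr_powr by simp
  then show ?thesis using False
    by (cases "s = 0") (auto simp: riesz_kernel_def riesz_profile_def ln_realpow powr_minus_divide)
qed

text \<open>The profile may tend to minus infinity, but more slowly than any linear function since
  \<open>a > -1\<close>; a small part of a quadratic field absorbs it. The sum with
  \<open>\<delta> * q\<close> is smallest on the positive half-line at \<open>q0\<close>, where
  \<open>q0 powr (- a - 1) = 2 * \<delta>\<close>.\<close>

lemma riesz_profile_ge:
  assumes a: "a > -1" and \<delta>: "\<delta> > 0"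
  obtains C where "C \<ge> 0" "\<And>q. q \<ge> 0 \<Longrightarrow> riesz_profile a q \<ge> - \<delta> * q - C"
proof -
  define q0 where "q0 = (2 * \<delta>) powr (- 1 / (a + 1))"
  have q0: "q0 > 0" using \<delta> by (simp add: q0_def)
  have "q0 powr (- a - 1) = (2 * \<delta>) powr 1"
    unfolding q0_def powr_powr using a by (intro arg_cong[where f = "(powr) (2 * \<delta>)"]) (simp add: field_simps)
  then have q0': "q0 powr (- a - 1) = 2 * \<delta>" using \<delta> by simp
  define \<phi> where "\<phi> q = riesz_profile a q + \<delta> * q" for q
  have der: "(\<phi> has_real_derivative \<delta> - (1/2) * q powr (- a - 1)) (at q)" if "q > 0" for q
    unfolding \<phi>_def[abs_def] using riesz_profile_deriv[OF that, of a] by (auto intro!: derivative_eq_intros)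
  have ge: "\<phi> q \<ge> \<phi> q0" if q: "q > 0" for q
  proof (cases "q0 \<le> q")
    case True
    show ?thesis
    proof (rule DERIV_nonneg_imp_nondecreasing[OF True])
      fix x assume x: "q0 \<le> x"
      then have "x powr (- a - 1) \<le> q0 powr (- a - 1)" using a q0 by (intro powr_mono2') auto
      then show "\<exists>y. (\<phi> has_real_derivative y) (at x) \<and> 0 \<le> y"
        using der[of x] x q0 q0' by (intro exI[of _ "\<delta> - (1/2) * x powr (- a - 1)"]) auto
    qed
  next
    case False
    show ?thesis
    proof (rule DERIV_nonpos_imp_nonincreasing[of q q0])
      fix x assume x: "q \<le> x" "x \<le> q0"
      then have "x powr (- a - 1) \<ge> q0 powr (- a - 1)" using a q by (intro powr_mono2') auto
      then show "\<exists>y. (\<phi> has_real_derivative y) (at x) \<and> y \<le> 0"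
        using der[of x] x q q0' by (intro exI[of _ "\<delta> - (1/2) * x powr (- a - 1)"]) auto
    qed (use False in simp)
  qed
  show ?thesis
  proof (rule that[of "\<bar>\<phi> q0\<bar>"])
    show "riesz_profile a q \<ge> - \<delta> * q - \<bar>\<phi> q0\<bar>" if "q \<ge> 0" for q
    proof (cases "q = 0")
      case True
      then show ?thesis by (simp add: riesz_profile_def)
    next
      case False
      then have "\<phi> q \<ge> \<phi> q0" using that ge by simp
      then show ?thesis by (simp add: \<phi>_def)
    qed
  qed simp
qed

lemma ereal_integral_eq:
  assumes "AE z in M. f z = ereal (g z)" "integrable M g"
  shows "ereal_integral M f = ereal (\<integral>z. g z \<partial>M)"
proof -
  have fin: "(\<integral>\<^sup>+z. ennreal (g z) \<partial>M) < \<infinity>" "(\<integral>\<^sup>+z. ennreal (- g z) \<partial>M) < \<infinity>"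
    using integrableD[OF assms(2)] by (auto simp: less_top)
  have e: "enn2ereal x = ereal (enn2real x)" if "x < \<infinity>" for x
    using that by (cases x) (auto simp: less_top)
  have "(\<integral>\<^sup>+z. e2ennreal (f z) \<partial>M) = (\<integral>\<^sup>+z. ennreal (g z) \<partial>M)"
    using assms(1) by (intro nn_integral_cong_AE) (auto elim: eventually_mono)
  moreover have "(\<integral>\<^sup>+z. e2ennreal (- f z) \<partial>M) = (\<integral>\<^sup>+z. ennreal (- g z) \<partial>M)"
    using assms(1) by (intro nn_integral_cong_AE) (auto elim: eventually_mono)
  ultimately show ?thesis
    unfolding ereal_integral_def using fin real_lebesgue_integral_def[OF assms(2)] by (simp add: e)
qed

text \<open>On a probability space the lower bound makes the negative part finite, so a finite value
  forces the positive part to be finite too, and the integrand has a real integrable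
  representative.\<close>

lemma ereal_integral_less_top:
  assumes M: "prob_space M" and [measurable]: "f \<in> borel_measurable M"
    and bd: "\<And>z. f z \<ge> ereal (- B)" and fin: "ereal_integral M f < \<infinity>"
  obtains g where "integrable M g" "AE z in M. f z = ereal (g z)"
proof -
  interpret prob_space M by fact
  define g where "g z = real_of_ereal (f z)" for z
  have [measurable]: "g \<in> borel_measurable M" unfolding g_def[abs_def] by measurable
  have neg_le: "e2ennreal (- f z) \<le> ennreal B" for z
  proof -
    have "- f z \<le> ereal B" using bd[of z] by (cases "f z") auto
    then show ?thesis using e2ennreal_mono[of "- f z" "ereal B"] by simp
  qed
  have "(\<integral>\<^sup>+z. e2ennreal (- f z) \<partial>M) \<le> (\<integral>\<^sup>+z. ennreal B \<partial>M)"
    by (intro nn_integral_mono neg_le)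
  then have neg: "(\<integral>\<^sup>+z. e2ennreal (- f z) \<partial>M) < \<infinity>"
    by (simp add: emeasure_space_1 le_less_trans)
  have pos: "(\<integral>\<^sup>+z. e2ennreal (f z) \<partial>M) < \<infinity>"
  proof (rule ccontr)
    assume "\<not> (\<integral>\<^sup>+z. e2ennreal (f z) \<partial>M) < \<infinity>"
    then have "(\<integral>\<^sup>+z. e2ennreal (f z) \<partial>M) = \<infinity>"
      by (metis top.not_eq_extremum infinity_ennreal_def)
    then have "ereal_integral M f = \<infinity>" by (simp add: ereal_integral_def)
    then show False using fin by simp
  qed
  then have "AE z in M. e2ennreal (f z) \<noteq> \<infinity>" by (intro nn_integral_PInf_AE) auto
  then have eq: "AE z in M. f z = ereal (g z)"
  proof eventually_elim
    case (elim z)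
    then show ?case using bd[of z] by (cases "f z") (auto simp: g_def)
  qed
  have "integrable M g"
  proof (rule integrableI_bounded)
    have "(\<integral>\<^sup>+z. ennreal (norm (g z)) \<partial>M) = (\<integral>\<^sup>+z. e2ennreal (f z) + e2ennreal (- f z) \<partial>M)"
      using eq
    proof (intro nn_integral_cong_AE, eventually_elim)
      case (elim z)
      then show ?case by (cases "g z \<ge> 0") (auto simp: ennreal_neg)
    qed
    also have "\<dots> = (\<integral>\<^sup>+z. e2ennreal (f z) \<partial>M) + (\<integral>\<^sup>+z. e2ennreal (- f z) \<partial>M)"
      by (intro nn_integral_add) auto
    also have "\<dots> < \<infinity>" using pos neg by simp
    finally show "(\<integral>\<^sup>+z. ennreal (norm (g z)) \<partial>M) < \<infinity>" .
  qed simp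
  with eq show ?thesis using that by blast
qed

text \<open>By transitivity of the orthogonal group some orthogonal map carries the vector of the
  same norm on axis \<open>i\<close> to \<open>x\<close>; the uniform measure is invariant under
  it.\<close>

lemma sphere_uniform_inner:
  fixes F :: "real \<Rightarrow> real" and i :: "'n::finite" and x :: "real ^ 'n"
  assumes [measurable]: "F \<in> borel_measurable borel"
  shows "(\<integral>y. F (x \<bullet> y) \<partial>sphere_uniform 1) = (\<integral>y. F (norm x * y $ i) \<partial>sphere_uniform 1)"
    and "integrable (sphere_uniform 1) (\<lambda>y. F (x \<bullet> y)) \<longleftrightarrow> integrable (sphere_uniform 1) (\<lambda>y::real^'n. F (norm x * y $ i))"
proof -
  have "norm (norm x *\<^sub>R axis i (1::real)) = norm x" by simp
  then obtain T :: "real ^ 'n \<Rightarrow> real ^ 'n" where T: "orthogonal_transformation T" "T (norm x *\<^sub>R axis i 1) = x"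
    by (rule orthogonal_transformation_exists) (erule that)
  have [measurable]: "T \<in> borel_measurable borel" by (rule borel_measurable_orthogonal_transformation[OF T(1)])
  have xT: "x \<bullet> T y = norm x * y $ i" for y
  proof -
    have "x \<bullet> T y = T (norm x *\<^sub>R axis i 1) \<bullet> T y" by (simp only: T(2))
    also have "\<dots> = (norm x *\<^sub>R axis i 1) \<bullet> y" using T(1) by (simp add: orthogonal_transformation_def)
    also have "\<dots> = norm x * y $ i" by (simp add: inner_axis' )
    finally show ?thesis .
  qed
  have [measurable]: "(\<lambda>y. F (x \<bullet> y)) \<in> borel_measurable borel" by measurable
  have "(\<integral>y. F (x \<bullet> y) \<partial>distr (sphere_uniform 1) borel T) = (\<integral>y. F (norm x * y $ i) \<partial>sphere_uniform 1)"
    by (subst integral_distr) (auto simp: xT)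
  then show "(\<integral>y. F (x \<bullet> y) \<partial>sphere_uniform 1) = (\<integral>y. F (norm x * y $ i) \<partial>sphere_uniform 1)"
    by (simp add: sphere_uniform_orthogonal[OF T(1)])
  have "integrable (distr (sphere_uniform 1) borel T) (\<lambda>y. F (x \<bullet> y)) \<longleftrightarrow> integrable (sphere_uniform 1) (\<lambda>y::real^'n. F (norm x * y $ i))"
    by (subst integrable_distr_eq) (auto simp: xT)
  then show "integrable (sphere_uniform 1) (\<lambda>y. F (x \<bullet> y)) \<longleftrightarrow> integrable (sphere_uniform 1) (\<lambda>y::real^'n. F (norm x * y $ i))"
    by (simp add: sphere_uniform_orthogonal[OF T(1)])
qed

lemma sphere_uniform_radial:
  fixes f :: "real \<Rightarrow> real" and i :: "'n::finite" and x :: "real ^ 'n"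
  assumes [measurable]: "f \<in> borel_measurable borel"
  shows "(\<integral>y. f ((norm (x - y))\<^sup>2) \<partial>sphere_uniform R) = sphere_mean i R f (norm x)"
    and "integrable (sphere_uniform R) (\<lambda>y. f ((norm (x - y))\<^sup>2))
      \<longleftrightarrow> integrable (sphere_uniform 1) (\<lambda>y::real^'n. f (sq_dist R (norm x) (y $ i)))"
proof -
  let ?S = "sphere_uniform 1 :: (real ^ 'n) measure"
  define F where "F \<tau> = f ((norm x)\<^sup>2 + R\<^sup>2 - 2 * R * \<tau>)" for \<tau>
  have [measurable]: "F \<in> borel_measurable borel" unfolding F_def[abs_def] by measurable
  have ae: "AE y in ?S. f ((norm (x - R *\<^sub>R y))\<^sup>2) = F (x \<bullet> y)"
    using AE_sphere_uniform_1_norm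
  proof eventually_elim
    case (elim y)
    have "(norm (x - R *\<^sub>R y))\<^sup>2 = (norm x)\<^sup>2 + R\<^sup>2 * (norm y)\<^sup>2 - 2 * R * (x \<bullet> y)"
      unfolding power2_norm_eq_inner by (simp add: inner_diff inner_commute algebra_simps power2_eq_square)
    then show ?case using elim by (simp add: F_def)
  qed
  have F2: "F (norm x * \<tau>) = f (sq_dist R (norm x) \<tau>)" for \<tau>
    by (simp add: F_def sq_dist_def mult_ac)
  have "(\<integral>y. f ((norm (x - y))\<^sup>2) \<partial>sphere_uniform R) = (\<integral>y. f ((norm (x - R *\<^sub>R y))\<^sup>2) \<partial>?S)"
    unfolding sphere_uniform_eq_distr[of R] by (subst integral_distr) auto
  also have "\<dots> = (\<integral>y. F (x \<bullet> y) \<partial>?S)"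
    by (intro integral_cong_AE ae) measurable
  also have "\<dots> = sphere_mean i R f (norm x)"
    unfolding sphere_mean_def F2[symmetric] by (rule sphere_uniform_inner) measurable
  finally show "(\<integral>y. f ((norm (x - y))\<^sup>2) \<partial>sphere_uniform R) = sphere_mean i R f (norm x)" .
  have "integrable (sphere_uniform R) (\<lambda>y. f ((norm (x - y))\<^sup>2)) \<longleftrightarrow> integrable ?S (\<lambda>y. f ((norm (x - R *\<^sub>R y))\<^sup>2))"
    unfolding sphere_uniform_eq_distr[of R] by (subst integrable_distr_eq) auto
  also have "\<dots> \<longleftrightarrow> integrable ?S (\<lambda>y. F (x \<bullet> y))"
    by (intro integrable_cong_AE ae) measurable
  also have "\<dots> \<longleftrightarrow> integrable ?S (\<lambda>y::real^'n. f (sq_dist R (norm x) (y $ i)))"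
    unfolding F2[symmetric] by (rule sphere_uniform_inner) measurable
  finally show "integrable (sphere_uniform R) (\<lambda>y. f ((norm (x - y))\<^sup>2)) \<longleftrightarrow> integrable ?S (\<lambda>y::real^'n. f (sq_dist R (norm x) (y $ i)))" .
qed

lemma norm_diff_sq_le: "(norm (x - y :: 'a::real_inner))\<^sup>2 \<le> 2 * (norm x)\<^sup>2 + 2 * (norm y)\<^sup>2"
proof -
  have "(norm (x - y))\<^sup>2 + (norm (x + y))\<^sup>2 = 2 * (norm x)\<^sup>2 + 2 * (norm y)\<^sup>2"
    by (simp add: power2_norm_eq_inner inner_diff inner_add inner_commute)
  then show ?thesis using zero_le_power2[of "norm (x + y)"] by linarith
qed

lemma AE_sphere_uniform_neq:
  fixes x :: "real ^ 'n::finite"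
  assumes "CARD('n) \<ge> 2" "R > 0"
  shows "AE y in sphere_uniform R. x \<noteq> y"
proof -
  have d: "DIM(real ^ 'n) \<ge> 2" using assms by simp
  have "AE y in (sphere_uniform 1 :: (real ^ 'n) measure). x \<noteq> R *\<^sub>R y"
    using AE_sphere_uniform_1_neq[OF d, of "inverse R *\<^sub>R x"]
    by eventually_elim (use assms in auto)
  then show ?thesis
    unfolding sphere_uniform_eq_distr[of R] by (subst AE_distr_iff) auto
qed

text \<open>
  \<open>\<nu>\<close> need not have finite energy here: the potential of the sphere is bounded above.
\<close>

lemma riesz_energy_sphere_uniform:
  fixes \<nu> :: "(real ^ 'n::finite) measure" and s R :: real and i :: 'n
  assumes s: "-2 < s" "s \<le> real CARD('n) - 4" and R: "R > 0"
    and \<nu>: "prob_space \<nu>" "sets \<nu> = sets borel" and mom: "integrable \<nu> (\<lambda>x. (norm x)\<^sup>2)"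
  defines "k \<equiv> \<lambda>z. riesz_profile (s / 2) ((norm (fst z - snd z :: real ^ 'n))\<^sup>2)"
  shows "integrable (\<nu> \<Otimes>\<^sub>M sphere_uniform R) k"
    and "integrable \<nu> (\<lambda>x. sphere_mean i R (riesz_profile (s / 2)) (norm x))"
    and "(\<integral>z. k z \<partial>(\<nu> \<Otimes>\<^sub>M sphere_uniform R)) = (\<integral>x. sphere_mean i R (riesz_profile (s / 2)) (norm x) \<partial>\<nu>)"
    and "AE z in \<nu> \<Otimes>\<^sub>M sphere_uniform R. fst z \<noteq> snd z"
proof -
  let ?S = "sphere_uniform R :: (real ^ 'n) measure"
  interpret \<nu>: prob_space \<nu> by fact
  interpret S: prob_space ?S by (rule prob_space_sphere_uniform)
  note [measurable_cong] = \<nu>(2)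
  interpret pair_prob_space \<nu> ?S ..
  have d2: "CARD('n) \<ge> 2" using s by linarith
  obtain C where C: "C \<ge> 0" "\<And>q. q \<ge> 0 \<Longrightarrow> riesz_profile (s / 2) q \<ge> - 1 * q - C"
    using riesz_profile_ge[of "s / 2" 1] s by auto
  have [measurable]: "k \<in> borel_measurable (\<nu> \<Otimes>\<^sub>M ?S)" unfolding k_def by measurable
  define U where "U x = sphere_mean i R (riesz_profile (s / 2)) (norm x)" for x :: "real ^ 'n"
  have int_x: "integrable ?S (\<lambda>y. riesz_profile (s / 2) ((norm (x - y))\<^sup>2))" for x
    by (subst sphere_uniform_radial(2)[where i = i]) (use integrable_sphere_potential[OF s R] in auto)
  have val_x: "(\<integral>y. riesz_profile (s / 2) ((norm (x - y))\<^sup>2) \<partial>?S) = U x" for x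
    unfolding U_def by (rule sphere_uniform_radial) measurable
  have U_le: "U x \<le> riesz_profile (s / 2) (R\<^sup>2)" for x
    unfolding U_def by (rule sphere_potential_le[OF s R]) simp
  \<comment> \<open>If \<open>k \<ge> - X\<close> with \<open>X \<ge> 0\<close>, then
    \<open>\<bar>k\<bar> \<le> k + 2 * X\<close>. So the norm is controlled by the potential,
    bounded above by its value at the center, and by the second moment.\<close>
  have norm_le: "(\<integral>y. norm (k (x, y)) \<partial>?S) \<le> riesz_profile (s / 2) (R\<^sup>2) + 2 * (2 * (norm x)\<^sup>2 + 2 * R\<^sup>2 + C)" for x
  proof -
    have "(\<integral>y. norm (k (x, y)) \<partial>?S) \<le> (\<integral>y. riesz_profile (s / 2) ((norm (x - y))\<^sup>2) + 2 * (2 * (norm x)\<^sup>2 + 2 * R\<^sup>2 + C) \<partial>?S)"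
    proof (rule integral_mono_AE)
      show "integrable ?S (\<lambda>y. norm (k (x, y)))" using int_x unfolding k_def by simp
      show "integrable ?S (\<lambda>y. riesz_profile (s / 2) ((norm (x - y))\<^sup>2) + 2 * (2 * (norm x)\<^sup>2 + 2 * R\<^sup>2 + C))"
        using int_x by simp
      show "AE y in ?S. norm (k (x, y)) \<le> riesz_profile (s / 2) ((norm (x - y))\<^sup>2) + 2 * (2 * (norm x)\<^sup>2 + 2 * R\<^sup>2 + C)"
        using AE_sphere_uniform[OF R]
      proof eventually_elim
        case (elim y)
        then have "norm y = R" by simp
        then have "(norm (x - y))\<^sup>2 \<le> 2 * (norm x)\<^sup>2 + 2 * R\<^sup>2" using norm_diff_sq_le[of x y] by simp
        moreover have "riesz_profile (s / 2) ((norm (x - y))\<^sup>2) \<ge> - (norm (x - y))\<^sup>2 - C" using C(2)[of "(norm (x - y))\<^sup>2"] by simp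
        ultimately show ?case using C(1) unfolding k_def real_norm_def fst_conv snd_conv by (simp add: abs_le_iff)
      qed
    qed
    also have "\<dots> = U x + 2 * (2 * (norm x)\<^sup>2 + 2 * R\<^sup>2 + C)"
      using int_x val_x S.prob_space by (subst Bochner_Integration.integral_add) auto
    finally show ?thesis using U_le[of x] by linarith
  qed
  show int: "integrable (\<nu> \<Otimes>\<^sub>M ?S) k"
  proof (rule Fubini_integrable)
    show "integrable \<nu> (\<lambda>x. \<integral>y. norm (k (x, y)) \<partial>?S)"
    proof (rule Bochner_Integration.integrable_bound)
      show "integrable \<nu> (\<lambda>x. riesz_profile (s / 2) (R\<^sup>2) + 2 * (2 * (norm x)\<^sup>2 + 2 * R\<^sup>2 + C))"
        using mom by simp
      show "AE x in \<nu>. norm (\<integral>y. norm (k (x, y)) \<partial>?S) \<le> norm (riesz_profile (s / 2) (R\<^sup>2) + 2 * (2 * (norm x)\<^sup>2 + 2 * R\<^sup>2 + C))"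
      proof (rule AE_I2)
        fix x
        have "0 \<le> (\<integral>y. norm (k (x, y)) \<partial>?S)" by simp
        then show "norm (\<integral>y. norm (k (x, y)) \<partial>?S) \<le> norm (riesz_profile (s / 2) (R\<^sup>2) + 2 * (2 * (norm x)\<^sup>2 + 2 * R\<^sup>2 + C))"
          using norm_le[of x] unfolding real_norm_def by linarith
      qed
    qed measurable
    show "AE x in \<nu>. integrable ?S (\<lambda>y. k (x, y))" using int_x unfolding k_def by simp
  qed measurable
  then have int': "integrable (\<nu> \<Otimes>\<^sub>M ?S) (case_prod (\<lambda>x y. k (x, y)))" by simp
  have inner: "(\<integral>y. k (x, y) \<partial>?S) = sphere_mean i R (riesz_profile (s / 2)) (norm x)" for x
    using val_x unfolding k_def U_def by simp
  show "integrable \<nu> (\<lambda>x. sphere_mean i R (riesz_profile (s / 2)) (norm x))"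
    using integrable_fst[OF int'] unfolding inner .
  show "(\<integral>z. k z \<partial>(\<nu> \<Otimes>\<^sub>M ?S)) = (\<integral>x. sphere_mean i R (riesz_profile (s / 2)) (norm x) \<partial>\<nu>)"
    using integral_fst[OF int'] unfolding inner by simp
  have "AE x in \<nu>. AE y in ?S. norm (fst (x, y) - snd (x, y)) \<noteq> 0"
    using AE_sphere_uniform_neq[OF d2 R] by simp
  then have "AE z in \<nu> \<Otimes>\<^sub>M ?S. norm (fst z - snd z) \<noteq> 0"
    by (intro AE_pair_measure) measurable
  then show "AE z in \<nu> \<Otimes>\<^sub>M ?S. fst z \<noteq> snd z" by simp
qed


lemma borel_measurable_riesz_kernel [measurable]: "riesz_kernel s \<in> borel_measurable borel"
  unfolding riesz_kernel_def[abs_def] by measurable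

text \<open>Equality off the diagonal; on the diagonal with \<open>s \<ge> 0\<close> the kernel is
  infinite while the profile takes its default value.\<close>

lemma riesz_kernel_ge: "riesz_kernel s x \<ge> ereal (riesz_profile (s / 2) ((norm x)\<^sup>2))"
proof (cases "x \<noteq> 0 \<or> s < 0")
  case True
  then show ?thesis by (simp add: riesz_kernel_eq)
qed (simp add: riesz_kernel_def)

theorem theorem1p4:
  fixes s R :: real and v :: "real \<Rightarrow> ereal"
  assumes d_ge_2: "CARD('d::finite) \<ge> 2"
    and v_lsc: "lsc_on {0..} v"
    and v_bounded_below: "\<exists>m::real. \<forall>r\<ge>0. ereal m \<le> v r"
    and v_finite: "\<exists>a b. 0 \<le> a \<and> a < b \<and> (\<forall>r\<in>{a<..<b}. v r < \<infinity>)"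
    and s_gt: "-2 < s"
    and s_le: "s \<le> real CARD('d) - 4"
    and v_C2: "Ck_ext_on 2 {0..} v"
    and v_convex: "\<forall>r\<in>{0..}. (ext_deriv {0..} ^^ 2) v r \<ge> 0"
    and R_pos: "R > 0"
    and R_eq: "ereal (R powr (s + 2)) * ext_deriv {0..} v (R\<^sup>2) = ereal (c_const s CARD('d) / 4)"
  shows "is_equilibrium_measure s (radial_field v) (sphere_uniform R :: (real ^ 'd) measure)"
proof -
  let ?S = "sphere_uniform R :: (real ^ 'd) measure"
  interpret S: prob_space ?S by (rule prob_space_sphere_uniform)
  define i :: 'd where "i = undefined"
  define a where "a = s / 2"
  have a: "a > -1" using s_gt by (simp add: a_def)
  define \<gamma> where "\<gamma> = c_const s CARD('d) / (4 * R powr (s + 2))"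
  have \<gamma>: "\<gamma> > 0" using c_const_pos[OF s_gt s_le] R_pos by (simp add: \<gamma>_def)
  have slope: "ext_deriv {0..} v (R\<^sup>2) = ereal \<gamma>"
  proof (cases "ext_deriv {0..} v (R\<^sup>2)")
    case (real r)
    then have "R powr (s + 2) * r = c_const s CARD('d) / 4" using R_eq by simp
    then show ?thesis using real R_pos by (simp add: \<gamma>_def field_simps)
  qed (use R_eq R_pos in auto)
  obtain w where w: "v (R\<^sup>2) = ereal w" "\<And>r. r \<ge> 0 \<Longrightarrow> v r \<ge> ereal (w + \<gamma> * (r - R\<^sup>2))"
    using Ck_ext_on_2_affine_minorant[OF v_C2 v_convex _ slope] R_pos by auto
  define V :: "real ^ 'd \<Rightarrow> ereal" where "V = radial_field v"
  define V0 :: "real ^ 'd \<Rightarrow> real" where "V0 x = w + \<gamma> * ((norm x)\<^sup>2 - R\<^sup>2)" for x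
  have V_ge: "V x \<ge> ereal (V0 x)" for x
    unfolding V_def V0_def radial_field_def using w(2)[of "(norm x)\<^sup>2"] by simp
  have V_meas [measurable]: "V \<in> borel_measurable borel"
    unfolding V_def by (rule borel_measurable_radial_field[OF v_C2 v_convex])
  have [measurable]: "V0 \<in> borel_measurable borel" unfolding V0_def[abs_def] by measurable
  define k where "k z = riesz_profile a ((norm (fst z - snd z :: real ^ 'd))\<^sup>2)" for z
  define K where "K z = (case z of (x, y) \<Rightarrow> riesz_kernel s (x - y) + V x + V y)" for z
  have J: "riesz_energy s V \<nu> = ereal_integral (\<nu> \<Otimes>\<^sub>M \<nu>) K" for \<nu>
    by (simp add: riesz_energy_def K_def[abs_def])
  \<comment> \<open>With \<open>(norm (x - y))\<^sup>2 \<le> 2 * (norm x)\<^sup>2 + 2 * (norm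
    y)\<^sup>2\<close>, the choice \<open>\<gamma> / 4\<close> lets the kernel use up at most half
    of the quadratic field; the other half controls the second moment.\<close>
  obtain C where C: "C \<ge> 0" "\<And>q. q \<ge> 0 \<Longrightarrow> riesz_profile a q \<ge> - (\<gamma> / 4) * q - C"
    using riesz_profile_ge[OF a, of "\<gamma> / 4"] \<gamma> by auto
  have k_ge: "k z \<ge> - (\<gamma> / 2) * ((norm (fst z))\<^sup>2 + (norm (snd z))\<^sup>2) - C" for z
  proof -
    have "\<gamma> / 4 * (norm (fst z - snd z))\<^sup>2 \<le> \<gamma> / 4 * (2 * (norm (fst z))\<^sup>2 + 2 * (norm (snd z))\<^sup>2)"
      using norm_diff_sq_le \<gamma> by (intro mult_left_mono) auto
    then show ?thesis using C(2)[of "(norm (fst z - snd z))\<^sup>2"] by (simp add: k_def algebra_simps)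
  qed
  define B where "B = C + 2 * \<bar>w - \<gamma> * R\<^sup>2\<bar>"
  have V0_eq: "V0 x = (w - \<gamma> * R\<^sup>2) + \<gamma> * (norm x)\<^sup>2" for x by (simp add: V0_def algebra_simps)
  have low: "k z + V0 (fst z) + V0 (snd z) \<ge> (\<gamma> / 2) * ((norm (fst z))\<^sup>2 + (norm (snd z))\<^sup>2) - B" for z
    using k_ge[of z] unfolding V0_eq B_def by (simp add: algebra_simps abs_if split: if_splits)
  have K_ge: "K z \<ge> ereal (k z + V0 (fst z) + V0 (snd z))" for z
  proof -
    have "ereal (k z) + ereal (V0 (fst z)) + ereal (V0 (snd z)) \<le> riesz_kernel s (fst z - snd z) + V (fst z) + V (snd z)"
      unfolding k_def a_def by (intro add_mono V_ge riesz_kernel_ge)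
    then show ?thesis by (simp add: K_def case_prod_unfold)
  qed
  have K_ge_B: "K z \<ge> ereal (- B)" for z
  proof (rule order_trans[OF _ K_ge])
    have "(\<gamma> / 2) * ((norm (fst z))\<^sup>2 + (norm (snd z))\<^sup>2) \<ge> 0" using \<gamma> by simp
    then show "ereal (- B) \<le> ereal (k z + V0 (fst z) + V0 (snd z))" using low[of z] by simp
  qed
  \<comment> \<open>The minorant touches the field on the sphere, so replacing \<open>V\<close> by
    \<open>V0\<close> leaves the energy of the sphere unchanged while lowering that of every
    competitor.\<close>
  have V_sphere: "AE x in ?S. V x = ereal w \<and> V0 x = w \<and> norm x = R"
    using AE_sphere_uniform[OF R_pos] by eventually_elim (simp add: V_def radial_field_def w(1) V0_def)
  define U where "U r = sphere_mean i R (riesz_profile a) r" for r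
  have EL: "U (norm x) + V0 x \<ge> U R + w" for x
    using sphere_potential_Euler_Lagrange[OF s_gt s_le R_pos, of "norm x" i]
    unfolding U_def a_def V0_def \<gamma>_def by simp
  have momS: "integrable ?S (\<lambda>x. (norm x)\<^sup>2)"
    by (rule S.integrable_const_bound[where B = "R\<^sup>2"]) (use V_sphere in \<open>auto elim: eventually_mono\<close>)
  note SS1 = riesz_energy_sphere_uniform(1)[OF s_gt s_le R_pos prob_space_sphere_uniform sets_sphere_uniform momS, folded a_def, folded k_def]
  note SS2 = riesz_energy_sphere_uniform(2)[OF s_gt s_le R_pos prob_space_sphere_uniform sets_sphere_uniform momS, of i, folded a_def, folded U_def]
  note SS3 = riesz_energy_sphere_uniform(3)[OF s_gt s_le R_pos prob_space_sphere_uniform sets_sphere_uniform momS, of i, folded a_def, folded k_def U_def]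
  note SS4 = riesz_energy_sphere_uniform(4)[OF s_gt s_le R_pos prob_space_sphere_uniform sets_sphere_uniform momS]
  have ESS: "(\<integral>z. k z \<partial>(?S \<Otimes>\<^sub>M ?S)) = U R"
  proof -
    have "(\<integral>x. U (norm x) \<partial>?S) = (\<integral>x. U R \<partial>?S)"
      by (rule integral_cong_AE) (use SS2 V_sphere in \<open>auto elim: eventually_mono intro: borel_measurable_integrable\<close>)
    then show ?thesis using SS3 S.prob_space by simp
  qed
  interpret SS: pair_prob_space ?S ?S ..
  have JS: "riesz_energy s V ?S = ereal (U R + 2 * w)"
  proof -
    have "AE z in ?S \<Otimes>\<^sub>M ?S. K z = ereal (k z + 2 * w)"
    proof -
      have 1: "AE z in ?S \<Otimes>\<^sub>M ?S. V (fst z) = ereal w"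
        by (rule SS.AE_pair_measure, measurable) (use V_sphere in \<open>auto elim: eventually_mono\<close>)
      have 2: "AE z in ?S \<Otimes>\<^sub>M ?S. V (snd z) = ereal w"
        by (rule SS.AE_pair_measure, measurable) (use V_sphere in \<open>auto elim: eventually_mono\<close>)
      show ?thesis using SS4 1 2
      proof eventually_elim
        case (elim z)
        then show ?case by (simp add: K_def case_prod_unfold riesz_kernel_eq k_def a_def)
      qed
    qed
    then have "riesz_energy s V ?S = ereal (\<integral>z. k z + 2 * w \<partial>(?S \<Otimes>\<^sub>M ?S))"
      unfolding J using SS1 by (intro ereal_integral_eq) auto
    also have "(\<integral>z. k z + 2 * w \<partial>(?S \<Otimes>\<^sub>M ?S)) = U R + 2 * w"
      using SS1 SS.prob_space ESS by (subst Bochner_Integration.integral_add) auto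
    finally show ?thesis .
  qed
  have main: "riesz_energy s V \<nu> \<ge> ereal (U R + 2 * w) \<and> (riesz_energy s V \<nu> = ereal (U R + 2 * w) \<longrightarrow> \<nu> = ?S)"
    if \<nu>: "sets \<nu> = sets borel" "prob_space \<nu>" for \<nu> :: "(real ^ 'd) measure"
  proof (cases "riesz_energy s V \<nu> < \<infinity>")
    case False
    then show ?thesis by auto
  next
    case True
    interpret \<nu>: prob_space \<nu> by fact
    note [measurable_cong] = \<nu>(1)
    interpret N: pair_prob_space \<nu> \<nu> ..
    have [measurable]: "K \<in> borel_measurable (\<nu> \<Otimes>\<^sub>M \<nu>)" unfolding K_def[abs_def] by measurable
    have [measurable]: "k \<in> borel_measurable (\<nu> \<Otimes>\<^sub>M \<nu>)" unfolding k_def[abs_def] by measurable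
    obtain g where g: "integrable (\<nu> \<Otimes>\<^sub>M \<nu>) g" "AE z in \<nu> \<Otimes>\<^sub>M \<nu>. K z = ereal (g z)"
      using ereal_integral_less_top[of _ K, OF N.prob_space_axioms _ K_ge_B True[unfolded J]] by auto
    have Jg: "riesz_energy s V \<nu> = ereal (\<integral>z. g z \<partial>(\<nu> \<Otimes>\<^sub>M \<nu>))"
      unfolding J by (rule ereal_integral_eq[OF g(2,1)])
    have le_g: "AE z in \<nu> \<Otimes>\<^sub>M \<nu>. k z + V0 (fst z) + V0 (snd z) \<le> g z"
      using g(2)
    proof eventually_elim
      case (elim z)
      then show ?case using K_ge[of z] by simp
    qed
    \<comment> \<open>For \<open>a \<ge> 0\<close> the kernel is infinite on the diagonal, so finite
      energy makes the diagonal a null set, and the default value of the profile there does not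
      matter.\<close>
    have diag: "a < 0 \<or> (AE z in \<nu> \<Otimes>\<^sub>M \<nu>. fst z \<noteq> snd z)"
    proof (cases "a < 0")
      case False
      have "AE z in \<nu> \<Otimes>\<^sub>M \<nu>. fst z \<noteq> snd z"
        using g(2)
      proof eventually_elim
        case (elim z)
        have "K z = \<infinity>" if "fst z = snd z"
          using that False V_ge[of "snd z"] by (auto simp: K_def case_prod_unfold riesz_kernel_def a_def)
        then show ?case using elim by auto
      qed
      then show ?thesis ..
    qed simp
    \<comment> \<open>Here confinement is used: the energy integrand dominates
      \<open>\<gamma> / 2\<close> times the sum of the squared norms, up to the constant
      \<open>B\<close>.\<close>
    have sq_int: "integrable (\<nu> \<Otimes>\<^sub>M \<nu>) (\<lambda>z. (norm (fst z))\<^sup>2 + (norm (snd z))\<^sup>2)"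
    proof (rule Bochner_Integration.integrable_bound)
      show "integrable (\<nu> \<Otimes>\<^sub>M \<nu>) (\<lambda>z. 2 / \<gamma> * (g z + B))" using g(1) by simp
      show "AE z in \<nu> \<Otimes>\<^sub>M \<nu>. norm ((norm (fst z))\<^sup>2 + (norm (snd z))\<^sup>2) \<le> norm (2 / \<gamma> * (g z + B))"
        using le_g
      proof eventually_elim
        case (elim z)
        have "(\<gamma> / 2) * ((norm (fst z))\<^sup>2 + (norm (snd z))\<^sup>2) \<le> g z + B" using low[of z] elim by simp
        then have "(norm (fst z))\<^sup>2 + (norm (snd z))\<^sup>2 \<le> 2 / \<gamma> * (g z + B)" using \<gamma> by (simp add: field_simps)
        also have "\<dots> \<le> \<bar>2 / \<gamma> * (g z + B)\<bar>" by (rule abs_ge_self)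
        finally show ?case by (simp only: real_norm_def abs_of_nonneg add_nonneg_nonneg zero_le_power2)
      qed
    qed measurable
    have fst_int: "integrable (\<nu> \<Otimes>\<^sub>M \<nu>) (\<lambda>z. (norm (fst z))\<^sup>2)" and snd_int: "integrable (\<nu> \<Otimes>\<^sub>M \<nu>) (\<lambda>z. (norm (snd z))\<^sup>2)"
      by (rule Bochner_Integration.integrable_bound[OF sq_int]; auto)+
    have dfst: "distr (\<nu> \<Otimes>\<^sub>M \<nu>) \<nu> fst = \<nu>" by (rule \<nu>.distr_pair_fst)
    have mom: "integrable \<nu> (\<lambda>x. (norm x)\<^sup>2)"
    proof -
      have "integrable (distr (\<nu> \<Otimes>\<^sub>M \<nu>) \<nu> fst) (\<lambda>x. (norm x)\<^sup>2)"
        using fst_int by (subst integrable_distr_eq) auto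
      then show ?thesis unfolding dfst .
    qed
    have V0_int: "integrable \<nu> V0" unfolding V0_def[abs_def] using mom by simp
    have V0_fst: "integrable (\<nu> \<Otimes>\<^sub>M \<nu>) (\<lambda>z. V0 (fst z))" "integrable (\<nu> \<Otimes>\<^sub>M \<nu>) (\<lambda>z. V0 (snd z))"
      unfolding V0_def using fst_int snd_int by simp_all
    have V0_val: "(\<integral>z. V0 (fst z) \<partial>(\<nu> \<Otimes>\<^sub>M \<nu>)) = (\<integral>x. V0 x \<partial>\<nu>)" "(\<integral>z. V0 (snd z) \<partial>(\<nu> \<Otimes>\<^sub>M \<nu>)) = (\<integral>x. V0 x \<partial>\<nu>)"
      using N.integral_fst'[OF V0_fst(1)] N.integral_fst'[OF V0_fst(2)] \<nu>.prob_space by simp_all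
    \<comment> \<open>The kernel lies between a quadratic lower bound and the energy integrand minus
      the minorants; both are integrable by now.\<close>
    have k_int: "integrable (\<nu> \<Otimes>\<^sub>M \<nu>) k"
    proof (rule Bochner_Integration.integrable_bound)
      show "integrable (\<nu> \<Otimes>\<^sub>M \<nu>) (\<lambda>z. \<bar>g z - V0 (fst z) - V0 (snd z)\<bar> + ((\<gamma> / 2) * ((norm (fst z))\<^sup>2 + (norm (snd z))\<^sup>2) + C))"
        using g(1) V0_fst sq_int by simp
      show "AE z in \<nu> \<Otimes>\<^sub>M \<nu>. norm (k z) \<le> norm (\<bar>g z - V0 (fst z) - V0 (snd z)\<bar> + ((\<gamma> / 2) * ((norm (fst z))\<^sup>2 + (norm (snd z))\<^sup>2) + C))"
        using le_g
      proof eventually_elim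
        case (elim z)
        define X where "X = (\<gamma> / 2) * ((norm (fst z))\<^sup>2 + (norm (snd z))\<^sup>2)"
        have "X \<ge> 0" using \<gamma> by (simp add: X_def)
        moreover have "k z \<ge> - X - C" using k_ge[of z] by (simp add: X_def)
        ultimately show ?case using elim C(1) unfolding X_def[symmetric] real_norm_def by linarith
      qed
    qed measurable
    note NS1 = riesz_energy_sphere_uniform(1)[OF s_gt s_le R_pos \<nu>(2,1) mom, folded a_def, folded k_def]
    note NS2 = riesz_energy_sphere_uniform(2)[OF s_gt s_le R_pos \<nu>(2,1) mom, of i, folded a_def, folded U_def]
    note NS3 = riesz_energy_sphere_uniform(3)[OF s_gt s_le R_pos \<nu>(2,1) mom, of i, folded a_def, folded k_def U_def]
    note NS4 = riesz_energy_sphere_uniform(4)[OF s_gt s_le R_pos \<nu>(2,1) mom]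
    define e where "e = (\<integral>z. k z \<partial>(\<nu> \<Otimes>\<^sub>M \<nu>)) - 2 * (\<integral>z. k z \<partial>(\<nu> \<Otimes>\<^sub>M ?S)) + (\<integral>z. k z \<partial>(?S \<Otimes>\<^sub>M ?S))"
    have pd: "e \<ge> 0" "e = 0 \<Longrightarrow> \<nu> = ?S"
      unfolding e_def k_def
      using riesz_energy_pos_def[OF \<nu>(2,1) prob_space_sphere_uniform sets_sphere_uniform a k_int[unfolded k_def] NS1[unfolded k_def] SS1[unfolded k_def] diag]
        NS4 SS4 by blast+
    \<comment> \<open>The Euler-Lagrange inequality integrated against \<open>\<nu>\<close>; by
      Fubini's theorem the potential integrates to the cross energy.\<close>
    have gap: "(\<integral>z. k z \<partial>(\<nu> \<Otimes>\<^sub>M ?S)) + (\<integral>x. V0 x \<partial>\<nu>) \<ge> U R + w"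
    proof -
      have "(\<integral>x. U R + w \<partial>\<nu>) \<le> (\<integral>x. U (norm x) + V0 x \<partial>\<nu>)"
        using NS2 V0_int EL by (intro integral_mono) auto
      then show ?thesis using NS2 NS3 V0_int \<nu>.prob_space by simp
    qed
    have "(\<integral>z. k z \<partial>(\<nu> \<Otimes>\<^sub>M \<nu>)) + 2 * (\<integral>x. V0 x \<partial>\<nu>) = (\<integral>z. k z + V0 (fst z) + V0 (snd z) \<partial>(\<nu> \<Otimes>\<^sub>M \<nu>))"
      using k_int V0_fst V0_val by simp
    also have "\<dots> \<le> (\<integral>z. g z \<partial>(\<nu> \<Otimes>\<^sub>M \<nu>))"
      using k_int V0_fst g(1) le_g by (intro integral_mono_AE) auto
    finally have le: "(\<integral>z. k z \<partial>(\<nu> \<Otimes>\<^sub>M \<nu>)) + 2 * (\<integral>x. V0 x \<partial>\<nu>) \<le> (\<integral>z. g z \<partial>(\<nu> \<Otimes>\<^sub>M \<nu>))" .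
    \<comment> \<open>The energy of \<open>\<nu>\<close> in the minorant field is \<open>e\<close>
      plus twice the left-hand side of \<open>gap\<close> minus the self-energy \<open>U R\<close>
      of the sphere. Equality therefore forces \<open>e = 0\<close>, which is the uniqueness case of
      positive definiteness.\<close>
    have "U R + 2 * w + e \<le> (\<integral>z. g z \<partial>(\<nu> \<Otimes>\<^sub>M \<nu>))"
      using le gap ESS unfolding e_def by linarith
    then show ?thesis unfolding Jg using pd by auto
  qed
  have mem: "?S \<in> borel_probability_measures" by (rule sphere_uniform_in_borel_probability_measures)
  have min: "is_energy_minimizer s V ?S"
    unfolding is_energy_minimizer_def JS using main mem by (auto simp: borel_probability_measures_def)
  have "\<nu> = ?S" if "is_energy_minimizer s V \<nu>" for \<nu>
  proof -
    have \<nu>: "sets \<nu> = sets borel" "prob_space \<nu>" and "riesz_energy s V \<nu> \<le> riesz_energy s V ?S"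
      using that mem unfolding is_energy_minimizer_def by (auto simp: borel_probability_measures_def)
    then have "riesz_energy s V \<nu> = ereal (U R + 2 * w)"
      using main[OF \<nu>] unfolding JS by (intro antisym) auto
    then show ?thesis using main[OF \<nu>] by blast
  qed
  with min show ?thesis unfolding is_equilibrium_measure_def V_def by blast
qed

end
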